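(* Let $(R,\mathfrak{m})$ be a local ring with $\operatorname{depth}(R)\geq 1$, and let $I$ be an $\mathfrak{m}$-primary ideal of $R$ satisfying the following condition: if $X$ is a finitely generated $R$-module and $\operatorname{Tor}^R_t(X,R/I)=0$ for some integer $t\geq 0$, then $\operatorname{pd}_R(X)<t$. Then $H^1_{\mathfrak{m}}(M\otimes_RI)\neq0$ for each nonzero finitely generated $R$-module $M$ that is locally free on the punctured spectrum of $R$ and satisfies $\operatorname{depth}_R(M)\geq 1$.
   Context: Rings are commutative Noetherian. $M$ is locally free on the punctured spectrum of $R$ if $M_\mathfrak{p}$ is free over $R_\mathfrak{p}$ for every prime $\mathfrak{p}\neq\mathfrak{m}$. $\operatorname{pd}$ denotes projective dimension (with $\operatorname{pd}_R(0)=-\infty$), and $H^i_{\mathfrak{m}}$ is local cohomology with support in $\mathfrak{m}$. *)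

theory Defs
  imports
    "HOL-Algebra.Ring_Divisibility"
    "HOL-Algebra.Ideal_Product"
    "HOL-Algebra.Module"
    "HOL-Library.Extended_Real"
begin

text \<open>
  HOL cannot quantify over types inside a formula, so resolutions and test modules need a fixed
  carrier type. The finitely branching trees with leaves in a type are infinite in number
  and closed under forming finite lists. Hence every module over a ring of type \<open>'a\<close> that has at most
  max(card \<open>'a\<close>, card \<open>'b\<close>, aleph-0) elements is isomorphic to one carried by a subset of
  \<open>('a + 'b) tree\<close>. For a module \<open>M\<close> with elements of type \<open>'b\<close>, this covers all finitely generated
  modules, the free module on \<open>M\<close> and all its submodules and quotients, hence a projective
  resolution of \<open>M\<close>; over a Noetherian ring it also covers an injective resolution of \<open>M\<close>, since such
  a module embeds in an injective module obeying the same cardinality bound.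
\<close>

datatype 'x tree = Leaf 'x | Node "'x tree list"


section \<open>Modules\<close>

definition mod_hom ::
  "('a, 'r) ring_scheme \<Rightarrow> ('a, 'b, 'm) module_scheme \<Rightarrow> ('a, 'c, 'n) module_scheme \<Rightarrow> ('b \<Rightarrow> 'c) set"
  where "mod_hom R M N = {h \<in> carrier M \<rightarrow> carrier N.
    (\<forall>x\<in>carrier M. \<forall>y\<in>carrier M. h (x \<oplus>\<^bsub>M\<^esub> y) = h x \<oplus>\<^bsub>N\<^esub> h y) \<and>
    (\<forall>a\<in>carrier R. \<forall>x\<in>carrier M. h (a \<odot>\<^bsub>M\<^esub> x) = a \<odot>\<^bsub>N\<^esub> h x)}"

definition zero_module :: "('a, 'b, 'm) module_scheme \<Rightarrow> bool"
  where "zero_module M \<longleftrightarrow> carrier M = {\<zero>\<^bsub>M\<^esub>}"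

definition submodule_gen ::
  "('a, 'r) ring_scheme \<Rightarrow> ('a, 'b, 'm) module_scheme \<Rightarrow> 'b set \<Rightarrow> 'b set"
  where "submodule_gen R M A = \<Inter>{K. submodule K R M \<and> A \<subseteq> K}"

definition fin_gen_module :: "('a, 'r) ring_scheme \<Rightarrow> ('a, 'b, 'm) module_scheme \<Rightarrow> bool"
  where "fin_gen_module R M \<longleftrightarrow>
    module R M \<and> (\<exists>A. finite A \<and> A \<subseteq> carrier M \<and> submodule_gen R M A = carrier M)"

text \<open>
  The locale \<^locale>\<open>module\<close> ignores the multiplicative fields of a module record; they are left
  unspecified below.
\<close>

definition quotient_module :: "('a, 'b, 'm) module_scheme \<Rightarrow> 'b set \<Rightarrow> ('a, 'b set) module"
  where "quotient_module M K =
    \<lparr>carrier = a_rcosets\<^bsub>M\<^esub> K, mult = undefined, one = undefined, zero = K, add = set_add M,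
     smult = (\<lambda>a C. \<Union>x\<in>C. K +>\<^bsub>M\<^esub> (a \<odot>\<^bsub>M\<^esub> x))\<rparr>"

definition self_module :: "('a, 'r) ring_scheme \<Rightarrow> ('a, 'a) module"
  where "self_module R =
    \<lparr>carrier = carrier R, mult = mult R, one = \<one>\<^bsub>R\<^esub>, zero = \<zero>\<^bsub>R\<^esub>, add = add R, smult = mult R\<rparr>"

definition ideal_module :: "('a, 'r) ring_scheme \<Rightarrow> 'a set \<Rightarrow> ('a, 'a) module"
  where "ideal_module R I = (self_module R)\<lparr>carrier := I\<rparr>"

definition free_module :: "('a, 'r) ring_scheme \<Rightarrow> 'x set \<Rightarrow> ('a, 'x \<Rightarrow> 'a) module"
  where "free_module R S =
    \<lparr>carrier = {f. (\<forall>x. f x \<in> carrier R) \<and> (\<forall>x. x \<notin> S \<longrightarrow> f x = \<zero>\<^bsub>R\<^esub>) \<and> finite {x. f x \<noteq> \<zero>\<^bsub>R\<^esub>}},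
     mult = undefined, one = undefined, zero = (\<lambda>x. \<zero>\<^bsub>R\<^esub>),
     add = (\<lambda>f g x. f x \<oplus>\<^bsub>R\<^esub> g x), smult = (\<lambda>a f x. a \<otimes>\<^bsub>R\<^esub> f x)\<rparr>"

definition single :: "('a, 'r) ring_scheme \<Rightarrow> 'x \<Rightarrow> 'x \<Rightarrow> 'a"
  where "single R p = (\<lambda>q. if q = p then \<one>\<^bsub>R\<^esub> else \<zero>\<^bsub>R\<^esub>)"

definition is_free_module :: "('a, 'r) ring_scheme \<Rightarrow> ('a, 'b, 'm) module_scheme \<Rightarrow> bool"
  where "is_free_module R M \<longleftrightarrow> module R M \<and>
    (\<exists>B\<subseteq>carrier M. \<forall>x\<in>carrier M. \<exists>!c. c \<in> carrier (free_module R B) \<and>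
       x = (\<Oplus>\<^bsub>M\<^esub>b\<in>{b. c b \<noteq> \<zero>\<^bsub>R\<^esub>}. c b \<odot>\<^bsub>M\<^esub> b))"


section \<open>Tensor products\<close>

definition bilinear_relations ::
  "('a, 'r) ring_scheme \<Rightarrow> ('a, 'b, 'm) module_scheme \<Rightarrow> ('a, 'c, 'n) module_scheme \<Rightarrow> ('b \<times> 'c \<Rightarrow> 'a) set"
  where "bilinear_relations R M N = (let F = free_module R (carrier M \<times> carrier N) in
    {single R (x \<oplus>\<^bsub>M\<^esub> x', y) \<ominus>\<^bsub>F\<^esub> (single R (x, y) \<oplus>\<^bsub>F\<^esub> single R (x', y)) | x x' y.
       x \<in> carrier M \<and> x' \<in> carrier M \<and> y \<in> carrier N} \<union>
    {single R (x, y \<oplus>\<^bsub>N\<^esub> y') \<ominus>\<^bsub>F\<^esub> (single R (x, y) \<oplus>\<^bsub>F\<^esub> single R (x, y')) | x y y'.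
       x \<in> carrier M \<and> y \<in> carrier N \<and> y' \<in> carrier N} \<union>
    {single R (a \<odot>\<^bsub>M\<^esub> x, y) \<ominus>\<^bsub>F\<^esub> (a \<odot>\<^bsub>F\<^esub> single R (x, y)) | a x y.
       a \<in> carrier R \<and> x \<in> carrier M \<and> y \<in> carrier N} \<union>
    {single R (x, a \<odot>\<^bsub>N\<^esub> y) \<ominus>\<^bsub>F\<^esub> (a \<odot>\<^bsub>F\<^esub> single R (x, y)) | a x y.
       a \<in> carrier R \<and> x \<in> carrier M \<and> y \<in> carrier N})"

definition tensor_kernel ::
  "('a, 'r) ring_scheme \<Rightarrow> ('a, 'b, 'm) module_scheme \<Rightarrow> ('a, 'c, 'n) module_scheme \<Rightarrow> ('b \<times> 'c \<Rightarrow> 'a) set"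
  where "tensor_kernel R M N =
    submodule_gen R (free_module R (carrier M \<times> carrier N)) (bilinear_relations R M N)"

definition tensor_product ::
  "('a, 'r) ring_scheme \<Rightarrow> ('a, 'b, 'm) module_scheme \<Rightarrow> ('a, 'c, 'n) module_scheme
    \<Rightarrow> ('a, ('b \<times> 'c \<Rightarrow> 'a) set) module"
  where "tensor_product R M N =
    quotient_module (free_module R (carrier M \<times> carrier N)) (tensor_kernel R M N)"

definition pure_tensor ::
  "('a, 'r) ring_scheme \<Rightarrow> ('a, 'b, 'm) module_scheme \<Rightarrow> ('a, 'c, 'n) module_scheme
    \<Rightarrow> 'b \<Rightarrow> 'c \<Rightarrow> ('b \<times> 'c \<Rightarrow> 'a) set"
  where "pure_tensor R M N x y =
    tensor_kernel R M N +>\<^bsub>free_module R (carrier M \<times> carrier N)\<^esub> single R (x, y)"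

text \<open>
  The map \<open>f \<otimes> N\<close>. Pure tensors generate, so its values on the carrier of \<open>M \<otimes> N\<close> are uniquely
  determined.
\<close>

definition tensor_map ::
  "('a, 'r) ring_scheme \<Rightarrow> ('a, 'b, 'm) module_scheme \<Rightarrow> ('a, 'd, 'k) module_scheme
    \<Rightarrow> ('a, 'c, 'n) module_scheme \<Rightarrow> ('b \<Rightarrow> 'd) \<Rightarrow> ('b \<times> 'c \<Rightarrow> 'a) set \<Rightarrow> ('d \<times> 'c \<Rightarrow> 'a) set"
  where "tensor_map R M M' N f =
    (SOME h. h \<in> mod_hom R (tensor_product R M N) (tensor_product R M' N) \<and>
       (\<forall>x\<in>carrier M. \<forall>y\<in>carrier N. h (pure_tensor R M N x y) = pure_tensor R M' N (f x) y))"


section \<open>Homology of complexes\<close>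

text \<open>Chain complexes have differentials \<open>d n : C (n + 1) \<rightarrow> C n\<close>, with \<open>C\<close> zero in negative degrees.\<close>

definition homology ::
  "(nat \<Rightarrow> ('a, 'b) module) \<Rightarrow> (nat \<Rightarrow> 'b \<Rightarrow> 'b) \<Rightarrow> nat \<Rightarrow> ('a, 'b set) module"
  where "homology C d n = quotient_module
    ((C n)\<lparr>carrier :=
       (case n of 0 \<Rightarrow> carrier (C 0) | Suc k \<Rightarrow> {x \<in> carrier (C (Suc k)). d k x = \<zero>\<^bsub>C k\<^esub>})\<rparr>)
    (d n ` carrier (C (Suc n)))"

text \<open>Cochain complexes have differentials \<open>d n : C n \<rightarrow> C (n + 1)\<close>, with \<open>C\<close> zero in negative degrees.\<close>

definition cohomology ::
  "(nat \<Rightarrow> ('a, 'b) module) \<Rightarrow> (nat \<Rightarrow> 'b \<Rightarrow> 'b) \<Rightarrow> nat \<Rightarrow> ('a, 'b set) module"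
  where "cohomology C d n = quotient_module
    ((C n)\<lparr>carrier := {x \<in> carrier (C n). d n x = \<zero>\<^bsub>C (Suc n)\<^esub>}\<rparr>)
    (case n of 0 \<Rightarrow> {\<zero>\<^bsub>C 0\<^esub>} | Suc k \<Rightarrow> d k ` carrier (C k))"


section \<open>Projective resolutions, Tor and projective dimension\<close>

text \<open>
  The type of the test modules admits a copy of the free module on \<open>P\<close> and of \<open>P\<close> itself. Lifting
  the identity of \<open>P\<close> along the canonical surjection exhibits \<open>P\<close> as a direct summand of a free module,
  so the lifting property holds against all surjections.
\<close>

definition projective_module :: "('a, 'r) ring_scheme \<Rightarrow> ('a, 'p, 'm) module_scheme \<Rightarrow> bool"
  where "projective_module R P \<longleftrightarrow> module R P \<and>
    (\<forall>(N :: ('a, ('a + 'p) tree) module) (N' :: ('a, ('a + 'p) tree) module) g f.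
       module R N \<and> module R N' \<and> g \<in> mod_hom R N N' \<and> g ` carrier N = carrier N' \<and>
       f \<in> mod_hom R P N' \<longrightarrow>
       (\<exists>h\<in>mod_hom R P N. \<forall>x\<in>carrier P. g (h x) = f x))"

definition projective_resolution ::
  "('a, 'r) ring_scheme \<Rightarrow> ('a, 'b, 'm) module_scheme \<Rightarrow> (nat \<Rightarrow> ('a, 'p) module)
    \<Rightarrow> (nat \<Rightarrow> 'p \<Rightarrow> 'p) \<Rightarrow> ('p \<Rightarrow> 'b) \<Rightarrow> bool"
  where "projective_resolution R X P d e \<longleftrightarrow>
    (\<forall>n. projective_module R (P n)) \<and>
    (\<forall>n. d n \<in> mod_hom R (P (Suc n)) (P n)) \<and>
    e \<in> mod_hom R (P 0) X \<and>
    e ` carrier (P 0) = carrier X \<and>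
    {x \<in> carrier (P 0). e x = \<zero>\<^bsub>X\<^esub>} = d 0 ` carrier (P 1) \<and>
    (\<forall>n. {x \<in> carrier (P (Suc n)). d n x = \<zero>\<^bsub>P n\<^esub>} = d (Suc n) ` carrier (P (Suc (Suc n))))"

definition Tor ::
  "('a, 'r) ring_scheme \<Rightarrow> nat \<Rightarrow> ('a, 'b, 'm) module_scheme \<Rightarrow> ('a, 'c, 'n) module_scheme
    \<Rightarrow> ('a, (('a + 'b) tree \<times> 'c \<Rightarrow> 'a) set set) module"
  where "Tor R t X N =
    (let (P, d, e) = (SOME (P :: nat \<Rightarrow> ('a, ('a + 'b) tree) module, d, e).
                        projective_resolution R X P d e)
     in homology (\<lambda>n. tensor_product R (P n) N) (\<lambda>n. tensor_map R (P (Suc n)) (P n) N (d n)) t)"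

definition proj_dim :: "('a, 'r) ring_scheme \<Rightarrow> ('a, 'b, 'm) module_scheme \<Rightarrow> ereal"
  where "proj_dim R X =
    (if zero_module X then -\<infinity>
     else Inf {ereal (real n) | n. \<exists>(P :: nat \<Rightarrow> ('a, ('a + 'b) tree) module) d e.
                 projective_resolution R X P d e \<and> (\<forall>i>n. zero_module (P i))})"


section \<open>Injective resolutions and local cohomology\<close>

text \<open>
  The type of the test modules admits copies of \<open>R\<close> and all its ideals, so by Baer's criterion
  the extension property holds for all module monomorphisms.
\<close>

definition injective_module :: "('a, 'r) ring_scheme \<Rightarrow> ('a, 'e, 'm) module_scheme \<Rightarrow> bool"
  where "injective_module R E \<longleftrightarrow> module R E \<and>
    (\<forall>(N :: ('a, ('a + 'e) tree) module) (N' :: ('a, ('a + 'e) tree) module) i f.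
       module R N \<and> module R N' \<and> i \<in> mod_hom R N N' \<and> inj_on i (carrier N) \<and>
       f \<in> mod_hom R N E \<longrightarrow>
       (\<exists>h\<in>mod_hom R N' E. \<forall>x\<in>carrier N. h (i x) = f x))"

definition injective_resolution ::
  "('a, 'r) ring_scheme \<Rightarrow> ('a, 'b, 'm) module_scheme \<Rightarrow> (nat \<Rightarrow> ('a, 'e) module)
    \<Rightarrow> (nat \<Rightarrow> 'e \<Rightarrow> 'e) \<Rightarrow> ('b \<Rightarrow> 'e) \<Rightarrow> bool"
  where "injective_resolution R N E d e \<longleftrightarrow>
    (\<forall>n. injective_module R (E n)) \<and>
    (\<forall>n. d n \<in> mod_hom R (E n) (E (Suc n))) \<and>
    e \<in> mod_hom R N (E 0) \<and>
    inj_on e (carrier N) \<and>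
    {x \<in> carrier (E 0). d 0 x = \<zero>\<^bsub>E 1\<^esub>} = e ` carrier N \<and>
    (\<forall>n. {x \<in> carrier (E (Suc n)). d (Suc n) x = \<zero>\<^bsub>E (Suc (Suc n))\<^esub>} = d n ` carrier (E n))"

definition torsion_submodule ::
  "('a, 'r) ring_scheme \<Rightarrow> 'a set \<Rightarrow> ('a, 'b) module \<Rightarrow> ('a, 'b) module"
  where "torsion_submodule R J E =
    E\<lparr>carrier := {x \<in> carrier E. \<exists>n::nat. \<forall>a\<in>J [^]\<^bsub>ideals_set R\<^esub> n. a \<odot>\<^bsub>E\<^esub> x = \<zero>\<^bsub>E\<^esub>}\<rparr>"

text \<open>
  The \<open>i\<close>-th right derived functor of the \<open>J\<close>-torsion functor, for \<open>R\<close> Noetherian: there an injective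
  resolution exists in the type chosen here.
\<close>

definition local_cohomology ::
  "('a, 'r) ring_scheme \<Rightarrow> 'a set \<Rightarrow> nat \<Rightarrow> ('a, 'b, 'm) module_scheme
    \<Rightarrow> ('a, ('a + 'b) tree set) module"
  where "local_cohomology R J i N =
    (let (E, d, e) = (SOME (E :: nat \<Rightarrow> ('a, ('a + 'b) tree) module, d, e).
                        injective_resolution R N E d e)
     in cohomology (\<lambda>n. torsion_submodule R J (E n)) d i)"


section \<open>Local rings, primary ideals and depth\<close>

definition noetherian_local_ring :: "('a, 'r) ring_scheme \<Rightarrow> 'a set \<Rightarrow> bool"
  where "noetherian_local_ring R \<mm> \<longleftrightarrow> cring R \<and> noetherian_ring R \<and>
    maximalideal \<mm> R \<and> (\<forall>J. maximalideal J R \<longrightarrow> J = \<mm>)"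

definition radical :: "('a, 'r) ring_scheme \<Rightarrow> 'a set \<Rightarrow> 'a set"
  where "radical R I = {x \<in> carrier R. \<exists>n::nat. x [^]\<^bsub>R\<^esub> n \<in> I}"

definition primary_ideal :: "('a, 'r) ring_scheme \<Rightarrow> 'a set \<Rightarrow> bool"
  where "primary_ideal R I \<longleftrightarrow> ideal I R \<and> I \<noteq> carrier R \<and>
    (\<forall>a\<in>carrier R. \<forall>b\<in>carrier R. a \<otimes>\<^bsub>R\<^esub> b \<in> I \<longrightarrow> a \<in> I \<or> b \<in> radical R I)"

definition ideal_smult ::
  "('a, 'r) ring_scheme \<Rightarrow> 'a set \<Rightarrow> ('a, 'b, 'm) module_scheme \<Rightarrow> 'b set"
  where "ideal_smult R J M = submodule_gen R M {a \<odot>\<^bsub>M\<^esub> x | a x. a \<in> J \<and> x \<in> carrier M}"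

definition nonzerodivisor_on :: "('a, 'b, 'm) module_scheme \<Rightarrow> 'a \<Rightarrow> bool"
  where "nonzerodivisor_on M a \<longleftrightarrow> (\<forall>x\<in>carrier M. a \<odot>\<^bsub>M\<^esub> x = \<zero>\<^bsub>M\<^esub> \<longrightarrow> x = \<zero>\<^bsub>M\<^esub>)"

definition regular_sequence :: "('a, 'r) ring_scheme \<Rightarrow> ('a, 'b, 'm) module_scheme \<Rightarrow> 'a list \<Rightarrow> bool"
  where "regular_sequence R M xs \<longleftrightarrow> set xs \<subseteq> carrier R \<and>
    (\<forall>i<length xs. nonzerodivisor_on
       (quotient_module M (ideal_smult R (Idl\<^bsub>R\<^esub> (set (take i xs))) M)) (xs ! i)) \<and>
    \<not> zero_module (quotient_module M (ideal_smult R (Idl\<^bsub>R\<^esub> (set xs)) M))"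

text \<open>Depth with respect to the maximal ideal, for finitely generated modules; the zero module has depth \<open>\<infinity>\<close>.\<close>

definition depth :: "('a, 'r) ring_scheme \<Rightarrow> 'a set \<Rightarrow> ('a, 'b, 'm) module_scheme \<Rightarrow> enat"
  where "depth R \<mm> M = (if zero_module M then \<infinity>
    else Sup {enat (length xs) | xs. set xs \<subseteq> \<mm> \<and> regular_sequence R M xs})"


section \<open>Localization\<close>

definition fraction_rel ::
  "'a set \<Rightarrow> ('a, 'b, 'm) module_scheme \<Rightarrow> (('b \<times> 'a) \<times> ('b \<times> 'a)) set"
  where "fraction_rel S M = {((x, s), (y, t)) | x s y t.
    x \<in> carrier M \<and> y \<in> carrier M \<and> s \<in> S \<and> t \<in> S \<and>
    (\<exists>u\<in>S. u \<odot>\<^bsub>M\<^esub> (t \<odot>\<^bsub>M\<^esub> x) = u \<odot>\<^bsub>M\<^esub> (s \<odot>\<^bsub>M\<^esub> y))}"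

definition fraction :: "'a set \<Rightarrow> ('a, 'b, 'm) module_scheme \<Rightarrow> 'b \<Rightarrow> 'a \<Rightarrow> ('b \<times> 'a) set"
  where "fraction S M x s = fraction_rel S M `` {(x, s)}"

definition localization_ring :: "('a, 'r) ring_scheme \<Rightarrow> 'a set \<Rightarrow> ('a \<times> 'a) set ring"
  where "localization_ring R S = (let q = fraction S (self_module R) in
    \<lparr>carrier = (carrier R \<times> S) // fraction_rel S (self_module R),
     mult = (\<lambda>A B. \<Union>(x, s)\<in>A. \<Union>(y, t)\<in>B. q (x \<otimes>\<^bsub>R\<^esub> y) (s \<otimes>\<^bsub>R\<^esub> t)),
     one = q \<one>\<^bsub>R\<^esub> \<one>\<^bsub>R\<^esub>,
     zero = q \<zero>\<^bsub>R\<^esub> \<one>\<^bsub>R\<^esub>,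
     add = (\<lambda>A B. \<Union>(x, s)\<in>A. \<Union>(y, t)\<in>B.
              q ((t \<otimes>\<^bsub>R\<^esub> x) \<oplus>\<^bsub>R\<^esub> (s \<otimes>\<^bsub>R\<^esub> y)) (s \<otimes>\<^bsub>R\<^esub> t))\<rparr>)"

definition localization_module ::
  "('a, 'r) ring_scheme \<Rightarrow> 'a set \<Rightarrow> ('a, 'b, 'm) module_scheme
    \<Rightarrow> (('a \<times> 'a) set, ('b \<times> 'a) set) module"
  where "localization_module R S M = (let q = fraction S M in
    \<lparr>carrier = (carrier M \<times> S) // fraction_rel S M,
     mult = undefined, one = undefined,
     zero = q \<zero>\<^bsub>M\<^esub> \<one>\<^bsub>R\<^esub>,
     add = (\<lambda>A B. \<Union>(x, s)\<in>A. \<Union>(y, t)\<in>B.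
              q ((t \<odot>\<^bsub>M\<^esub> x) \<oplus>\<^bsub>M\<^esub> (s \<odot>\<^bsub>M\<^esub> y)) (s \<otimes>\<^bsub>R\<^esub> t)),
     smult = (\<lambda>A B. \<Union>(a, s)\<in>A. \<Union>(y, t)\<in>B. q (a \<odot>\<^bsub>M\<^esub> y) (s \<otimes>\<^bsub>R\<^esub> t))\<rparr>)"

definition locally_free_on_punctured_spectrum ::
  "('a, 'r) ring_scheme \<Rightarrow> 'a set \<Rightarrow> ('a, 'b, 'm) module_scheme \<Rightarrow> bool"
  where "locally_free_on_punctured_spectrum R \<mm> M \<longleftrightarrow>
    (\<forall>p. primeideal p R \<and> p \<noteq> \<mm> \<longrightarrow>
       is_free_module (localization_ring R (carrier R - p)) (localization_module R (carrier R - p) M))"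

end

theory Submission
  imports Defs "HOL-Algebra.IntRing" "HOL-Library.Countable"
begin

text \<open>
  Let \<open>N\<close> be the tensor product of \<open>M\<close> and \<open>I\<close>, and suppose that the first local cohomology of \<open>N\<close> vanishes.
  Each \<open>y \<in> M\<close> gives a homomorphism \<open>a \<mapsto> y \<otimes> a\<close> from \<open>I\<close> to \<open>N\<close>. Since \<open>I\<close> contains a power of the maximal ideal
  (lemma \<open>noetherian_power_subset\<close>), this is a section of \<open>N\<close> on the punctured spectrum, and vanishing of
  the cohomology extends it: there is \<open>w \<in> N\<close> with \<open>y \<otimes> a = a w\<close> for all \<open>a\<close> in some power of the maximal
  ideal (lemma \<open>local_cohomology_1_zero_extends\<close>). The multiplication map \<open>\<phi>\<close> from \<open>N\<close> to \<open>M\<close> turns this into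
  \<open>a y = a \<phi>(w)\<close>. As \<open>M\<close> has positive depth, the maximal ideal contains a nonzerodivisor \<open>x\<close> on \<open>M\<close>; taking for
  \<open>a\<close> a power of \<open>x\<close> gives \<open>y = \<phi>(w)\<close>, an element of \<open>I M\<close>. Hence \<open>M = I M\<close>, and \<open>M = 0\<close> by Nakayama's lemma.

  Local cohomology is defined by choosing an injective resolution whose terms are all carried by one
  type, so the argument also needs a resolution to exist there. A module \<open>N\<close> embeds in
  the injective module of additive maps from \<open>R\<close> to \<open>D\<close>, where \<open>D\<close> is a divisible group containing \<open>N\<close> (lemmas
  \<open>divisible_embedding\<close>, \<open>coinduced_module_baer\<close> and \<open>enough_injectives\<close>). If \<open>\<kappa>\<close> is an infinite cardinal
  bounding \<open>N\<close>, then \<open>D\<close> has at most \<open>\<kappa>\<close> elements and the module of maps at most \<open>\<kappa>\<close> to the power of the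
  cardinality of \<open>R\<close>. The iteration therefore stays inside a type of cardinality \<open>\<kappa>\<close> as soon as that power is again \<open>\<kappa>\<close>.
  This holds for the type at hand, because the elements of a tensor product are sets of functions and
  \<open>R\<close> is infinite (lemmas \<open>tree_type_absorbs_functions\<close> and \<open>infinite_ring_of_nonzerodivisor\<close>).
\<close>

section \<open>Homomorphisms, quotients and transport of structure\<close>

lemma (in abelian_group) minus_eq_zero_iff:
  assumes "x \<in> carrier G" "y \<in> carrier G"
  shows "x \<ominus> y = \<zero> \<longleftrightarrow> x = y"
  using assms minus_equality[of x "\<ominus> y"] by (auto simp: a_minus_def r_neg)

lemma mod_homI:
  assumes "\<And>x. x \<in> carrier M \<Longrightarrow> h x \<in> carrier N"
    and "\<And>x y. x \<in> carrier M \<Longrightarrow> y \<in> carrier M \<Longrightarrow> h (x \<oplus>\<^bsub>M\<^esub> y) = h x \<oplus>\<^bsub>N\<^esub> h y"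
    and "\<And>a x. a \<in> carrier R \<Longrightarrow> x \<in> carrier M \<Longrightarrow> h (a \<odot>\<^bsub>M\<^esub> x) = a \<odot>\<^bsub>N\<^esub> h x"
  shows "h \<in> mod_hom R M N"
  using assms unfolding mod_hom_def by auto

lemma mod_homD:
  assumes "h \<in> mod_hom R M N"
  shows "x \<in> carrier M \<Longrightarrow> h x \<in> carrier N"
    and "x \<in> carrier M \<Longrightarrow> y \<in> carrier M \<Longrightarrow> h (x \<oplus>\<^bsub>M\<^esub> y) = h x \<oplus>\<^bsub>N\<^esub> h y"
    and "a \<in> carrier R \<Longrightarrow> x \<in> carrier M \<Longrightarrow> h (a \<odot>\<^bsub>M\<^esub> x) = a \<odot>\<^bsub>N\<^esub> h x"
  using assms unfolding mod_hom_def by auto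

lemma mod_hom_zero:
  assumes "module R M" "module R N" "h \<in> mod_hom R M N"
  shows "h \<zero>\<^bsub>M\<^esub> = \<zero>\<^bsub>N\<^esub>"
proof -
  interpret M: module R M by fact
  interpret N: module R N by fact
  have "h (\<zero>\<^bsub>R\<^esub> \<odot>\<^bsub>M\<^esub> \<zero>\<^bsub>M\<^esub>) = \<zero>\<^bsub>R\<^esub> \<odot>\<^bsub>N\<^esub> h \<zero>\<^bsub>M\<^esub>"
    using assms(3) by (intro mod_homD(3)) auto
  then show ?thesis using mod_homD(1)[OF assms(3)] by simp
qed

lemma mod_hom_uminus:
  assumes "module R M" "module R N" "h \<in> mod_hom R M N" "x \<in> carrier M"
  shows "h (\<ominus>\<^bsub>M\<^esub> x) = \<ominus>\<^bsub>N\<^esub> h x"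
proof -
  interpret M: module R M by fact
  interpret N: module R N by fact
  have "h ((\<ominus>\<^bsub>R\<^esub> \<one>\<^bsub>R\<^esub>) \<odot>\<^bsub>M\<^esub> x) = (\<ominus>\<^bsub>R\<^esub> \<one>\<^bsub>R\<^esub>) \<odot>\<^bsub>N\<^esub> h x"
    using assms(3,4) by (intro mod_homD(3)) auto
  then show ?thesis using mod_homD(1)[OF assms(3,4)] assms(4)
    by (simp add: M.smult_l_minus N.smult_l_minus)
qed

lemma mod_hom_minus:
  assumes "module R M" "module R N" "h \<in> mod_hom R M N" "x \<in> carrier M" "y \<in> carrier M"
  shows "h (x \<ominus>\<^bsub>M\<^esub> y) = h x \<ominus>\<^bsub>N\<^esub> h y"
proof -
  interpret M: module R M by fact
  show ?thesis
    using assms by (simp add: a_minus_def mod_homD(2) mod_hom_uminus)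
qed

lemma mod_hom_comp:
  assumes "f \<in> mod_hom R L M" "g \<in> mod_hom R M N"
  shows "(\<lambda>x. g (f x)) \<in> mod_hom R L N"
  using mod_homD[OF assms(1)] mod_homD[OF assms(2)] by (intro mod_homI) auto

lemma mod_hom_inj_onI:
  assumes "module R M" "module R N" "h \<in> mod_hom R M N"
    and ker: "\<And>x. x \<in> carrier M \<Longrightarrow> h x = \<zero>\<^bsub>N\<^esub> \<Longrightarrow> x = \<zero>\<^bsub>M\<^esub>"
  shows "inj_on h (carrier M)"
proof (rule inj_onI)
  interpret M: module R M by fact
  interpret N: module R N by fact
  fix x y assume xy: "x \<in> carrier M" "y \<in> carrier M" "h x = h y"
  then have "h (x \<ominus>\<^bsub>M\<^esub> y) = \<zero>\<^bsub>N\<^esub>"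
    using mod_homD(1)[OF assms(3)] assms(1-3) by (simp add: mod_hom_minus N.minus_eq_zero_iff)
  then show "x = y" using ker[of "x \<ominus>\<^bsub>M\<^esub> y"] xy M.minus_eq_zero_iff by simp
qed

lemma kernel_submodule:
  assumes "module R M" "module R N" "h \<in> mod_hom R M N"
  shows "submodule {x \<in> carrier M. h x = \<zero>\<^bsub>N\<^esub>} R M"
proof -
  interpret M: module R M by fact
  interpret N: module R N by fact
  show ?thesis
    using assms mod_homD[OF assms(3)]
    by (intro M.submoduleI) (auto simp: mod_hom_zero mod_hom_uminus)
qed

lemma image_submodule:
  assumes "module R M" "module R N" "h \<in> mod_hom R M N"
  shows "submodule (h ` carrier M) R N"
proof -
  interpret M: module R M by fact
  interpret N: module R N by fact
  show ?thesis
  proof (rule N.submoduleI)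
    show "\<zero>\<^bsub>N\<^esub> \<in> h ` carrier M"
      using mod_hom_zero[OF assms] M.zero_closed by force
    fix a assume "a \<in> h ` carrier M"
    then show "\<ominus>\<^bsub>N\<^esub> a \<in> h ` carrier M"
      using mod_hom_uminus[OF assms, symmetric] by auto
  next
    fix a b assume "a \<in> h ` carrier M" "b \<in> h ` carrier M"
    then show "a \<oplus>\<^bsub>N\<^esub> b \<in> h ` carrier M"
      using mod_homD(2)[OF assms(3), symmetric] by auto
  next
    fix a x assume "a \<in> carrier R" "x \<in> h ` carrier M"
    then show "a \<odot>\<^bsub>N\<^esub> x \<in> h ` carrier M"
      using mod_homD(3)[OF assms(3), symmetric] by auto
  qed (use mod_homD(1)[OF assms(3)] in auto)
qed

text \<open>
  The module axioms are equations and the existence of negatives, so they pass to any structure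
  that is the image of a module under a map respecting the operations. Quotients and modules
  moved along an injection are both of this form.
\<close>

lemma module_of_surjection:
  assumes "module R M"
    and car: "carrier Q = \<pi> ` carrier M" and zero: "\<zero>\<^bsub>Q\<^esub> = \<pi> \<zero>\<^bsub>M\<^esub>"
    and add: "\<And>x y. x \<in> carrier M \<Longrightarrow> y \<in> carrier M \<Longrightarrow> \<pi> x \<oplus>\<^bsub>Q\<^esub> \<pi> y = \<pi> (x \<oplus>\<^bsub>M\<^esub> y)"
    and smult: "\<And>a x. a \<in> carrier R \<Longrightarrow> x \<in> carrier M \<Longrightarrow> a \<odot>\<^bsub>Q\<^esub> \<pi> x = \<pi> (a \<odot>\<^bsub>M\<^esub> x)"
  shows "module R Q"
proof -
  interpret M: module R M by fact
  show ?thesis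
  proof (rule moduleI)
    show "cring R" by (rule M.R.is_cring)
    show "abelian_group Q"
    proof (rule abelian_groupI)
      fix x assume "x \<in> carrier Q"
      then obtain x' where x': "x' \<in> carrier M" "x = \<pi> x'" using car by auto
      then have "\<pi> (\<ominus>\<^bsub>M\<^esub> x') \<oplus>\<^bsub>Q\<^esub> x = \<zero>\<^bsub>Q\<^esub>" by (simp add: add M.l_neg zero)
      then show "\<exists>y\<in>carrier Q. y \<oplus>\<^bsub>Q\<^esub> x = \<zero>\<^bsub>Q\<^esub>"
        using x' car by (metis M.a_inv_closed image_eqI)
    qed (auto simp: car add zero M.a_assoc, metis M.a_comm)
  qed (auto simp: car add smult M.smult_l_distr M.smult_r_distr M.smult_assoc1)
qed

text \<open>
  The constructions below leave the type in which a resolution has to live. Their results are carried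
  back along an injection of the underlying set.
\<close>

definition transport_module :: "('b \<Rightarrow> 'c) \<Rightarrow> ('a, 'b, 'm) module_scheme \<Rightarrow> ('a, 'c) module"
  where "transport_module g M = (let k = inv_into (carrier M) g in
    \<lparr>carrier = g ` carrier M, mult = undefined, one = undefined, zero = g \<zero>\<^bsub>M\<^esub>,
     add = (\<lambda>x y. g (k x \<oplus>\<^bsub>M\<^esub> k y)), smult = (\<lambda>a x. g (a \<odot>\<^bsub>M\<^esub> k x))\<rparr>)"

lemma transport_module:
  assumes "module R M" "inj_on g (carrier M)"
  shows "module R (transport_module g M)"
    and "g \<in> mod_hom R M (transport_module g M)"
    and "carrier (transport_module g M) = g ` carrier M"
    and "\<zero>\<^bsub>transport_module g M\<^esub> = g \<zero>\<^bsub>M\<^esub>"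
proof -
  show car: "carrier (transport_module g M) = g ` carrier M"
    and zero: "\<zero>\<^bsub>transport_module g M\<^esub> = g \<zero>\<^bsub>M\<^esub>"
    by (simp_all add: transport_module_def Let_def)
  have add: "g x \<oplus>\<^bsub>transport_module g M\<^esub> g y = g (x \<oplus>\<^bsub>M\<^esub> y)"
    if "x \<in> carrier M" "y \<in> carrier M" for x y
    using that assms(2) by (simp add: transport_module_def Let_def inv_into_f_f)
  have smult: "a \<odot>\<^bsub>transport_module g M\<^esub> g x = g (a \<odot>\<^bsub>M\<^esub> x)"
    if "a \<in> carrier R" "x \<in> carrier M" for a x
    using that assms(2) by (simp add: transport_module_def Let_def inv_into_f_f)
  show "module R (transport_module g M)"
    by (rule module_of_surjection[OF assms(1) car zero add smult])
  show "g \<in> mod_hom R M (transport_module g M)"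
    by (rule mod_homI) (auto simp: car add smult)
qed

lemma transport_module_inverse:
  assumes "module R M" "inj_on g (carrier M)"
  shows "inv_into (carrier M) g \<in> mod_hom R (transport_module g M) M"
proof -
  interpret M: module R M by fact
  show ?thesis using assms(2)
    by (intro mod_homI) (auto simp: transport_module_def Let_def inv_into_f_f)
qed

lemma submodule_abelian_subgroup:
  assumes "module R M" "submodule K R M"
  shows "abelian_subgroup K M"
proof -
  interpret M: module R M by fact
  show ?thesis
    using assms(2) by (intro abelian_subgroupI3 additive_subgroupI)
      (auto simp: submodule_def M.abelian_group_axioms)
qed

lemma quotient_module_carrier:
  "carrier (quotient_module M K) = (\<lambda>x. K +>\<^bsub>M\<^esub> x) ` carrier M"
  by (auto simp: quotient_module_def A_RCOSETS_def')

lemma coset_eq_iff: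
  assumes "module R M" "submodule K R M" "x \<in> carrier M" "y \<in> carrier M"
  shows "K +>\<^bsub>M\<^esub> x = K +>\<^bsub>M\<^esub> y \<longleftrightarrow> x \<ominus>\<^bsub>M\<^esub> y \<in> K"
proof -
  interpret K: abelian_subgroup K M by (rule submodule_abelian_subgroup[OF assms(1,2)])
  show ?thesis
    using K.a_rcos_module[OF assms(4,3)] K.a_repr_independence'[of x y] K.a_rcos_self[OF assms(3)]
      assms(3,4) unfolding a_minus_def by metis
qed

lemma quotient_module:
  assumes "module R M" "submodule K R M"
  shows "module R (quotient_module M K)"
    and "(\<lambda>x. K +>\<^bsub>M\<^esub> x) \<in> mod_hom R M (quotient_module M K)"
    and "x \<in> carrier M \<Longrightarrow> K +>\<^bsub>M\<^esub> x = \<zero>\<^bsub>quotient_module M K\<^esub> \<longleftrightarrow> x \<in> K"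
proof -
  interpret M: module R M by fact
  interpret K: abelian_subgroup K M by (rule submodule_abelian_subgroup[OF assms])
  have zero: "\<zero>\<^bsub>quotient_module M K\<^esub> = K +>\<^bsub>M\<^esub> \<zero>\<^bsub>M\<^esub>"
    by (simp add: quotient_module_def K.a_subset)
  have add: "(K +>\<^bsub>M\<^esub> x) \<oplus>\<^bsub>quotient_module M K\<^esub> (K +>\<^bsub>M\<^esub> y) = K +>\<^bsub>M\<^esub> (x \<oplus>\<^bsub>M\<^esub> y)"
    if "x \<in> carrier M" "y \<in> carrier M" for x y
    using that by (simp add: quotient_module_def K.a_rcos_sum)
  have smult: "a \<odot>\<^bsub>quotient_module M K\<^esub> (K +>\<^bsub>M\<^esub> x) = K +>\<^bsub>M\<^esub> (a \<odot>\<^bsub>M\<^esub> x)"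
    if a: "a \<in> carrier R" and x: "x \<in> carrier M" for a x
  proof -
    have "K +>\<^bsub>M\<^esub> (a \<odot>\<^bsub>M\<^esub> y) = K +>\<^bsub>M\<^esub> (a \<odot>\<^bsub>M\<^esub> x)" if y: "y \<in> K +>\<^bsub>M\<^esub> x" for y
    proof -
      have yM: "y \<in> carrier M" using K.a_elemrcos_carrier[OF x y] .
      have "y \<ominus>\<^bsub>M\<^esub> x \<in> K" using K.a_rcos_module_imp[OF x y] by (simp add: a_minus_def)
      then have "a \<odot>\<^bsub>M\<^esub> (y \<ominus>\<^bsub>M\<^esub> x) \<in> K" using a assms M.submoduleE(4) by blast
      then have "a \<odot>\<^bsub>M\<^esub> y \<ominus>\<^bsub>M\<^esub> a \<odot>\<^bsub>M\<^esub> x \<in> K"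
        using a x yM by (simp add: a_minus_def M.smult_r_distr M.smult_r_minus)
      then show ?thesis using a x yM by (simp add: coset_eq_iff[OF assms])
    qed
    then have "(\<Union>y\<in>K +>\<^bsub>M\<^esub> x. K +>\<^bsub>M\<^esub> (a \<odot>\<^bsub>M\<^esub> y)) = K +>\<^bsub>M\<^esub> (a \<odot>\<^bsub>M\<^esub> x)"
      using K.a_rcos_self[OF x] by blast
    then show ?thesis by (simp add: quotient_module_def)
  qed
  show mod: "module R (quotient_module M K)"
    by (rule module_of_surjection[OF assms(1) quotient_module_carrier zero add smult])
  show "(\<lambda>x. K +>\<^bsub>M\<^esub> x) \<in> mod_hom R M (quotient_module M K)"
    by (rule mod_homI) (auto simp: quotient_module_carrier add smult)
  have "x \<ominus>\<^bsub>M\<^esub> \<zero>\<^bsub>M\<^esub> = x" if "x \<in> carrier M" for x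
    using that by (simp add: a_minus_def M.add.inv_one)
  then show "K +>\<^bsub>M\<^esub> x = \<zero>\<^bsub>quotient_module M K\<^esub> \<longleftrightarrow> x \<in> K" if "x \<in> carrier M"
    using that by (simp add: zero coset_eq_iff[OF assms])
qed

lemma quotient_module_lift:
  assumes "module R M" "module R P" "submodule K R M" "h \<in> mod_hom R M P"
    and ker: "\<And>x. x \<in> K \<Longrightarrow> h x = \<zero>\<^bsub>P\<^esub>"
  obtains h' where "h' \<in> mod_hom R (quotient_module M K) P"
    and "\<And>x. x \<in> carrier M \<Longrightarrow> h' (K +>\<^bsub>M\<^esub> x) = h x"
proof -
  interpret M: module R M by fact
  interpret P: module R P by fact
  define h' where "h' = (\<lambda>C. h (SOME y. y \<in> carrier M \<and> C = K +>\<^bsub>M\<^esub> y))"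
  have h': "h' (K +>\<^bsub>M\<^esub> x) = h x" if x: "x \<in> carrier M" for x
  proof -
    let ?y = "SOME y. y \<in> carrier M \<and> K +>\<^bsub>M\<^esub> x = K +>\<^bsub>M\<^esub> y"
    have y: "?y \<in> carrier M \<and> K +>\<^bsub>M\<^esub> x = K +>\<^bsub>M\<^esub> ?y" by (rule someI) (use x in auto)
    then have "x \<ominus>\<^bsub>M\<^esub> ?y \<in> K" using coset_eq_iff[OF assms(1,3) x] by blast
    then have "h x \<ominus>\<^bsub>P\<^esub> h ?y = \<zero>\<^bsub>P\<^esub>" using ker mod_hom_minus[OF assms(1,2,4) x] y by metis
    then have "h x = h ?y"
      using P.minus_eq_zero_iff mod_homD(1)[OF assms(4)] x y by blast
    then show ?thesis by (simp add: h'_def)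
  qed
  note q = mod_homD[OF quotient_module(2)[OF assms(1,3)]]
  have "h' \<in> mod_hom R (quotient_module M K) P"
  proof (rule mod_homI)
    fix X assume "X \<in> carrier (quotient_module M K)"
    then obtain x where x: "x \<in> carrier M" "X = K +>\<^bsub>M\<^esub> x" by (auto simp: quotient_module_carrier)
    then show "h' X \<in> carrier P" using mod_homD(1)[OF assms(4)] by (simp add: h')
    show "h' (a \<odot>\<^bsub>quotient_module M K\<^esub> X) = a \<odot>\<^bsub>P\<^esub> h' X" if "a \<in> carrier R" for a
      using x that q(3)[OF that x(1), symmetric] mod_homD(3)[OF assms(4)] by (simp add: h')
    fix Y assume "Y \<in> carrier (quotient_module M K)"
    then obtain y where y: "y \<in> carrier M" "Y = K +>\<^bsub>M\<^esub> y" by (auto simp: quotient_module_carrier)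
    show "h' (X \<oplus>\<^bsub>quotient_module M K\<^esub> Y) = h' X \<oplus>\<^bsub>P\<^esub> h' Y"
      using x y q(2)[OF x(1) y(1), symmetric] mod_homD(2)[OF assms(4)] by (simp add: h')
  qed
  then show ?thesis using h' that by blast
qed

lemma submodule_gen:
  assumes "module R M" "A \<subseteq> carrier M"
  shows "submodule (submodule_gen R M A) R M"
    and "A \<subseteq> submodule_gen R M A"
    and "submodule K R M \<Longrightarrow> A \<subseteq> K \<Longrightarrow> submodule_gen R M A \<subseteq> K"
proof -
  interpret M: module R M by fact
  have car: "carrier M \<in> {K. submodule K R M \<and> A \<subseteq> K}"
    using assms(2) M.carrier_is_submodule by auto
  show "A \<subseteq> submodule_gen R M A"
    and "submodule K R M \<Longrightarrow> A \<subseteq> K \<Longrightarrow> submodule_gen R M A \<subseteq> K"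
    unfolding submodule_gen_def by auto
  show "submodule (submodule_gen R M A) R M"
  proof (rule M.submoduleI)
    show "submodule_gen R M A \<subseteq> carrier M" using car unfolding submodule_gen_def by blast
    show "\<zero>\<^bsub>M\<^esub> \<in> submodule_gen R M A"
      unfolding submodule_gen_def
      using submodule_abelian_subgroup[OF assms(1)] abelian_subgroup.axioms(1)
        additive_subgroup.zero_closed by blast
  qed (auto simp: submodule_gen_def intro: M.submoduleE)
qed

section \<open>Free modules and tensor products\<close>

lemma free_module_simps:
  "f \<in> carrier (free_module R S) \<longleftrightarrow>
     (\<forall>x. f x \<in> carrier R) \<and> (\<forall>x. x \<notin> S \<longrightarrow> f x = \<zero>\<^bsub>R\<^esub>) \<and> finite {x. f x \<noteq> \<zero>\<^bsub>R\<^esub>}"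
  "\<zero>\<^bsub>free_module R S\<^esub> = (\<lambda>x. \<zero>\<^bsub>R\<^esub>)"
  "f \<oplus>\<^bsub>free_module R S\<^esub> g = (\<lambda>x. f x \<oplus>\<^bsub>R\<^esub> g x)"
  "a \<odot>\<^bsub>free_module R S\<^esub> f = (\<lambda>x. a \<otimes>\<^bsub>R\<^esub> f x)"
  by (auto simp: free_module_def)

lemma free_module:
  assumes "cring R"
  shows "module R (free_module R S)"
proof -
  interpret R: cring R by fact
  have add: "finite {x. f x \<oplus>\<^bsub>R\<^esub> g x \<noteq> \<zero>\<^bsub>R\<^esub>}"
    if "finite {x. f x \<noteq> \<zero>\<^bsub>R\<^esub>}" "finite {x. g x \<noteq> \<zero>\<^bsub>R\<^esub>}" for f g
    by (rule finite_subset[OF _ finite_UnI[OF that]]) auto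
  have smult: "finite {x. a \<otimes>\<^bsub>R\<^esub> f x \<noteq> \<zero>\<^bsub>R\<^esub>}"
    if "a \<in> carrier R" "finite {x. f x \<noteq> \<zero>\<^bsub>R\<^esub>}" for f a
    by (rule finite_subset[OF _ that(2)]) (use that(1) in auto)
  show ?thesis
  proof (rule moduleI)
    show "abelian_group (free_module R S)"
    proof (rule abelian_groupI)
      fix f assume f: "f \<in> carrier (free_module R S)"
      have "{x. \<ominus>\<^bsub>R\<^esub> f x \<noteq> \<zero>\<^bsub>R\<^esub>} \<subseteq> {x. f x \<noteq> \<zero>\<^bsub>R\<^esub>}" by auto
      then have "finite {x. \<ominus>\<^bsub>R\<^esub> f x \<noteq> \<zero>\<^bsub>R\<^esub>}"
        using f finite_subset by (auto simp: free_module_simps)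
      then show "\<exists>g\<in>carrier (free_module R S). g \<oplus>\<^bsub>free_module R S\<^esub> f = \<zero>\<^bsub>free_module R S\<^esub>"
        using f by (intro bexI[of _ "\<lambda>x. \<ominus>\<^bsub>R\<^esub> f x"]) (auto simp: free_module_simps R.l_neg)
    qed (auto simp: free_module_simps add R.a_assoc intro!: ext R.a_comm)
  qed (auto simp: free_module_simps add smult R.l_distr R.r_distr R.m_assoc R.is_cring)
qed

lemma single_in_free_module:
  assumes "cring R" "p \<in> S"
  shows "single R p \<in> carrier (free_module R S)"
proof -
  interpret R: cring R by fact
  have "{x. single R p x \<noteq> \<zero>\<^bsub>R\<^esub>} \<subseteq> {p}" by (auto simp: single_def)
  then have "finite {x. single R p x \<noteq> \<zero>\<^bsub>R\<^esub>}" using finite_subset by blast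
  then show ?thesis using assms(2) by (auto simp: free_module_simps single_def)
qed

definition free_lift ::
  "('a, 'r) ring_scheme \<Rightarrow> ('a, 'b, 'm) module_scheme \<Rightarrow> ('x \<Rightarrow> 'b) \<Rightarrow> ('x \<Rightarrow> 'a) \<Rightarrow> 'b"
  where "free_lift R M \<phi> f = (\<Oplus>\<^bsub>M\<^esub>x\<in>{x. f x \<noteq> \<zero>\<^bsub>R\<^esub>}. f x \<odot>\<^bsub>M\<^esub> \<phi> x)"

lemma free_lift:
  fixes M :: "('a, 'b, 'm) module_scheme"
  assumes M: "module R M" and \<phi>: "\<And>x. x \<in> S \<Longrightarrow> \<phi> x \<in> carrier M"
  shows "free_lift R M \<phi> \<in> mod_hom R (free_module R S) M"
    and "p \<in> S \<Longrightarrow> free_lift R M \<phi> (single R p) = \<phi> p"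
proof -
  interpret M: module R M by fact
  let ?F = "free_module R S"
  \<comment> \<open>Two functions can only be added up over a common index set, so the support is enlarged first.\<close>
  have enlarge: "free_lift R M \<phi> f = (\<Oplus>\<^bsub>M\<^esub>x\<in>A. f x \<odot>\<^bsub>M\<^esub> \<phi> x)"
    if f: "f \<in> carrier ?F" and A: "finite A" "A \<subseteq> S" "{x. f x \<noteq> \<zero>\<^bsub>R\<^esub>} \<subseteq> A" for f A
    unfolding free_lift_def using f A \<phi>
    by (intro M.add.finprod_mono_neutral_cong_left) (auto simp: free_module_simps)
  have supp: "finite {x. f x \<noteq> \<zero>\<^bsub>R\<^esub>}" "{x. f x \<noteq> \<zero>\<^bsub>R\<^esub>} \<subseteq> S" if "f \<in> carrier ?F" for f
    using that by (auto simp: free_module_simps)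
  have val: "f x \<odot>\<^bsub>M\<^esub> \<phi> x \<in> carrier M" if "f \<in> carrier ?F" "x \<in> S" for f x
    using that \<phi> by (auto simp: free_module_simps)
  show "free_lift R M \<phi> \<in> mod_hom R ?F M"
  proof (rule mod_homI)
    fix f assume f: "f \<in> carrier ?F"
    show "free_lift R M \<phi> f \<in> carrier M"
      unfolding free_lift_def using supp[OF f] val[OF f] by (intro M.finsum_closed) auto
    show "free_lift R M \<phi> (a \<odot>\<^bsub>?F\<^esub> f) = a \<odot>\<^bsub>M\<^esub> free_lift R M \<phi> f" if a: "a \<in> carrier R" for a
    proof -
      let ?A = "{x. f x \<noteq> \<zero>\<^bsub>R\<^esub>}"
      have af: "a \<odot>\<^bsub>?F\<^esub> f \<in> carrier ?F"
        using module.smult_closed[OF free_module[OF M.R.is_cring] a f] .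
      have sub: "{x. (a \<odot>\<^bsub>?F\<^esub> f) x \<noteq> \<zero>\<^bsub>R\<^esub>} \<subseteq> ?A"
        using a by (auto simp: free_module_simps)
      have "free_lift R M \<phi> (a \<odot>\<^bsub>?F\<^esub> f) = (\<Oplus>\<^bsub>M\<^esub>x\<in>?A. (a \<odot>\<^bsub>?F\<^esub> f) x \<odot>\<^bsub>M\<^esub> \<phi> x)"
        by (rule enlarge[OF af supp[OF f] sub])
      also have "\<dots> = (\<Oplus>\<^bsub>M\<^esub>x\<in>?A. a \<odot>\<^bsub>M\<^esub> (f x \<odot>\<^bsub>M\<^esub> \<phi> x))"
        using f a \<phi> val[OF f] supp(2)[OF f]
        by (intro M.finsum_cong') (auto simp: free_module_simps intro!: M.smult_assoc1)
      also have "\<dots> = a \<odot>\<^bsub>M\<^esub> (\<Oplus>\<^bsub>M\<^esub>x\<in>?A. f x \<odot>\<^bsub>M\<^esub> \<phi> x)"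
        using val[OF f] supp(2)[OF f]
        by (intro M.finsum_smult_ldistr[symmetric] supp(1)[OF f] a) auto
      finally show ?thesis by (simp add: free_lift_def)
    qed
    fix g assume g: "g \<in> carrier ?F"
    let ?A = "{x. f x \<noteq> \<zero>\<^bsub>R\<^esub>} \<union> {x. g x \<noteq> \<zero>\<^bsub>R\<^esub>}"
    have A: "finite ?A" "?A \<subseteq> S" using supp[OF f] supp[OF g] by auto
    have fg: "f \<oplus>\<^bsub>?F\<^esub> g \<in> carrier ?F"
      using abelian_monoid.a_closed[OF abelian_group.axioms(1)[OF module.axioms(2)[OF
            free_module[OF M.R.is_cring]]] f g] .
    have sub: "{x. (f \<oplus>\<^bsub>?F\<^esub> g) x \<noteq> \<zero>\<^bsub>R\<^esub>} \<subseteq> ?A"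
      by (auto simp: free_module_simps)
    have "free_lift R M \<phi> (f \<oplus>\<^bsub>?F\<^esub> g) = (\<Oplus>\<^bsub>M\<^esub>x\<in>?A. (f \<oplus>\<^bsub>?F\<^esub> g) x \<odot>\<^bsub>M\<^esub> \<phi> x)"
      by (rule enlarge[OF fg A sub])
    also have "\<dots> = (\<Oplus>\<^bsub>M\<^esub>x\<in>?A. f x \<odot>\<^bsub>M\<^esub> \<phi> x \<oplus>\<^bsub>M\<^esub> g x \<odot>\<^bsub>M\<^esub> \<phi> x)"
      using f g \<phi> val[OF f] val[OF g] A(2)
      by (intro M.finsum_cong') (auto simp: free_module_simps intro!: M.smult_l_distr)
    also have "\<dots> = (\<Oplus>\<^bsub>M\<^esub>x\<in>?A. f x \<odot>\<^bsub>M\<^esub> \<phi> x) \<oplus>\<^bsub>M\<^esub> (\<Oplus>\<^bsub>M\<^esub>x\<in>?A. g x \<odot>\<^bsub>M\<^esub> \<phi> x)"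
      using val[OF f] val[OF g] A(2) by (intro M.finsum_addf) auto
    finally show "free_lift R M \<phi> (f \<oplus>\<^bsub>?F\<^esub> g) = free_lift R M \<phi> f \<oplus>\<^bsub>M\<^esub> free_lift R M \<phi> g"
      using enlarge[OF f A] enlarge[OF g A] by simp
  qed
  show "free_lift R M \<phi> (single R p) = \<phi> p" if p: "p \<in> S"
  proof -
    have "free_lift R M \<phi> (single R p) = (\<Oplus>\<^bsub>M\<^esub>x\<in>{p}. single R p x \<odot>\<^bsub>M\<^esub> \<phi> x)"
      using p by (intro enlarge single_in_free_module M.R.is_cring) (auto simp: single_def)
    then show ?thesis using \<phi>[OF p] by (simp add: single_def)
  qed
qed

lemma (in module) bilinear_relations_subset:
  assumes "module R N"
  shows "bilinear_relations R M N \<subseteq> carrier (free_module R (carrier M \<times> carrier N))"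
proof -
  interpret N: module R N by fact
  interpret F: module R "free_module R (carrier M \<times> carrier N)"
    by (rule free_module[OF R.is_cring])
  show ?thesis
    unfolding bilinear_relations_def Let_def
    by (auto simp: a_minus_def
        intro!: F.a_closed F.a_inv_closed F.smult_closed single_in_free_module R.is_cring)
qed

lemma tensor_product_module:
  assumes "module R M" "module R N"
  shows "module R (tensor_product R M N)"
proof -
  interpret M: module R M by fact
  show ?thesis
    unfolding tensor_product_def tensor_kernel_def
    by (intro quotient_module submodule_gen free_module M.R.is_cring
        M.bilinear_relations_subset assms)
qed

lemma pure_tensor_right_linear:
  assumes "module R M" "module R N" "x \<in> carrier M"
  shows "pure_tensor R M N x \<in> mod_hom R N (tensor_product R M N)"
proof -
  interpret M: module R M by fact
  interpret N: module R N by fact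
  let ?F = "free_module R (carrier M \<times> carrier N)" and ?K = "tensor_kernel R M N"
  let ?q = "\<lambda>f. ?K +>\<^bsub>?F\<^esub> f"
  have F: "module R ?F" by (rule free_module[OF M.R.is_cring])
  interpret F: module R ?F by fact
  have rel: "bilinear_relations R M N \<subseteq> ?K" and K: "submodule ?K R ?F"
    unfolding tensor_kernel_def
    using submodule_gen[OF F M.bilinear_relations_subset[OF assms(2)]] by auto
  have s: "single R (x, y) \<in> carrier ?F" if "y \<in> carrier N" for y
    using that assms(3) by (auto intro!: single_in_free_module M.R.is_cring)
  note q = quotient_module(2)[OF F K, folded tensor_product_def]
  show ?thesis
  proof (rule mod_homI)
    fix y assume y: "y \<in> carrier N"
    show "pure_tensor R M N x y \<in> carrier (tensor_product R M N)"
      unfolding pure_tensor_def using mod_homD(1)[OF q s[OF y]] .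
    show "pure_tensor R M N x (a \<odot>\<^bsub>N\<^esub> y) = a \<odot>\<^bsub>tensor_product R M N\<^esub> pure_tensor R M N x y"
      if a: "a \<in> carrier R" for a
    proof -
      have "single R (x, a \<odot>\<^bsub>N\<^esub> y) \<ominus>\<^bsub>?F\<^esub> (a \<odot>\<^bsub>?F\<^esub> single R (x, y)) \<in> ?K"
        using rel a y assms(3) unfolding bilinear_relations_def Let_def by blast
      then have "?q (single R (x, a \<odot>\<^bsub>N\<^esub> y)) = ?q (a \<odot>\<^bsub>?F\<^esub> single R (x, y))"
        using s a y by (subst coset_eq_iff[OF F K]) auto
      then show ?thesis unfolding pure_tensor_def using mod_homD(3)[OF q a s[OF y]] by simp
    qed
    fix y' assume y': "y' \<in> carrier N"
    have "single R (x, y \<oplus>\<^bsub>N\<^esub> y') \<ominus>\<^bsub>?F\<^esub> (single R (x, y) \<oplus>\<^bsub>?F\<^esub> single R (x, y')) \<in> ?K"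
      using rel y y' assms(3) unfolding bilinear_relations_def Let_def by blast
    then have "?q (single R (x, y \<oplus>\<^bsub>N\<^esub> y')) = ?q (single R (x, y) \<oplus>\<^bsub>?F\<^esub> single R (x, y'))"
      using s y y' by (subst coset_eq_iff[OF F K]) auto
    then show "pure_tensor R M N x (y \<oplus>\<^bsub>N\<^esub> y') =
        pure_tensor R M N x y \<oplus>\<^bsub>tensor_product R M N\<^esub> pure_tensor R M N x y'"
      unfolding pure_tensor_def using mod_homD(2)[OF q s[OF y] s[OF y']] by simp
  qed
qed

lemma tensor_product_lift:
  assumes "module R M" "module R N" "module R P"
    and left: "\<And>y. y \<in> carrier N \<Longrightarrow> (\<lambda>x. \<beta> x y) \<in> mod_hom R M P"
    and right: "\<And>x. x \<in> carrier M \<Longrightarrow> \<beta> x \<in> mod_hom R N P"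
  obtains \<phi> where "\<phi> \<in> mod_hom R (tensor_product R M N) P"
    and "\<And>x y. x \<in> carrier M \<Longrightarrow> y \<in> carrier N \<Longrightarrow> \<phi> (pure_tensor R M N x y) = \<beta> x y"
proof -
  interpret M: module R M by fact
  interpret N: module R N by fact
  interpret P: module R P by fact
  let ?F = "free_module R (carrier M \<times> carrier N)" and ?K = "tensor_kernel R M N"
  have F: "module R ?F" by (rule free_module[OF M.R.is_cring])
  interpret F: module R ?F by fact
  have K: "submodule ?K R ?F"
    unfolding tensor_kernel_def by (rule submodule_gen[OF F M.bilinear_relations_subset[OF assms(2)]])
  define h where "h = free_lift R P (\<lambda>(x, y). \<beta> x y)"
  have \<beta>: "\<beta> x y \<in> carrier P" if "x \<in> carrier M" "y \<in> carrier N" for x y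
    using mod_homD(1)[OF right] that by blast
  have h: "h \<in> mod_hom R ?F P"
    unfolding h_def by (rule free_lift(1)[OF assms(3)]) (auto simp: \<beta>)
  have hs: "h (single R (x, y)) = \<beta> x y" if "x \<in> carrier M" "y \<in> carrier N" for x y
    unfolding h_def using free_lift(2)[OF assms(3), of "carrier M \<times> carrier N" "\<lambda>(x, y). \<beta> x y" "(x, y)"]
      that \<beta> by auto
  have s: "single R (x, y) \<in> carrier ?F" if "x \<in> carrier M" "y \<in> carrier N" for x y
    using that by (auto intro!: single_in_free_module M.R.is_cring)
  define Z where "Z = {f \<in> carrier ?F. h f = \<zero>\<^bsub>P\<^esub>}"
  have Z: "submodule Z R ?F" unfolding Z_def by (rule kernel_submodule[OF F assms(3) h])
  have diff: "f \<ominus>\<^bsub>?F\<^esub> g \<in> Z" if "f \<in> carrier ?F" "g \<in> carrier ?F" "h f = h g" for f g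
    using that mod_homD(1)[OF h]
    by (simp add: Z_def mod_hom_minus[OF F assms(3) h] P.minus_eq_zero_iff)
  have "bilinear_relations R M N \<subseteq> Z"
    unfolding bilinear_relations_def Let_def
    by (auto intro!: diff
        simp: s mod_homD(2,3)[OF h] hs mod_homD(2,3)[OF left] mod_homD(2,3)[OF right])
  then have "?K \<subseteq> Z"
    unfolding tensor_kernel_def
    by (intro submodule_gen(3)[OF F M.bilinear_relations_subset[OF assms(2)]] Z)
  then have "h f = \<zero>\<^bsub>P\<^esub>" if "f \<in> ?K" for f using that by (auto simp: Z_def)
  then obtain \<phi> where "\<phi> \<in> mod_hom R (tensor_product R M N) P"
    and "\<And>f. f \<in> carrier ?F \<Longrightarrow> \<phi> (?K +>\<^bsub>?F\<^esub> f) = h f"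
    using quotient_module_lift[OF F assms(3) K h] unfolding tensor_product_def by auto
  then show ?thesis using that s hs unfolding pure_tensor_def by simp
qed

section \<open>Baer's criterion\<close>

text \<open>
  Injectivity tested on ideals only. In this form it refers to no type of test modules; by the lemmas
  \<open>baer_injective\<close> and \<open>injective_baer\<close> it is equivalent to \<open>injective_module\<close>.
\<close>

definition baer :: "('a, 'r) ring_scheme \<Rightarrow> ('a, 'e, 'm) module_scheme \<Rightarrow> bool"
  where "baer R E \<longleftrightarrow> module R E \<and>
    (\<forall>J f. ideal J R \<and> f \<in> mod_hom R (ideal_module R J) E \<longrightarrow>
       (\<exists>e\<in>carrier E. \<forall>a\<in>J. f a = a \<odot>\<^bsub>E\<^esub> e))"

lemma ideal_module_simps:
  "carrier (ideal_module R J) = J" "\<zero>\<^bsub>ideal_module R J\<^esub> = \<zero>\<^bsub>R\<^esub>"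
  "a \<oplus>\<^bsub>ideal_module R J\<^esub> b = a \<oplus>\<^bsub>R\<^esub> b" "a \<odot>\<^bsub>ideal_module R J\<^esub> b = a \<otimes>\<^bsub>R\<^esub> b"
  by (auto simp: ideal_module_def self_module_def)

lemma self_module_simps:
  "carrier (self_module R) = carrier R" "\<zero>\<^bsub>self_module R\<^esub> = \<zero>\<^bsub>R\<^esub>"
  "a \<oplus>\<^bsub>self_module R\<^esub> b = a \<oplus>\<^bsub>R\<^esub> b" "a \<odot>\<^bsub>self_module R\<^esub> b = a \<otimes>\<^bsub>R\<^esub> b"
  by (auto simp: self_module_def)

lemma self_module:
  assumes "cring R"
  shows "module R (self_module R)"
proof -
  interpret R: cring R by fact
  show ?thesis
  proof (rule moduleI)
    show "abelian_group (self_module R)"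
    proof (rule abelian_groupI)
      fix x assume "x \<in> carrier (self_module R)"
      then show "\<exists>y\<in>carrier (self_module R). y \<oplus>\<^bsub>self_module R\<^esub> x = \<zero>\<^bsub>self_module R\<^esub>"
        by (intro bexI[of _ "\<ominus>\<^bsub>R\<^esub> x"]) (auto simp: self_module_simps R.l_neg)
    qed (auto simp: self_module_simps R.a_assoc intro: R.a_comm)
  qed (auto simp: self_module_simps R.l_distr R.r_distr R.m_assoc R.is_cring)
qed

lemma ideal_submodule:
  assumes "cring R" "ideal J R"
  shows "submodule J R (self_module R)"
proof -
  interpret S: module R "self_module R" by (rule self_module[OF assms(1)])
  interpret J: ideal J R by fact
  have "\<ominus>\<^bsub>self_module R\<^esub> a \<in> J" if a: "a \<in> J" for a
  proof -
    have "\<ominus>\<^bsub>self_module R\<^esub> a = \<ominus>\<^bsub>R\<^esub> a"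
      using a J.Icarr by (intro S.minus_equality) (auto simp: self_module_simps S.R.l_neg)
    then show ?thesis using a by simp
  qed
  moreover have "J \<subseteq> carrier (self_module R)" using J.a_subset by (simp add: self_module_simps)
  ultimately show ?thesis
    by (intro S.submoduleI) (simp_all add: self_module_simps J.I_l_closed)
qed

lemma ideal_module:
  assumes "cring R" "ideal J R"
  shows "module R (ideal_module R J)"
  unfolding ideal_module_def
  by (rule submodule.submodule_is_module[OF ideal_submodule[OF assms] self_module[OF assms(1)]])

text \<open>
  Zorn's lemma yields a maximal partial extension, taken as the graph of a linear map. If \<open>x\<^sub>0\<close> is
  missing from its domain, the scalars sending \<open>x\<^sub>0\<close> into the domain form an ideal, and
  the hypothesis on ideals provides a value for \<open>x\<^sub>0\<close>.
\<close>

lemma baer_extend: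
  assumes E: "baer R E" and N: "module R N" and A: "submodule A R N"
    and f: "f \<in> mod_hom R (N\<lparr>carrier := A\<rparr>) E"
  obtains h where "h \<in> mod_hom R N E" "\<And>x. x \<in> A \<Longrightarrow> h x = f x"
proof -
  have modE: "module R E" using E by (simp add: baer_def)
  interpret N: module R N by fact
  interpret E: module R E by fact
  define \<G> where "\<G> = {G. G \<subseteq> carrier N \<times> carrier E \<and> (\<forall>x\<in>A. (x, f x) \<in> G) \<and>
    (\<forall>x y x' y'. (x, y) \<in> G \<longrightarrow> (x', y') \<in> G \<longrightarrow> (x \<oplus>\<^bsub>N\<^esub> x', y \<oplus>\<^bsub>E\<^esub> y') \<in> G) \<and>
    (\<forall>a\<in>carrier R. \<forall>x y. (x, y) \<in> G \<longrightarrow> (a \<odot>\<^bsub>N\<^esub> x, a \<odot>\<^bsub>E\<^esub> y) \<in> G) \<and>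
    (\<forall>x y y'. (x, y) \<in> G \<longrightarrow> (x, y') \<in> G \<longrightarrow> y = y')}"
  have A0: "\<zero>\<^bsub>N\<^esub> \<in> A"
    using abelian_subgroup.axioms(1)[OF submodule_abelian_subgroup[OF N A]]
    by (rule additive_subgroup.zero_closed)
  have AN: "A \<subseteq> carrier N" using N.submoduleE(1)[OF A] .
  have "(\<lambda>x. (x, f x)) ` A \<in> \<G>"
    unfolding \<G>_def mem_Collect_eq
  proof (intro conjI allI impI ballI)
    show "(\<lambda>x. (x, f x)) ` A \<subseteq> carrier N \<times> carrier E" using mod_homD(1)[OF f] AN by auto
  next
    fix x y x' y' assume "(x, y) \<in> (\<lambda>x. (x, f x)) ` A" "(x', y') \<in> (\<lambda>x. (x, f x)) ` A"
    then have "x \<in> A" "x' \<in> A" "y = f x" "y' = f x'" by auto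
    then show "(x \<oplus>\<^bsub>N\<^esub> x', y \<oplus>\<^bsub>E\<^esub> y') \<in> (\<lambda>x. (x, f x)) ` A"
      using mod_homD(2)[OF f, of x x'] N.submoduleE(5)[OF A, of x x']
      by (intro image_eqI[of _ _ "x \<oplus>\<^bsub>N\<^esub> x'"]) simp_all
  next
    fix a x y assume "a \<in> carrier R" "(x, y) \<in> (\<lambda>x. (x, f x)) ` A"
    then have "a \<in> carrier R" "x \<in> A" "y = f x" by auto
    then show "(a \<odot>\<^bsub>N\<^esub> x, a \<odot>\<^bsub>E\<^esub> y) \<in> (\<lambda>x. (x, f x)) ` A"
      using mod_homD(3)[OF f, of a x] N.submoduleE(4)[OF A, of a x]
      by (intro image_eqI[of _ _ "a \<odot>\<^bsub>N\<^esub> x"]) simp_all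
  qed auto
  then have ne: "\<G> \<noteq> {}" by blast
  have chain: "\<Union>C \<in> \<G>" if C: "C \<noteq> {}" "subset.chain \<G> C" for C
  proof -
    have sub: "C \<subseteq> \<G>" using C(2) unfolding subset.chain_def by blast
    have common: "\<exists>G\<in>C. p \<in> G \<and> q \<in> G" if "p \<in> \<Union>C" "q \<in> \<Union>C" for p q
      using that C(2) unfolding subset_chain_def by blast
    show ?thesis
      unfolding \<G>_def mem_Collect_eq
    proof (intro conjI allI impI ballI)
      show "\<Union>C \<subseteq> carrier N \<times> carrier E" using sub unfolding \<G>_def by blast
      show "(x, f x) \<in> \<Union>C" if "x \<in> A" for x using sub C(1) that unfolding \<G>_def by blast
      show "(a \<odot>\<^bsub>N\<^esub> x, a \<odot>\<^bsub>E\<^esub> y) \<in> \<Union>C" if "a \<in> carrier R" "(x, y) \<in> \<Union>C" for a x y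
        using sub that unfolding \<G>_def by blast
      fix x y x' y' assume xy: "(x, y) \<in> \<Union>C" "(x', y') \<in> \<Union>C"
      obtain G where G: "G \<in> C" "(x, y) \<in> G" "(x', y') \<in> G" using common[OF xy] by blast
      then have "(x \<oplus>\<^bsub>N\<^esub> x', y \<oplus>\<^bsub>E\<^esub> y') \<in> G" using sub unfolding \<G>_def by blast
      then show "(x \<oplus>\<^bsub>N\<^esub> x', y \<oplus>\<^bsub>E\<^esub> y') \<in> \<Union>C" using G(1) by blast
    next
      fix x y y' assume xy: "(x, y) \<in> \<Union>C" "(x, y') \<in> \<Union>C"
      obtain G where "G \<in> C" "(x, y) \<in> G" "(x, y') \<in> G" using common[OF xy] by blast
      then show "y = y'" using sub unfolding \<G>_def by blast
    qed
  qed
  obtain G where G: "G \<in> \<G>" and max: "\<And>G'. G' \<in> \<G> \<Longrightarrow> G \<subseteq> G' \<Longrightarrow> G' = G"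
    using subset_Zorn_nonempty[OF ne chain] by blast
  have Gcar: "x \<in> carrier N" "y \<in> carrier E" if "(x, y) \<in> G" for x y
    using G that unfolding \<G>_def by auto
  have Gf: "(x, f x) \<in> G" if "x \<in> A" for x using G that unfolding \<G>_def by auto
  have Gadd: "(x \<oplus>\<^bsub>N\<^esub> x', y \<oplus>\<^bsub>E\<^esub> y') \<in> G" if "(x, y) \<in> G" "(x', y') \<in> G" for x y x' y'
    using G that unfolding \<G>_def by blast
  have Gsmult: "(a \<odot>\<^bsub>N\<^esub> x, a \<odot>\<^bsub>E\<^esub> y) \<in> G" if "a \<in> carrier R" "(x, y) \<in> G" for a x y
    using G that unfolding \<G>_def by blast
  have Guniq: "y = y'" if "(x, y) \<in> G" "(x, y') \<in> G" for x y y'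
    using G that unfolding \<G>_def by blast
  have G0: "(\<zero>\<^bsub>N\<^esub>, \<zero>\<^bsub>E\<^esub>) \<in> G"
    using Gsmult[OF N.R.zero_closed Gf[OF A0]] mod_homD(1)[OF f, of "\<zero>\<^bsub>N\<^esub>"] A0 by simp
  have Gneg: "(\<ominus>\<^bsub>N\<^esub> x, \<ominus>\<^bsub>E\<^esub> y) \<in> G" if "(x, y) \<in> G" for x y
    using Gsmult[of "\<ominus>\<^bsub>R\<^esub> \<one>\<^bsub>R\<^esub>", OF _ that] Gcar[OF that]
    by (simp add: N.smult_l_minus E.smult_l_minus)
  have total: "\<exists>y. (x\<^sub>0, y) \<in> G" if x0: "x\<^sub>0 \<in> carrier N" for x\<^sub>0
  proof -
    \<comment> \<open>On \<open>J\<close> the value at \<open>a x\<^sub>0\<close> is already prescribed, and \<open>x\<^sub>0\<close> has to be sent to an \<open>e\<close> compatible with it.\<close>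
    define J where "J = {a \<in> carrier R. \<exists>y. (a \<odot>\<^bsub>N\<^esub> x\<^sub>0, y) \<in> G}"
    have J: "ideal J R"
    proof (rule idealI)
      show "subgroup J (add_monoid R)"
      proof (rule subgroup.intro)
        fix a b assume ab: "a \<in> J" "b \<in> J"
        then show "a \<otimes>\<^bsub>add_monoid R\<^esub> b \<in> J"
          using x0 Gadd by (auto simp: J_def N.smult_l_distr) blast
      next
        fix a assume "a \<in> J"
        then show "inv\<^bsub>add_monoid R\<^esub> a \<in> J"
          using x0 Gneg by (auto simp: J_def N.smult_l_minus a_inv_def[symmetric])
      next
        show "J \<subseteq> carrier (add_monoid R)" by (auto simp: J_def)
        show "\<one>\<^bsub>add_monoid R\<^esub> \<in> J" using x0 G0 by (auto simp: J_def)
      qed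
      fix a b assume ab: "a \<in> J" "b \<in> carrier R"
      show "b \<otimes>\<^bsub>R\<^esub> a \<in> J"
        using ab x0 Gsmult[OF ab(2)] by (auto simp: J_def N.smult_assoc1)
      then show "a \<otimes>\<^bsub>R\<^esub> b \<in> J"
        using ab by (simp add: J_def N.R.m_comm)
    qed (rule N.R.ring_axioms)
    define g where "g a = (THE y. (a \<odot>\<^bsub>N\<^esub> x\<^sub>0, y) \<in> G)" for a
    have g: "(a \<odot>\<^bsub>N\<^esub> x\<^sub>0, g a) \<in> G" if "a \<in> J" for a
      unfolding g_def using that Guniq by (auto simp: J_def intro: theI2)
    have "g \<in> mod_hom R (ideal_module R J) E"
    proof (rule mod_homI, unfold ideal_module_simps)
      fix a assume a: "a \<in> J"
      show "g a \<in> carrier E" using g[OF a] Gcar by blast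
      show "g (r \<otimes>\<^bsub>R\<^esub> a) = r \<odot>\<^bsub>E\<^esub> g a" if r: "r \<in> carrier R" for r
      proof (rule Guniq)
        show "((r \<otimes>\<^bsub>R\<^esub> a) \<odot>\<^bsub>N\<^esub> x\<^sub>0, g (r \<otimes>\<^bsub>R\<^esub> a)) \<in> G"
          using ideal.I_l_closed[OF J a r] by (rule g)
        show "((r \<otimes>\<^bsub>R\<^esub> a) \<odot>\<^bsub>N\<^esub> x\<^sub>0, r \<odot>\<^bsub>E\<^esub> g a) \<in> G"
          using Gsmult[OF r g[OF a]] a r x0 by (simp add: J_def N.smult_assoc1)
      qed
      fix b assume b: "b \<in> J"
      show "g (a \<oplus>\<^bsub>R\<^esub> b) = g a \<oplus>\<^bsub>E\<^esub> g b"
      proof (rule Guniq)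
        show "((a \<oplus>\<^bsub>R\<^esub> b) \<odot>\<^bsub>N\<^esub> x\<^sub>0, g (a \<oplus>\<^bsub>R\<^esub> b)) \<in> G"
          using additive_subgroup.a_closed[OF ideal.axioms(1)[OF J] a b] by (rule g)
        show "((a \<oplus>\<^bsub>R\<^esub> b) \<odot>\<^bsub>N\<^esub> x\<^sub>0, g a \<oplus>\<^bsub>E\<^esub> g b) \<in> G"
          using Gadd[OF g[OF a] g[OF b]] a b x0 by (simp add: J_def N.smult_l_distr)
      qed
    qed
    then obtain e where e: "e \<in> carrier E" and ge: "\<And>a. a \<in> J \<Longrightarrow> g a = a \<odot>\<^bsub>E\<^esub> e"
      using E J unfolding baer_def by blast
    define G' where "G' = {(x \<oplus>\<^bsub>N\<^esub> a \<odot>\<^bsub>N\<^esub> x\<^sub>0, y \<oplus>\<^bsub>E\<^esub> a \<odot>\<^bsub>E\<^esub> e) | x y a. (x, y) \<in> G \<and> a \<in> carrier R}"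
    have G'I: "(x \<oplus>\<^bsub>N\<^esub> a \<odot>\<^bsub>N\<^esub> x\<^sub>0, y \<oplus>\<^bsub>E\<^esub> a \<odot>\<^bsub>E\<^esub> e) \<in> G'"
      if "(x, y) \<in> G" "a \<in> carrier R" for x y a
      using that unfolding G'_def by blast
    have sub: "G \<subseteq> G'"
    proof
      fix p assume "p \<in> G"
      then obtain x y where xy: "p = (x, y)" "(x, y) \<in> G" by (cases p) auto
      show "p \<in> G'" using G'I[OF xy(2) N.R.zero_closed] xy Gcar[OF xy(2)] x0 e by simp
    qed
    have "G' \<in> \<G>"
      unfolding \<G>_def mem_Collect_eq
    proof (intro conjI allI impI ballI)
      show "G' \<subseteq> carrier N \<times> carrier E" using Gcar x0 e by (auto simp: G'_def)
      show "(x, f x) \<in> G'" if "x \<in> A" for x using sub Gf[OF that] by blast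
    next
      fix r x y assume r: "r \<in> carrier R" and xy: "(x, y) \<in> G'"
      then obtain x1 y1 a where 1: "x = x1 \<oplus>\<^bsub>N\<^esub> a \<odot>\<^bsub>N\<^esub> x\<^sub>0" "y = y1 \<oplus>\<^bsub>E\<^esub> a \<odot>\<^bsub>E\<^esub> e" "(x1, y1) \<in> G"
        "a \<in> carrier R" unfolding G'_def by blast
      show "(r \<odot>\<^bsub>N\<^esub> x, r \<odot>\<^bsub>E\<^esub> y) \<in> G'"
        using G'I[OF Gsmult[OF r 1(3)] N.R.m_closed[OF r 1(4)]] 1 Gcar[OF 1(3)] r x0 e
        by (simp add: N.smult_r_distr E.smult_r_distr N.smult_assoc1 E.smult_assoc1)
    next
      fix x y x' y' assume xy: "(x, y) \<in> G'" "(x', y') \<in> G'"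
      then obtain x1 y1 a where 1: "x = x1 \<oplus>\<^bsub>N\<^esub> a \<odot>\<^bsub>N\<^esub> x\<^sub>0" "y = y1 \<oplus>\<^bsub>E\<^esub> a \<odot>\<^bsub>E\<^esub> e" "(x1, y1) \<in> G"
        "a \<in> carrier R" unfolding G'_def by blast
      from xy obtain x2 y2 b where 2: "x' = x2 \<oplus>\<^bsub>N\<^esub> b \<odot>\<^bsub>N\<^esub> x\<^sub>0" "y' = y2 \<oplus>\<^bsub>E\<^esub> b \<odot>\<^bsub>E\<^esub> e"
        "(x2, y2) \<in> G" "b \<in> carrier R" unfolding G'_def by blast
      show "(x \<oplus>\<^bsub>N\<^esub> x', y \<oplus>\<^bsub>E\<^esub> y') \<in> G'"
        using G'I[OF Gadd[OF 1(3) 2(3)] N.R.a_closed[OF 1(4) 2(4)]] 1 2 Gcar[OF 1(3)] Gcar[OF 2(3)] x0 e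
        by (simp add: N.smult_l_distr E.smult_l_distr N.add.m_ac E.add.m_ac)
    next
      fix x y y' assume xy: "(x, y) \<in> G'" "(x, y') \<in> G'"
      then obtain x1 y1 a where 1: "x = x1 \<oplus>\<^bsub>N\<^esub> a \<odot>\<^bsub>N\<^esub> x\<^sub>0" "y = y1 \<oplus>\<^bsub>E\<^esub> a \<odot>\<^bsub>E\<^esub> e" "(x1, y1) \<in> G"
        "a \<in> carrier R" unfolding G'_def by blast
      from xy obtain x2 y2 b where 2: "x = x2 \<oplus>\<^bsub>N\<^esub> b \<odot>\<^bsub>N\<^esub> x\<^sub>0" "y' = y2 \<oplus>\<^bsub>E\<^esub> b \<odot>\<^bsub>E\<^esub> e"
        "(x2, y2) \<in> G" "b \<in> carrier R" unfolding G'_def by blast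
      note car = Gcar[OF 1(3)] Gcar[OF 2(3)]
      have ab: "a \<ominus>\<^bsub>R\<^esub> b \<in> carrier R" using 1(4) 2(4) by simp
      have "(a \<ominus>\<^bsub>R\<^esub> b) \<odot>\<^bsub>N\<^esub> x\<^sub>0 = x2 \<oplus>\<^bsub>N\<^esub> \<ominus>\<^bsub>N\<^esub> x1"
      proof -
        have "(a \<ominus>\<^bsub>R\<^esub> b) \<odot>\<^bsub>N\<^esub> x\<^sub>0 = a \<odot>\<^bsub>N\<^esub> x\<^sub>0 \<oplus>\<^bsub>N\<^esub> \<ominus>\<^bsub>N\<^esub> (b \<odot>\<^bsub>N\<^esub> x\<^sub>0)"
          using 1(4) 2(4) x0 by (simp add: a_minus_def N.smult_l_distr N.smult_l_minus)
        also have "\<dots> = (x1 \<oplus>\<^bsub>N\<^esub> a \<odot>\<^bsub>N\<^esub> x\<^sub>0) \<oplus>\<^bsub>N\<^esub> (\<ominus>\<^bsub>N\<^esub> (b \<odot>\<^bsub>N\<^esub> x\<^sub>0) \<oplus>\<^bsub>N\<^esub> \<ominus>\<^bsub>N\<^esub> x1)"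
          using 1(4) 2(4) x0 car by (simp add: N.add.m_ac N.r_neg N.r_neg1 N.r_neg2)
        also have "\<dots> = (x2 \<oplus>\<^bsub>N\<^esub> b \<odot>\<^bsub>N\<^esub> x\<^sub>0) \<oplus>\<^bsub>N\<^esub> (\<ominus>\<^bsub>N\<^esub> (b \<odot>\<^bsub>N\<^esub> x\<^sub>0) \<oplus>\<^bsub>N\<^esub> \<ominus>\<^bsub>N\<^esub> x1)"
          using 1(1) 2(1) by simp
        also have "\<dots> = x2 \<oplus>\<^bsub>N\<^esub> \<ominus>\<^bsub>N\<^esub> x1"
          using 1(4) 2(4) x0 car by (simp add: N.add.m_assoc N.r_neg2)
        finally show ?thesis .
      qed
      then have in_G: "((a \<ominus>\<^bsub>R\<^esub> b) \<odot>\<^bsub>N\<^esub> x\<^sub>0, y2 \<oplus>\<^bsub>E\<^esub> \<ominus>\<^bsub>E\<^esub> y1) \<in> G"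
        using Gadd[OF 2(3) Gneg[OF 1(3)]] by simp
      then have abJ: "a \<ominus>\<^bsub>R\<^esub> b \<in> J" using ab unfolding J_def by blast
      have eq: "(a \<ominus>\<^bsub>R\<^esub> b) \<odot>\<^bsub>E\<^esub> e = y2 \<oplus>\<^bsub>E\<^esub> \<ominus>\<^bsub>E\<^esub> y1"
        using Guniq[OF g[OF abJ] in_G] ge[OF abJ] by simp
      have "y = y1 \<oplus>\<^bsub>E\<^esub> ((a \<ominus>\<^bsub>R\<^esub> b) \<odot>\<^bsub>E\<^esub> e \<oplus>\<^bsub>E\<^esub> b \<odot>\<^bsub>E\<^esub> e)"
      proof -
        have "a = (a \<ominus>\<^bsub>R\<^esub> b) \<oplus>\<^bsub>R\<^esub> b"
          using 1(4) 2(4) by (simp add: a_minus_def N.R.a_assoc N.R.l_neg)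
        then have "a \<odot>\<^bsub>E\<^esub> e = (a \<ominus>\<^bsub>R\<^esub> b) \<odot>\<^bsub>E\<^esub> e \<oplus>\<^bsub>E\<^esub> b \<odot>\<^bsub>E\<^esub> e"
          using E.smult_l_distr[OF ab 2(4) e] by simp
        then show ?thesis using 1(2) by simp
      qed
      also have "\<dots> = y1 \<oplus>\<^bsub>E\<^esub> (y2 \<oplus>\<^bsub>E\<^esub> (\<ominus>\<^bsub>E\<^esub> y1 \<oplus>\<^bsub>E\<^esub> b \<odot>\<^bsub>E\<^esub> e))"
        unfolding eq using 2(4) car e by (simp add: E.a_assoc)
      also have "\<dots> = y2 \<oplus>\<^bsub>E\<^esub> (y1 \<oplus>\<^bsub>E\<^esub> (\<ominus>\<^bsub>E\<^esub> y1 \<oplus>\<^bsub>E\<^esub> b \<odot>\<^bsub>E\<^esub> e))"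
        using 2(4) car e by (intro E.add.m_lcomm) auto
      also have "\<dots> = y'"
        unfolding 2(2) using 2(4) car e by (simp add: E.r_neg2)
      finally show "y = y'" .
    qed
    then have "G' = G" using max sub by blast
    then show ?thesis using G'I[OF G0 N.R.one_closed] x0 e by auto
  qed
  define h where "h x = (THE y. (x, y) \<in> G)" for x
  have h: "(x, h x) \<in> G" if "x \<in> carrier N" for x
    unfolding h_def using total[OF that] Guniq by (auto intro: theI2)
  have hI: "h x = y" if "(x, y) \<in> G" for x y
    using Guniq[OF h that] Gcar(1)[OF that] by blast
  show ?thesis
  proof (rule that)
    show "h \<in> mod_hom R N E"
      by (rule mod_homI) (auto intro: hI Gadd Gsmult h dest: Gcar(2)[OF h])
    show "h x = f x" if "x \<in> A" for x using hI[OF Gf[OF that]] .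
  qed
qed

lemma baer_injective:
  fixes R :: "('a, 'r) ring_scheme" and E :: "('a, 'e, 'm) module_scheme"
  assumes E: "baer R E"
  shows "injective_module R E"
  unfolding injective_module_def
proof (intro conjI allI impI)
  show modE: "module R E" using E by (simp add: baer_def)
  fix N N' :: "('a, ('a + 'e) tree) module" and i f
  assume H: "module R N \<and> module R N' \<and> i \<in> mod_hom R N N' \<and> inj_on i (carrier N) \<and>
    f \<in> mod_hom R N E"
  then have N: "module R N" "module R N'" and i: "i \<in> mod_hom R N N'" "inj_on i (carrier N)"
    and f: "f \<in> mod_hom R N E" by auto
  interpret N: module R N by fact
  let ?A = "i ` carrier N" and ?k = "inv_into (carrier N) i"
  have k: "?k (i x) = x" if "x \<in> carrier N" for x
    using i(2) that by (rule inv_into_f_f)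
  have "(\<lambda>y. f (?k y)) \<in> mod_hom R (N'\<lparr>carrier := ?A\<rparr>) E"
    by (rule mod_homI)
      (auto simp: k mod_homD[OF f] mod_homD(2,3)[OF i(1), symmetric])
  then obtain h where "h \<in> mod_hom R N' E" "\<And>y. y \<in> ?A \<Longrightarrow> h y = f (?k y)"
    using baer_extend[OF E N(2) image_submodule[OF N i(1)]] by blast
  then show "\<exists>h\<in>mod_hom R N' E. \<forall>x\<in>carrier N. h (i x) = f x"
    using k by (metis image_eqI)
qed

section \<open>Divisible groups as modules over the integers\<close>

definition int_module :: "('b, 'm) ring_scheme \<Rightarrow> (int, 'b) module"
  where "int_module G =
    \<lparr>carrier = carrier G, mult = undefined, one = undefined, zero = \<zero>\<^bsub>G\<^esub>, add = add G,
     smult = (\<lambda>k x. x [^]\<^bsub>add_monoid G\<^esub> k)\<rparr>"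

lemma int_module_simps:
  "carrier (int_module G) = carrier G" "\<zero>\<^bsub>int_module G\<^esub> = \<zero>\<^bsub>G\<^esub>"
  "x \<oplus>\<^bsub>int_module G\<^esub> y = x \<oplus>\<^bsub>G\<^esub> y"
  "k \<odot>\<^bsub>int_module G\<^esub> x = x [^]\<^bsub>add_monoid G\<^esub> k"
  by (auto simp: int_module_def)

lemma int_module:
  assumes "abelian_group G"
  shows "module \<Z> (int_module G)"
proof -
  interpret G: abelian_group G by fact
  show ?thesis
  proof (rule moduleI)
    show "abelian_group (int_module G)"
    proof (rule abelian_groupI)
      fix x assume "x \<in> carrier (int_module G)"
      then show "\<exists>y\<in>carrier (int_module G). y \<oplus>\<^bsub>int_module G\<^esub> x = \<zero>\<^bsub>int_module G\<^esub>"
        by (intro bexI[of _ "\<ominus>\<^bsub>G\<^esub> x"]) (auto simp: int_module_simps G.l_neg)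
    qed (auto simp: int_module_simps G.a_assoc intro: G.a_comm)
    fix a b :: int and x y
    assume x: "x \<in> carrier (int_module G)"
    show "a \<odot>\<^bsub>int_module G\<^esub> x \<in> carrier (int_module G)"
      using x group.int_pow_closed[OF G.a_group, of x a] by (simp add: int_module_simps)
    show "(a \<oplus>\<^bsub>\<Z>\<^esub> b) \<odot>\<^bsub>int_module G\<^esub> x = a \<odot>\<^bsub>int_module G\<^esub> x \<oplus>\<^bsub>int_module G\<^esub> b \<odot>\<^bsub>int_module G\<^esub> x"
      using x group.int_pow_mult[OF G.a_group, of x a b] by (simp add: int_module_simps)
    show "(a \<otimes>\<^bsub>\<Z>\<^esub> b) \<odot>\<^bsub>int_module G\<^esub> x = a \<odot>\<^bsub>int_module G\<^esub> (b \<odot>\<^bsub>int_module G\<^esub> x)"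
      using x group.int_pow_pow[OF G.a_group, of x b a] by (simp add: int_module_simps mult.commute)
    show "\<one>\<^bsub>\<Z>\<^esub> \<odot>\<^bsub>int_module G\<^esub> x = x"
      using x group.int_pow_1[OF G.a_group, of x] by (simp add: int_module_simps)
    assume y: "y \<in> carrier (int_module G)"
    show "a \<odot>\<^bsub>int_module G\<^esub> (x \<oplus>\<^bsub>int_module G\<^esub> y) =
        a \<odot>\<^bsub>int_module G\<^esub> x \<oplus>\<^bsub>int_module G\<^esub> a \<odot>\<^bsub>int_module G\<^esub> y"
      using x y group.int_pow_mult_distrib[OF G.a_group, of x y a] by (simp add: int_module_simps G.a_comm)
  qed (rule int_is_cring)
qed

lemma additive_int_linear:
  assumes A: "module \<Z> A" and B: "module \<Z> B"
    and h: "\<And>x. x \<in> carrier A \<Longrightarrow> h x \<in> carrier B"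
    and add: "\<And>x y. x \<in> carrier A \<Longrightarrow> y \<in> carrier A \<Longrightarrow> h (x \<oplus>\<^bsub>A\<^esub> y) = h x \<oplus>\<^bsub>B\<^esub> h y"
  shows "h \<in> mod_hom \<Z> A B"
proof (rule mod_homI[OF h add])
  interpret A: module \<Z> A by fact
  interpret B: module \<Z> B by fact
  fix k :: int and x assume x: "x \<in> carrier A"
  have cl: "j \<odot>\<^bsub>A\<^esub> x \<in> carrier A" "j \<odot>\<^bsub>B\<^esub> h x \<in> carrier B" for j
    using A.smult_closed[of j x] B.smult_closed[of j "h x"] x h by auto
  have stepA: "(j + 1) \<odot>\<^bsub>A\<^esub> x = j \<odot>\<^bsub>A\<^esub> x \<oplus>\<^bsub>A\<^esub> x" for j
    using A.smult_l_distr[of j 1 x] A.smult_one[of x] x by simp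
  have stepB: "(j + 1) \<odot>\<^bsub>B\<^esub> h x = j \<odot>\<^bsub>B\<^esub> h x \<oplus>\<^bsub>B\<^esub> h x" for j
    using B.smult_l_distr[of j 1 "h x"] B.smult_one[of "h x"] h[OF x] by simp
  have "h \<zero>\<^bsub>A\<^esub> \<oplus>\<^bsub>B\<^esub> h \<zero>\<^bsub>A\<^esub> = h \<zero>\<^bsub>A\<^esub>"
    using add[of "\<zero>\<^bsub>A\<^esub>" "\<zero>\<^bsub>A\<^esub>"] by simp
  then have zero: "h \<zero>\<^bsub>A\<^esub> = \<zero>\<^bsub>B\<^esub>"
    using h[OF A.zero_closed] B.add.r_cancel_one' by metis
  show "h (k \<odot>\<^bsub>A\<^esub> x) = k \<odot>\<^bsub>B\<^esub> h x"
  proof (induction k rule: int_induct[where k = 0])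
    case base
    then show ?case using A.smult_l_null[OF x] B.smult_l_null[OF h[OF x]] zero by simp
  next
    case (step1 j)
    then show ?case using cl x by (simp add: stepA stepB add)
  next
    case (step2 j)
    have "h ((j - 1) \<odot>\<^bsub>A\<^esub> x) \<oplus>\<^bsub>B\<^esub> h x = (j - 1) \<odot>\<^bsub>B\<^esub> h x \<oplus>\<^bsub>B\<^esub> h x"
      using step2 stepA[of "j - 1"] stepB[of "j - 1"] add[OF cl(1) x, of "j - 1"] by simp
    then show ?case using cl h x by simp
  qed
qed

definition divisible :: "(int, 'b, 'm) module_scheme \<Rightarrow> bool"
  where "divisible D \<longleftrightarrow> (\<forall>x\<in>carrier D. \<forall>n>0. \<exists>y\<in>carrier D. n \<odot>\<^bsub>D\<^esub> y = x)"

text \<open>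
  An ideal of the integers is generated by its least positive element \<open>d\<close>, and the value at \<open>d\<close> can be
  divided by \<open>d\<close>.
\<close>

lemma divisible_baer:
  assumes D: "module \<Z> D" and div: "divisible D"
  shows "baer \<Z> D"
  unfolding baer_def
proof (intro conjI allI impI)
  interpret D: module \<Z> D by fact
  fix J f assume "ideal J \<Z> \<and> f \<in> mod_hom \<Z> (ideal_module \<Z> J) D"
  then have J: "ideal J \<Z>" and f: "f \<in> mod_hom \<Z> (ideal_module \<Z> J) D" by auto
  interpret J: ideal J \<Z> by fact
  have f0: "f 0 = \<zero>\<^bsub>D\<^esub>"
    using mod_hom_zero[OF ideal_module[OF int_is_cring J] D f] by (simp add: ideal_module_simps)
  have mult: "k * a \<in> J" if "a \<in> J" for k a using J.I_l_closed[OF that, of k] by simp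
  show "\<exists>e\<in>carrier D. \<forall>a\<in>J. f a = a \<odot>\<^bsub>D\<^esub> e"
  proof (cases "\<exists>n>0. int n \<in> J")
    case False
    have "a = 0" if "a \<in> J" for a
      using False mult[OF that, of "sgn a"] by (metis abs_sgn mult.commute nat_0_le abs_ge_zero
          not_gr_zero of_nat_0 abs_eq_0)
    then have "f a = a \<odot>\<^bsub>D\<^esub> \<zero>\<^bsub>D\<^esub>" if "a \<in> J" for a
      using that f0 D.smult_r_null[of a] by auto
    then show ?thesis by blast
  next
    case True
    define d where "d = (LEAST n. n > 0 \<and> int n \<in> J)"
    have d: "d > 0" "int d \<in> J" using True LeastI_ex[of "\<lambda>n. n > 0 \<and> int n \<in> J"] d_def by auto
    have gen: "\<exists>q. a = q * int d" if a: "a \<in> J" for a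
    proof -
      have "a + (- (a div int d)) * int d = a mod int d" by (simp add: minus_div_mult_eq_mod)
      then have "a mod int d \<in> J"
        using J.a_closed[OF a mult[OF d(2), of "- (a div int d)"]] by simp
      moreover have "nat (a mod int d) < d" using d(1) by (simp add: nat_less_iff)
      ultimately have "nat (a mod int d) = 0"
        using not_less_Least[of "nat (a mod int d)" "\<lambda>n. n > 0 \<and> int n \<in> J"] d(1)
        unfolding d_def[symmetric] by auto
      then have "a mod int d = 0" using d(1) by (simp add: nat_eq_iff)
      then show ?thesis by (metis dvd_def mod_eq_0_iff_dvd mult.commute)
    qed
    obtain e where e: "e \<in> carrier D" "int d \<odot>\<^bsub>D\<^esub> e = f (int d)"
      using div d mod_homD(1)[OF f] unfolding divisible_def
      by (metis ideal_module_simps(1) of_nat_0_less_iff)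
    have "f a = a \<odot>\<^bsub>D\<^esub> e" if "a \<in> J" for a
    proof -
      obtain q where q: "a = q * int d" using gen[OF \<open>a \<in> J\<close>] by blast
      have "f a = q \<odot>\<^bsub>D\<^esub> f (int d)"
        using mod_homD(3)[OF f, of q "int d"] d(2) by (simp add: q ideal_module_simps)
      also have "\<dots> = a \<odot>\<^bsub>D\<^esub> e"
        using D.smult_assoc1[of q "int d" e] e by (simp add: q)
      finally show ?thesis .
    qed
    then show ?thesis using e(1) by blast
  qed
qed (rule D)

text \<open>
  The direct sum of copies of the rational numbers indexed by \<open>S\<close>, as a module over the integers.
\<close>

definition rat_functions :: "'x set \<Rightarrow> (int, 'x \<Rightarrow> rat) module"
  where "rat_functions S =
    \<lparr>carrier = {f. (\<forall>x. x \<notin> S \<longrightarrow> f x = 0) \<and> finite {x. f x \<noteq> 0}}, mult = undefined, one = undefined,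
     zero = (\<lambda>x. 0), add = (\<lambda>f g x. f x + g x), smult = (\<lambda>k f x. of_int k * f x)\<rparr>"

lemma rat_functions_simps:
  "f \<in> carrier (rat_functions S) \<longleftrightarrow> (\<forall>x. x \<notin> S \<longrightarrow> f x = 0) \<and> finite {x. f x \<noteq> 0}"
  "\<zero>\<^bsub>rat_functions S\<^esub> = (\<lambda>x. 0)" "f \<oplus>\<^bsub>rat_functions S\<^esub> g = (\<lambda>x. f x + g x)"
  "k \<odot>\<^bsub>rat_functions S\<^esub> f = (\<lambda>x. of_int k * f x)"
  by (auto simp: rat_functions_def)

lemma rat_functions: "module \<Z> (rat_functions S)"
proof (rule moduleI)
  have add: "finite {x. f x + g x \<noteq> 0}"
    if "finite {x. f x \<noteq> 0}" "finite {x. g x \<noteq> 0}" for f g :: "'b \<Rightarrow> rat"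
    by (rule finite_subset[OF _ finite_UnI[OF that]]) auto
  show "abelian_group (rat_functions S)"
  proof (rule abelian_groupI)
    fix f assume "f \<in> carrier (rat_functions S)"
    then show "\<exists>g\<in>carrier (rat_functions S). g \<oplus>\<^bsub>rat_functions S\<^esub> f = \<zero>\<^bsub>rat_functions S\<^esub>"
      by (intro bexI[of _ "\<lambda>x. - f x"]) (auto simp: rat_functions_simps)
  qed (auto simp: rat_functions_simps add add.assoc add.commute)
  fix k :: int and f assume f: "f \<in> carrier (rat_functions S)"
  have "{x. of_int k * f x \<noteq> 0} \<subseteq> {x. f x \<noteq> 0}" by auto
  then show "k \<odot>\<^bsub>rat_functions S\<^esub> f \<in> carrier (rat_functions S)"
    using f by (auto simp: rat_functions_simps dest: finite_subset)
qed (auto simp: rat_functions_simps int_is_cring algebra_simps)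

text \<open>
  A group \<open>N\<close> is a quotient of the free abelian group on its elements. Dividing the same relations \<open>K\<close>
  out of the rational combinations of elements gives a divisible group, and \<open>N\<close> embeds in it because an
  integral combination lies in \<open>K\<close> only if its value in \<open>N\<close> vanishes. The divisible group is
  made of finite data over \<open>N\<close>; duality with the rationals modulo the integers would
  also embed \<open>N\<close>, but raises the cardinality at each step of a resolution.
\<close>

lemma divisible_embedding:
  fixes N :: "(int, 'x, 'm) module_scheme"
  assumes N: "module \<Z> N"
  obtains K j where "submodule K \<Z> (rat_functions (carrier N))"
    and "divisible (quotient_module (rat_functions (carrier N)) K)"
    and "j \<in> mod_hom \<Z> N (quotient_module (rat_functions (carrier N)) K)"
    and "inj_on j (carrier N)"
proof -
  let ?S = "carrier N"
  let ?F = "free_module \<Z> ?S" and ?Q = "rat_functions ?S"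
  interpret N: module \<Z> N by fact
  have F: "module \<Z> ?F" by (rule free_module[OF int_is_cring])
  interpret F: module \<Z> ?F by fact
  have Q: "module \<Z> ?Q" by (rule rat_functions)
  interpret Q: module \<Z> ?Q by fact
  define \<iota> :: "('x \<Rightarrow> int) \<Rightarrow> 'x \<Rightarrow> rat" where "\<iota> f = (\<lambda>x. of_int (f x))" for f
  have \<iota>: "\<iota> \<in> mod_hom \<Z> ?F ?Q"
    by (rule mod_homI) (auto simp: \<iota>_def free_module_simps rat_functions_simps)
  have \<iota>_inj: "f = g" if "\<iota> f = \<iota> g" for f g
    using that by (auto simp: \<iota>_def fun_eq_iff)
  define ev where "ev = free_lift \<Z> N (\<lambda>x. x)"
  have ev: "ev \<in> mod_hom \<Z> ?F N" and ev_single: "\<And>x. x \<in> ?S \<Longrightarrow> ev (single \<Z> x) = x"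
    unfolding ev_def using free_lift[OF N, of ?S "\<lambda>x. x"] by auto
  define Z where "Z = {f \<in> carrier ?F. ev f = \<zero>\<^bsub>N\<^esub>}"
  have Z: "submodule Z \<Z> ?F" unfolding Z_def by (rule kernel_submodule[OF F N ev])
  have "\<iota> \<in> mod_hom \<Z> (?F\<lparr>carrier := Z\<rparr>) ?Q"
    by (rule mod_homI) (auto simp: Z_def mod_homD[OF \<iota>])
  then have K: "submodule (\<iota> ` Z) \<Z> ?Q"
    using image_submodule[OF submodule.submodule_is_module[OF Z F] Q] by simp
  let ?D = "quotient_module ?Q (\<iota> ` Z)"
  note D = quotient_module[OF Q K]
  interpret D: module \<Z> ?D by (rule D(1))
  note \<pi> = mod_homD[OF D(2)]
  have s: "single \<Z> x \<in> carrier ?F" if "x \<in> ?S" for x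
    using that by (rule single_in_free_module[OF int_is_cring])
  have \<iota>s: "\<iota> f \<in> carrier ?Q" if "f \<in> carrier ?F" for f using mod_homD(1)[OF \<iota> that] .
  define j where "j x = \<iota> ` Z +>\<^bsub>?Q\<^esub> \<iota> (single \<Z> x)" for x
  have j: "j \<in> mod_hom \<Z> N ?D"
  proof (rule additive_int_linear[OF N D(1)])
    fix x y assume xy: "x \<in> ?S" "y \<in> ?S"
    show "j x \<in> carrier ?D" unfolding j_def using \<pi>(1) \<iota>s[OF s[OF xy(1)]] by blast
    let ?sum = "single \<Z> x \<oplus>\<^bsub>?F\<^esub> single \<Z> y"
    have sum: "?sum \<in> carrier ?F" and sxy: "single \<Z> (x \<oplus>\<^bsub>N\<^esub> y) \<in> carrier ?F"
      using xy s by auto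
    have "single \<Z> (x \<oplus>\<^bsub>N\<^esub> y) \<ominus>\<^bsub>?F\<^esub> ?sum \<in> Z"
      using xy s sum sxy unfolding Z_def
      by (auto simp: mod_hom_minus[OF F N ev] mod_homD(2)[OF ev] ev_single N.minus_eq_zero_iff)
    then have "\<iota> (single \<Z> (x \<oplus>\<^bsub>N\<^esub> y)) \<ominus>\<^bsub>?Q\<^esub> \<iota> ?sum \<in> \<iota> ` Z"
      using mod_hom_minus[OF F Q \<iota> sxy sum] by (metis image_eqI)
    then have "j (x \<oplus>\<^bsub>N\<^esub> y) = \<iota> ` Z +>\<^bsub>?Q\<^esub> \<iota> ?sum"
      unfolding j_def using coset_eq_iff[OF Q K \<iota>s[OF sxy] \<iota>s[OF sum]] by blast
    also have "\<dots> = j x \<oplus>\<^bsub>?D\<^esub> j y"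
      unfolding j_def mod_homD(2)[OF \<iota> s[OF xy(1)] s[OF xy(2)]]
      by (rule \<pi>(2)[OF \<iota>s[OF s[OF xy(1)]] \<iota>s[OF s[OF xy(2)]]])
    finally show "j (x \<oplus>\<^bsub>N\<^esub> y) = j x \<oplus>\<^bsub>?D\<^esub> j y" .
  qed
  have "inj_on j ?S"
  proof (rule mod_hom_inj_onI[OF N D(1) j])
    fix x assume x: "x \<in> ?S" "j x = \<zero>\<^bsub>?D\<^esub>"
    then have "\<iota> (single \<Z> x) \<in> \<iota> ` Z"
      unfolding j_def using D(3)[OF \<iota>s[OF s[OF x(1)]]] by blast
    then have "single \<Z> x \<in> Z" using \<iota>_inj by blast
    then show "x = \<zero>\<^bsub>N\<^esub>" using ev_single[OF x(1)] by (simp add: Z_def)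
  qed
  moreover have "divisible ?D"
    unfolding divisible_def
  proof (intro ballI allI impI)
    fix X and n :: int assume "X \<in> carrier ?D" and n: "n > 0"
    then obtain q where q: "q \<in> carrier ?Q" "X = \<iota> ` Z +>\<^bsub>?Q\<^esub> q"
      by (auto simp: quotient_module_carrier)
    define q' where "q' = (\<lambda>x. q x / of_int n)"
    have q': "q' \<in> carrier ?Q" using q(1) n by (auto simp: q'_def rat_functions_simps)
    have "n \<odot>\<^bsub>?Q\<^esub> q' = q" using n by (auto simp: q'_def rat_functions_simps)
    then have "n \<odot>\<^bsub>?D\<^esub> (\<iota> ` Z +>\<^bsub>?Q\<^esub> q') = X"
      using \<pi>(3)[OF _ q', of n] q(2) by simp
    then show "\<exists>y\<in>carrier ?D. n \<odot>\<^bsub>?D\<^esub> y = X" using \<pi>(1)[OF q'] by blast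
  qed
  ultimately show ?thesis using that K j by blast
qed

section \<open>Enough injectives, with control of the cardinality\<close>

text \<open>
  The additive maps from \<open>R\<close> to \<open>D\<close>, with \<open>R\<close> acting on the argument. They are required to be zero off the
  carrier of \<open>R\<close>, so that maps agreeing on the carrier are equal.
\<close>

definition coinduced_module ::
  "('a, 'r) ring_scheme \<Rightarrow> (int, 'd, 'm) module_scheme \<Rightarrow> ('a, 'a \<Rightarrow> 'd) module"
  where "coinduced_module R D =
    \<lparr>carrier = {\<phi>. (\<forall>a\<in>carrier R. \<phi> a \<in> carrier D) \<and> (\<forall>a. a \<notin> carrier R \<longrightarrow> \<phi> a = \<zero>\<^bsub>D\<^esub>) \<and>
       (\<forall>a\<in>carrier R. \<forall>b\<in>carrier R. \<phi> (a \<oplus>\<^bsub>R\<^esub> b) = \<phi> a \<oplus>\<^bsub>D\<^esub> \<phi> b)},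
     mult = undefined, one = undefined, zero = (\<lambda>a. \<zero>\<^bsub>D\<^esub>),
     add = (\<lambda>\<phi> \<psi> a. \<phi> a \<oplus>\<^bsub>D\<^esub> \<psi> a),
     smult = (\<lambda>r \<phi> a. if a \<in> carrier R then \<phi> (a \<otimes>\<^bsub>R\<^esub> r) else \<zero>\<^bsub>D\<^esub>)\<rparr>"

lemma coinduced_module_simps:
  "\<phi> \<in> carrier (coinduced_module R D) \<longleftrightarrow>
     (\<forall>a\<in>carrier R. \<phi> a \<in> carrier D) \<and> (\<forall>a. a \<notin> carrier R \<longrightarrow> \<phi> a = \<zero>\<^bsub>D\<^esub>) \<and>
     (\<forall>a\<in>carrier R. \<forall>b\<in>carrier R. \<phi> (a \<oplus>\<^bsub>R\<^esub> b) = \<phi> a \<oplus>\<^bsub>D\<^esub> \<phi> b)"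
  "\<zero>\<^bsub>coinduced_module R D\<^esub> = (\<lambda>a. \<zero>\<^bsub>D\<^esub>)"
  "\<phi> \<oplus>\<^bsub>coinduced_module R D\<^esub> \<psi> = (\<lambda>a. \<phi> a \<oplus>\<^bsub>D\<^esub> \<psi> a)"
  "r \<odot>\<^bsub>coinduced_module R D\<^esub> \<phi> = (\<lambda>a. if a \<in> carrier R then \<phi> (a \<otimes>\<^bsub>R\<^esub> r) else \<zero>\<^bsub>D\<^esub>)"
  by (auto simp: coinduced_module_def)

lemma coinduced_module:
  fixes R :: "('a, 'r) ring_scheme"
  assumes R: "cring R" and D: "module \<Z> D"
  shows "module R (coinduced_module R D)"
proof -
  interpret R: cring R by fact
  interpret D: module \<Z> D by fact
  let ?E = "coinduced_module R D"
  have val: "\<phi> a \<in> carrier D" if "\<phi> \<in> carrier ?E" for \<phi> a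
    using that by (cases "a \<in> carrier R") (auto simp: coinduced_module_simps)
  show ?thesis
  proof (rule moduleI)
    show "abelian_group ?E"
    proof (rule abelian_groupI)
      fix \<phi> \<psi> assume \<phi>: "\<phi> \<in> carrier ?E" and \<psi>: "\<psi> \<in> carrier ?E"
      show "\<phi> \<oplus>\<^bsub>?E\<^esub> \<psi> \<in> carrier ?E"
        using \<phi> \<psi> val[OF \<phi>] val[OF \<psi>] by (simp add: coinduced_module_simps D.add.m_ac)
      show "\<phi> \<oplus>\<^bsub>?E\<^esub> \<psi> = \<psi> \<oplus>\<^bsub>?E\<^esub> \<phi>"
        using val[OF \<phi>] val[OF \<psi>] by (simp add: coinduced_module_simps D.add.m_comm)
    next
      fix \<phi> \<psi> \<chi> assume "\<phi> \<in> carrier ?E" "\<psi> \<in> carrier ?E" "\<chi> \<in> carrier ?E"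
      then show "\<phi> \<oplus>\<^bsub>?E\<^esub> \<psi> \<oplus>\<^bsub>?E\<^esub> \<chi> = \<phi> \<oplus>\<^bsub>?E\<^esub> (\<psi> \<oplus>\<^bsub>?E\<^esub> \<chi>)"
        using val by (simp add: coinduced_module_simps D.a_assoc)
    next
      fix \<phi> assume \<phi>: "\<phi> \<in> carrier ?E"
      show "\<zero>\<^bsub>?E\<^esub> \<oplus>\<^bsub>?E\<^esub> \<phi> = \<phi>" using val[OF \<phi>] by (simp add: coinduced_module_simps)
      have "(\<lambda>a. \<ominus>\<^bsub>D\<^esub> \<phi> a) \<in> carrier ?E"
        using \<phi> val[OF \<phi>] by (simp add: coinduced_module_simps D.minus_add)
      then show "\<exists>\<psi>\<in>carrier ?E. \<psi> \<oplus>\<^bsub>?E\<^esub> \<phi> = \<zero>\<^bsub>?E\<^esub>"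
        using val[OF \<phi>] by (intro bexI[of _ "\<lambda>a. \<ominus>\<^bsub>D\<^esub> \<phi> a"]) (simp_all add: coinduced_module_simps D.l_neg)
    qed (simp add: coinduced_module_simps)
    fix a b :: 'a and \<phi> assume a: "a \<in> carrier R" and \<phi>: "\<phi> \<in> carrier ?E"
    show "a \<odot>\<^bsub>?E\<^esub> \<phi> \<in> carrier ?E"
      using a \<phi> by (simp add: coinduced_module_simps R.l_distr)
    assume b: "b \<in> carrier R"
    show "(a \<oplus>\<^bsub>R\<^esub> b) \<odot>\<^bsub>?E\<^esub> \<phi> = a \<odot>\<^bsub>?E\<^esub> \<phi> \<oplus>\<^bsub>?E\<^esub> b \<odot>\<^bsub>?E\<^esub> \<phi>"
      using a b \<phi> by (auto simp: coinduced_module_simps R.r_distr)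
    show "(a \<otimes>\<^bsub>R\<^esub> b) \<odot>\<^bsub>?E\<^esub> \<phi> = a \<odot>\<^bsub>?E\<^esub> (b \<odot>\<^bsub>?E\<^esub> \<phi>)"
      using a b \<phi> by (auto simp: coinduced_module_simps R.m_assoc)
  next
    fix a \<phi> \<psi> assume "a \<in> carrier R" "\<phi> \<in> carrier ?E" "\<psi> \<in> carrier ?E"
    then show "a \<odot>\<^bsub>?E\<^esub> (\<phi> \<oplus>\<^bsub>?E\<^esub> \<psi>) = a \<odot>\<^bsub>?E\<^esub> \<phi> \<oplus>\<^bsub>?E\<^esub> a \<odot>\<^bsub>?E\<^esub> \<psi>"
      by (auto simp: coinduced_module_simps)
  next
    fix \<phi> assume \<phi>: "\<phi> \<in> carrier ?E"
    show "\<one>\<^bsub>R\<^esub> \<odot>\<^bsub>?E\<^esub> \<phi> = \<phi>" using \<phi> by (auto simp: coinduced_module_simps)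
  qed (rule R)
qed

text \<open>
  An \<open>R\<close>-linear map from an ideal to \<open>Hom(R, D)\<close> is the same thing as an additive map from the ideal
  to \<open>D\<close>, obtained by evaluating at \<open>1\<close>; the latter extends to \<open>R\<close> because \<open>D\<close> is injective over the integers.
\<close>

lemma coinduced_module_baer:
  fixes R :: "('a, 'r) ring_scheme" and D :: "(int, 'd, 'm) module_scheme"
  assumes R: "cring R" and D: "baer \<Z> D"
  shows "baer R (coinduced_module R D)"
  unfolding baer_def
proof (intro conjI allI impI)
  have modD: "module \<Z> D" using D by (simp add: baer_def)
  show "module R (coinduced_module R D)" by (rule coinduced_module[OF R modD])
  interpret R: cring R by fact
  interpret D: module \<Z> D by fact
  let ?E = "coinduced_module R D" and ?Z = "int_module R"
  fix J f assume "ideal J R \<and> f \<in> mod_hom R (ideal_module R J) ?E"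
  then have J: "ideal J R" and f: "f \<in> mod_hom R (ideal_module R J) ?E" by auto
  note fD = mod_homD[OF f, unfolded ideal_module_simps]
  interpret J: ideal J R by fact
  have Z: "module \<Z> ?Z" by (rule int_module) (rule R.is_abelian_group)
  interpret Z: module \<Z> ?Z by fact
  have JZ: "submodule J \<Z> ?Z"
  proof (rule Z.submoduleI)
    show "\<ominus>\<^bsub>?Z\<^esub> a \<in> J" if "a \<in> J" for a
    proof -
      have "\<ominus>\<^bsub>?Z\<^esub> a = \<ominus>\<^bsub>R\<^esub> a"
        using that J.Icarr by (intro Z.minus_equality) (auto simp: int_module_simps R.l_neg)
      then show ?thesis using that by simp
    qed
    show "k \<odot>\<^bsub>?Z\<^esub> a \<in> J" if a: "a \<in> J" for k a
    proof -
      have "k \<odot>\<^bsub>?Z\<^esub> a = ([k] \<cdot>\<^bsub>R\<^esub> \<one>\<^bsub>R\<^esub>) \<otimes>\<^bsub>R\<^esub> a"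
        using R.add_pow_ldistr_int[of "\<one>\<^bsub>R\<^esub>" a k] J.Icarr[OF a]
        by (simp add: int_module_simps add_pow_def)
      moreover have "[k] \<cdot>\<^bsub>R\<^esub> \<one>\<^bsub>R\<^esub> \<in> carrier R" by simp
      ultimately show ?thesis using J.I_l_closed[OF a] by simp
    qed
  qed (use J.Icarr in \<open>auto simp: int_module_simps\<close>)
  define g where "g a = f a \<one>\<^bsub>R\<^esub>" for a
  have "g \<in> mod_hom \<Z> (?Z\<lparr>carrier := J\<rparr>) D"
  proof (rule additive_int_linear[OF submodule.submodule_is_module[OF JZ Z] modD])
    fix a assume "a \<in> carrier (?Z\<lparr>carrier := J\<rparr>)"
    then show "g a \<in> carrier D"
      using fD(1)[of a] by (simp add: g_def coinduced_module_simps)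
    fix b assume "b \<in> carrier (?Z\<lparr>carrier := J\<rparr>)"
    then show "g (a \<oplus>\<^bsub>?Z\<lparr>carrier := J\<rparr>\<^esub> b) = g a \<oplus>\<^bsub>D\<^esub> g b"
      using \<open>a \<in> carrier _\<close> fD(2)[of a b] by (simp add: g_def coinduced_module_simps int_module_simps)
  qed
  then obtain h where h: "h \<in> mod_hom \<Z> ?Z D" "\<And>a. a \<in> J \<Longrightarrow> h a = g a"
    using baer_extend[OF D Z JZ] by blast
  define e where "e = (\<lambda>a. if a \<in> carrier R then h a else \<zero>\<^bsub>D\<^esub>)"
  have e: "e \<in> carrier ?E"
    using mod_homD(1,2)[OF h(1)] by (simp add: coinduced_module_simps e_def int_module_simps)
  have "f a = a \<odot>\<^bsub>?E\<^esub> e" if a: "a \<in> J" for a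
  proof
    fix b
    have aR: "a \<in> carrier R" using J.Icarr[OF a] .
    show "f a b = (a \<odot>\<^bsub>?E\<^esub> e) b"
    proof (cases "b \<in> carrier R")
      case False
      then show ?thesis using fD(1)[OF a] by (simp add: coinduced_module_simps)
    next
      case True
      have ba: "b \<otimes>\<^bsub>R\<^esub> a \<in> J" using J.I_l_closed[OF a True] .
      have "(a \<odot>\<^bsub>?E\<^esub> e) b = g (b \<otimes>\<^bsub>R\<^esub> a)"
        using True aR h(2)[OF ba] by (simp add: coinduced_module_simps e_def)
      also have "\<dots> = (b \<odot>\<^bsub>?E\<^esub> f a) \<one>\<^bsub>R\<^esub>" by (simp add: g_def fD(3)[OF True a])
      also have "\<dots> = f a b" using True by (simp add: coinduced_module_simps)
      finally show ?thesis by simp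
    qed
  qed
  then show "\<exists>e\<in>carrier ?E. \<forall>a\<in>J. f a = a \<odot>\<^bsub>?E\<^esub> e" using e by blast
qed

lemma transport_module_baer:
  assumes E: "baer R E" and g: "inj_on g (carrier E)"
  shows "baer R (transport_module g E)"
  unfolding baer_def
proof (intro conjI allI impI)
  have modE: "module R E" using E by (simp add: baer_def)
  note T = transport_module[OF modE g]
  show "module R (transport_module g E)" by (rule T(1))
  fix J f assume "ideal J R \<and> f \<in> mod_hom R (ideal_module R J) (transport_module g E)"
  then have J: "ideal J R" and f: "f \<in> mod_hom R (ideal_module R J) (transport_module g E)" by auto
  let ?k = "inv_into (carrier E) g"
  obtain e where e: "e \<in> carrier E" "\<And>a. a \<in> J \<Longrightarrow> ?k (f a) = a \<odot>\<^bsub>E\<^esub> e"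
    using E J mod_hom_comp[OF f transport_module_inverse[OF modE g]] unfolding baer_def by blast
  have "f a = a \<odot>\<^bsub>transport_module g E\<^esub> g e" if a: "a \<in> J" for a
  proof -
    have "f a \<in> g ` carrier E" using mod_homD(1)[OF f] a by (simp add: ideal_module_simps T(3))
    then have "f a = g (?k (f a))" by (simp add: f_inv_into_f)
    also have "\<dots> = a \<odot>\<^bsub>transport_module g E\<^esub> g e"
      using mod_homD(3)[OF T(2) ideal.Icarr[OF J a] e(1)] by (simp add: e(2)[OF a])
    finally show ?thesis .
  qed
  then show "\<exists>e\<in>carrier (transport_module g E). \<forall>a\<in>J. f a = a \<odot>\<^bsub>transport_module g E\<^esub> e"
    using e(1) by (auto simp: T(3))
qed

text \<open>
  Finite lists of trees are trees, and a number is coded by the length of such a list; hence a finitely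
  supported function on trees with values in a countable set is coded by its graph over the support.
\<close>

lemma finite_support_rat_embedding:
  "\<exists>g :: ('a tree \<Rightarrow> rat) \<Rightarrow> 'a tree. inj_on g {f. finite {x. f x \<noteq> 0}}"
proof -
  define code :: "rat \<Rightarrow> 'a tree" where "code q = Node (replicate (to_nat q) (Node []))" for q
  have code: "q = q'" if "code q = code q'" for q q'
  proof -
    have "to_nat q = to_nat q'" using that by (metis code_def tree.inject(2) length_replicate)
    then show ?thesis by simp
  qed
  define supp :: "('a tree \<Rightarrow> rat) \<Rightarrow> 'a tree list" where "supp f = (SOME xs. set xs = {x. f x \<noteq> 0})" for f
  have supp: "set (supp f) = {x. f x \<noteq> 0}" if "finite {x. f x \<noteq> 0}" for f
    unfolding supp_def using finite_list[OF that] by (rule someI_ex)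
  let ?g = "\<lambda>f. Node (map (\<lambda>x. Node [x, code (f x)]) (supp f))"
  have "inj_on ?g {f. finite {x. f x \<noteq> 0}}"
  proof (rule inj_onI, rule ext)
    fix f f' :: "'a tree \<Rightarrow> rat" and x
    assume "f \<in> {f. finite {x. f x \<noteq> 0}}" "f' \<in> {f. finite {x. f x \<noteq> 0}}" and eq: "?g f = ?g f'"
    then have s: "set (supp f) = {x. f x \<noteq> 0}" "set (supp f') = {x. f' x \<noteq> 0}" by (simp_all add: supp)
    have "(\<lambda>x. Node [x, code (f x)]) ` set (supp f) = (\<lambda>x. Node [x, code (f' x)]) ` set (supp f')"
      using arg_cong[OF eq[unfolded tree.inject], of set] by (simp only: list.set_map)
    then have *: "(\<lambda>x. Node [x, code (f x)]) ` {x. f x \<noteq> 0} = (\<lambda>x. Node [x, code (f' x)]) ` {x. f' x \<noteq> 0}"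
      by (simp only: s)
    have "f x = f' x" if "f x \<noteq> 0"
    proof -
      have "Node [x, code (f x)] \<in> (\<lambda>x. Node [x, code (f' x)]) ` {x. f' x \<noteq> 0}"
        using that unfolding *[symmetric] by blast
      then show ?thesis using code by auto
    qed
    moreover have "f x = f' x" if "f' x \<noteq> 0"
    proof -
      have "Node [x, code (f' x)] \<in> (\<lambda>x. Node [x, code (f x)]) ` {x. f x \<noteq> 0}"
        using that unfolding * by blast
      then show ?thesis using code by auto
    qed
    ultimately show "f x = f' x" by fastforce
  qed
  then show ?thesis by blast
qed

text \<open>
  The module \<open>N\<close> maps to \<open>Hom(R, D)\<close> by sending \<open>x\<close> to the map \<open>a \<mapsto> a x\<close>, where \<open>D\<close> is a divisible group
  containing \<open>N\<close>. With \<open>D\<close> coded in the type of trees, \<open>Hom(R, D)\<close> consists of functions from \<open>'a\<close> to trees,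
  and the injection \<open>F\<close> brings it back to trees.
\<close>

lemma enough_injectives:
  fixes N :: "('a, 'x tree, 'm) module_scheme" and F :: "('a \<Rightarrow> 'x tree) \<Rightarrow> 'x tree"
  assumes N: "module R N" and F: "inj F"
  obtains E :: "('a, 'x tree) module" and e where "baer R E" "e \<in> mod_hom R N E" "inj_on e (carrier N)"
proof -
  interpret N: module R N by fact
  have Z: "module \<Z> (int_module N)" by (rule int_module) (rule N.abelian_group_axioms)
  let ?Q = "rat_functions (carrier (int_module N))"
  obtain K j where K: "submodule K \<Z> ?Q" and div: "divisible (quotient_module ?Q K)"
    and j: "j \<in> mod_hom \<Z> (int_module N) (quotient_module ?Q K)"
    and j_inj: "inj_on j (carrier (int_module N))"
    using divisible_embedding[OF Z] by blast
  let ?D = "quotient_module ?Q K"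
  have modD: "module \<Z> ?D" by (rule quotient_module(1)[OF rat_functions K])
  \<comment> \<open>Choosing representatives of cosets brings the divisible group back into the type of trees.\<close>
  obtain r :: "('x tree \<Rightarrow> rat) \<Rightarrow> 'x tree" where r: "inj_on r {f. finite {x. f x \<noteq> 0}}"
    using finite_support_rat_embedding by blast
  define rep where "rep = inv_into (carrier ?Q) (\<lambda>f. K +>\<^bsub>?Q\<^esub> f)"
  have rep: "rep X \<in> carrier ?Q" "K +>\<^bsub>?Q\<^esub> rep X = X" if "X \<in> carrier ?D" for X
    using inv_into_into[of X "\<lambda>f. K +>\<^bsub>?Q\<^esub> f" "carrier ?Q"]
      f_inv_into_f[of X "\<lambda>f. K +>\<^bsub>?Q\<^esub> f" "carrier ?Q"] that
    unfolding quotient_module_carrier rep_def by blast+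
  define c where "c X = r (rep X)" for X
  have c: "inj_on c (carrier ?D)"
  proof (rule inj_onI)
    fix X Y assume XY: "X \<in> carrier ?D" "Y \<in> carrier ?D" "c X = c Y"
    then have "rep X = rep Y"
      using rep(1)[OF XY(1)] rep(1)[OF XY(2)]
      by (intro inj_onD[OF r]) (auto simp: c_def rat_functions_simps)
    then have "K +>\<^bsub>?Q\<^esub> rep X = K +>\<^bsub>?Q\<^esub> rep Y" by (rule arg_cong)
    then show "X = Y" unfolding rep(2)[OF XY(1)] rep(2)[OF XY(2)] .
  qed
  let ?D' = "transport_module c ?D"
  have D': "baer \<Z> ?D'" by (rule transport_module_baer[OF divisible_baer[OF modD div] c])
  let ?C = "coinduced_module R ?D'"
  have C: "baer R ?C" by (rule coinduced_module_baer[OF N.R.is_cring D'])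
  define i where "i x = c (j x)" for x
  have i: "i \<in> mod_hom \<Z> (int_module N) ?D'"
    unfolding i_def by (rule mod_hom_comp[OF j transport_module(2)[OF modD c]])
  have i_inj: "x = y" if "x \<in> carrier N" "y \<in> carrier N" "i x = i y" for x y
    using that inj_onD[OF c, of "j x" "j y"] inj_onD[OF j_inj, of x y] mod_homD(1)[OF j]
    by (simp add: i_def int_module_simps)
  define e where "e x = (\<lambda>a. if a \<in> carrier R then i (a \<odot>\<^bsub>N\<^esub> x) else \<zero>\<^bsub>?D'\<^esub>)" for x
  have iD: "i x \<in> carrier ?D'" "y \<in> carrier N \<Longrightarrow> i (x \<oplus>\<^bsub>N\<^esub> y) = i x \<oplus>\<^bsub>?D'\<^esub> i y"
    if "x \<in> carrier N" for x y
    using that mod_homD(1,2)[OF i] by (simp_all add: int_module_simps)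
  interpret D': module \<Z> ?D' using D' by (simp add: baer_def)
  have e: "e \<in> mod_hom R N ?C"
  proof (rule mod_homI)
    fix x assume x: "x \<in> carrier N"
    show "e x \<in> carrier ?C"
      using x iD by (simp add: coinduced_module_simps e_def N.smult_l_distr)
    show "e (a \<odot>\<^bsub>N\<^esub> x) = a \<odot>\<^bsub>?C\<^esub> e x" if "a \<in> carrier R" for a
      using x that by (auto simp: coinduced_module_simps e_def N.smult_assoc1)
    show "e (x \<oplus>\<^bsub>N\<^esub> y) = e x \<oplus>\<^bsub>?C\<^esub> e y" if "y \<in> carrier N" for y
      using x that iD by (auto simp: coinduced_module_simps e_def N.smult_r_distr)
  qed
  have e_inj: "inj_on e (carrier N)"
  proof (rule inj_onI)
    fix x y assume xy: "x \<in> carrier N" "y \<in> carrier N" "e x = e y"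
    then have "i x = i y" by (metis e_def N.R.one_closed N.smult_one)
    then show "x = y" using i_inj xy by blast
  qed
  have FC: "inj_on F (carrier ?C)" using F inj_on_subset by blast
  have modC: "module R ?C" using C by (simp add: baer_def)
  show ?thesis
  proof (rule that)
    show "baer R (transport_module F ?C)" by (rule transport_module_baer[OF C FC])
    show "(\<lambda>x. F (e x)) \<in> mod_hom R N (transport_module F ?C)"
      by (rule mod_hom_comp[OF e transport_module(2)[OF modC FC]])
    show "inj_on (\<lambda>x. F (e x)) (carrier N)"
      using comp_inj_on[OF e_inj inj_on_subset[OF F subset_UNIV]] by (simp add: comp_def)
  qed
qed

section \<open>Existence of injective resolutions\<close>

text \<open>
  A tree is determined by the set of its labelled nodes, each recorded with the path from the root.
  A label that is a set is spread over several records, one for each element, so that a tree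
  becomes a set of records and a family of trees a set of pairs. The number in a record tells apart a label
  of the first kind (0), the presence of a set (1), an element of that set (2), and an inner node,
  for which it is the number of children plus 3; the unused components are \<open>undefined\<close>.
\<close>

primrec tree_records :: "('a + 'y set) tree \<Rightarrow> (nat list \<times> nat \<times> 'a \<times> 'y) set"
  where
    "tree_records (Leaf x) = (case x of
       Inl a \<Rightarrow> {([], 0, a, undefined)}
     | Inr S \<Rightarrow> insert ([], 1, undefined, undefined) ((\<lambda>y. ([], 2, undefined, y)) ` S))"
  | "tree_records (Node ts) = insert ([], length ts + 3, undefined, undefined)
       (\<Union>i<length ts. (\<lambda>(p, m). (i # p, m)) ` (map tree_records ts ! i))"

lemma tree_records_inj: "tree_records t = tree_records t' \<Longrightarrow> t = t'"
proof (induction t arbitrary: t')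
  case (Leaf x)
  have roots: "{m. ([], m) \<in> tree_records (Leaf x)} = {m. ([], m) \<in> tree_records t'}"
    using Leaf by simp
  show ?case
  proof (cases t')
    case (Leaf x')
    have eq: "tree_records (Leaf x) = tree_records (Leaf x')"
      using \<open>tree_records (Leaf x) = tree_records t'\<close> Leaf by simp
    show ?thesis
    proof (cases x)
      case (Inl a)
      have "([], 0, a, undefined) \<in> tree_records (Leaf x')" using eq Inl by auto
      then show ?thesis using Leaf Inl by (cases x') auto
    next
      case (Inr S)
      have "([], 1, undefined, undefined) \<in> tree_records (Leaf x')" using eq Inr by auto
      then obtain S' where S': "x' = Inr S'" by (cases x') auto
      have "y \<in> S \<longleftrightarrow> y \<in> S'" for y
      proof -
        have "([], 2, undefined, y) \<in> tree_records (Leaf x) \<longleftrightarrow> y \<in> S" using Inr by auto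
        moreover have "([], 2, undefined, y) \<in> tree_records (Leaf x') \<longleftrightarrow> y \<in> S'" using S' by auto
        ultimately show ?thesis using eq by simp
      qed
      then show ?thesis using Leaf Inr S' by auto
    qed
  next
    case (Node ts)
    then have "([], length ts + 3, undefined, undefined) \<in> tree_records (Leaf x)"
      using \<open>tree_records (Leaf x) = tree_records t'\<close> by simp
    then show ?thesis by (auto split: sum.splits)
  qed
next
  case (Node ts)
  have root: "([], length ts + 3, undefined, undefined) \<in> tree_records t'"
    using Node.prems by auto
  then obtain ts' where t': "t' = Node ts'"
    by (cases t') (auto split: sum.splits)
  then have len: "length ts' = length ts" using root by auto
  have child: "(i # p, m) \<in> tree_records (Node us) \<longleftrightarrow> (p, m) \<in> tree_records (us ! i)"
    if "i < length us" for i p m and us :: "('a + 'b set) tree list"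
    using that by (force simp: image_iff)
  have "ts ! i = ts' ! i" if i: "i < length ts" for i
  proof (rule Node.IH)
    show "ts ! i \<in> set ts" using i by simp
    have "(p, m) \<in> tree_records (ts ! i) \<longleftrightarrow> (p, m) \<in> tree_records (ts' ! i)" for p m
    proof -
      have "(i # p, m) \<in> tree_records (Node ts) \<longleftrightarrow> (i # p, m) \<in> tree_records (Node ts')"
        using Node.prems t' by (simp only:)
      then show ?thesis using child[of i ts] child[of i ts'] i len by (simp only:)
    qed
    then show "tree_records (ts ! i) = tree_records (ts' ! i)" by auto
  qed
  then show ?case using t' len by (metis nth_equalityI)
qed

text \<open>
  A family of subsets of \<open>'y\<close> indexed by \<open>'a\<close> is a subset of \<open>'a \<times> 'y\<close>, and an infinite \<open>'y\<close> that contains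
  a copy of \<open>'a\<close> absorbs products with \<open>'a\<close> and with countable sets. The power set in the type is therefore
  what makes room for all functions on \<open>'a\<close>.
\<close>

lemma tree_type_absorbs_functions:
  assumes inf: "infinite (UNIV :: 'y set)" and emb: "inj (k :: 'a \<Rightarrow> 'y)"
  shows "\<exists>F :: ('a \<Rightarrow> ('a + 'y set) tree) \<Rightarrow> ('a + 'y set) tree. inj F"
proof -
  let ?le = "\<lambda>A. ordLeq3 (card_of A) (card_of (UNIV :: 'y set))"
  have times: "?le (A \<times> B)" if "?le A" "?le B" for A :: "'c set" and B :: "'d set"
    using card_of_Sigma_ordLeq_infinite[OF inf that(1), of "\<lambda>_. B"] that(2) by blast
  have countable: "?le (UNIV :: 'c :: countable set)"
  proof -
    obtain f :: "nat \<Rightarrow> 'y" where "inj f" using inf infinite_countable_subset by blast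
    then have "inj (f \<circ> (to_nat :: 'c \<Rightarrow> nat))" by (rule inj_compose) (rule inj_to_nat)
    then show ?thesis using card_of_ordLeq by blast
  qed
  have 1: "?le (UNIV :: 'a set)" using emb card_of_ordLeq by blast
  have 2: "?le (UNIV :: 'y set)" by (rule card_of_mono1) simp
  have "?le ((UNIV :: 'a set) \<times> (UNIV :: nat list set) \<times> (UNIV :: nat set) \<times> (UNIV :: 'a set) \<times> (UNIV :: 'y set))"
    by (intro times 1 2 countable)
  then obtain c :: "'a \<times> nat list \<times> nat \<times> 'a \<times> 'y \<Rightarrow> 'y" where c: "inj c"
    using card_of_ordLeq[of "UNIV :: ('a \<times> nat list \<times> nat \<times> 'a \<times> 'y) set" "UNIV :: 'y set"] by auto
  define F :: "('a \<Rightarrow> ('a + 'y set) tree) \<Rightarrow> ('a + 'y set) tree"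
    where "F \<phi> = Leaf (Inr (c ` {(a, r). r \<in> tree_records (\<phi> a)}))" for \<phi>
  have "inj F"
  proof (rule injI, rule ext)
    fix \<phi> \<psi> a assume "F \<phi> = F \<psi>"
    then have eq: "{(a, r). r \<in> tree_records (\<phi> a)} = {(a, r). r \<in> tree_records (\<psi> a)}"
      by (simp add: F_def inj_image_eq_iff[OF c])
    then have "tree_records (\<phi> a) = tree_records (\<psi> a)" by blast
    then show "\<phi> a = \<psi> a" by (rule tree_records_inj)
  qed
  then show ?thesis by blast
qed

text \<open>Choosing a representative of each coset keeps the cokernel in the type, so that the step can be iterated.\<close>

lemma injective_step:
  fixes C :: "('a, 'x tree) module" and F :: "('a \<Rightarrow> 'x tree) \<Rightarrow> 'x tree"
  assumes C: "module R C" and F: "inj F"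
  shows "\<exists>(E :: ('a, 'x tree) module) e (C' :: ('a, 'x tree) module) p.
    baer R E \<and> e \<in> mod_hom R C E \<and> inj_on e (carrier C) \<and> module R C' \<and> p \<in> mod_hom R E C' \<and>
    p ` carrier E = carrier C' \<and> {x \<in> carrier E. p x = \<zero>\<^bsub>C'\<^esub>} = e ` carrier C"
proof -
  obtain E :: "('a, 'x tree) module" and e
    where E: "baer R E" and e: "e \<in> mod_hom R C E" and e_inj: "inj_on e (carrier C)"
    using enough_injectives[OF C F] by blast
  have modE: "module R E" using E by (simp add: baer_def)
  have K: "submodule (e ` carrier C) R E" by (rule image_submodule[OF C modE e])
  let ?q = "\<lambda>x. e ` carrier C +>\<^bsub>E\<^esub> x" and ?Q = "quotient_module E (e ` carrier C)"
  note Q = quotient_module[OF modE K]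
  define rep where "rep = inv_into (carrier E) ?q"
  have rep: "inj_on rep (carrier ?Q)"
    unfolding rep_def quotient_module_carrier by (rule inj_on_inv_into) simp
  note T = transport_module[OF Q(1) rep]
  interpret Q: module R ?Q by (rule Q(1))
  have ker: "rep (?q x) = \<zero>\<^bsub>transport_module rep ?Q\<^esub> \<longleftrightarrow> x \<in> e ` carrier C" if x: "x \<in> carrier E" for x
  proof -
    have "rep (?q x) = rep \<zero>\<^bsub>?Q\<^esub> \<longleftrightarrow> ?q x = \<zero>\<^bsub>?Q\<^esub>"
      using inj_on_eq_iff[OF rep mod_homD(1)[OF Q(2) x] Q.zero_closed] .
    then show ?thesis using Q(3)[OF x] by (simp add: T(4))
  qed
  have "e ` carrier C \<subseteq> carrier E" using mod_homD(1)[OF e] by blast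
  then have "{x \<in> carrier E. rep (?q x) = \<zero>\<^bsub>transport_module rep ?Q\<^esub>} = e ` carrier C"
    using ker by blast
  moreover have "(\<lambda>x. rep (?q x)) ` carrier E = carrier (transport_module rep ?Q)"
    unfolding T(3) quotient_module_carrier by (simp add: image_image)
  ultimately show ?thesis
    using E e e_inj T(1) mod_hom_comp[OF Q(2) T(2)] by blast
qed

text \<open>
  Iterating the step on the successive cokernels and composing each projection with the next
  embedding gives the resolution. The module itself is first copied into the type of trees.
\<close>

lemma injective_resolution_exists:
  fixes N :: "('a, 'c, 'm) module_scheme" and F :: "('a \<Rightarrow> ('a + 'c) tree) \<Rightarrow> ('a + 'c) tree"
  assumes N: "module R N" and F: "inj F"
  shows "\<exists>(E :: nat \<Rightarrow> ('a, ('a + 'c) tree) module) d e. injective_resolution R N E d e"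
proof -
  define P where "P C E e C' p \<longleftrightarrow>
    baer R E \<and> e \<in> mod_hom R C E \<and> inj_on e (carrier C) \<and> module R C' \<and> p \<in> mod_hom R E C' \<and>
    p ` carrier E = carrier C' \<and> {x \<in> carrier E. p x = \<zero>\<^bsub>C'\<^esub>} = e ` carrier C"
    for C E C' :: "('a, ('a + 'c) tree) module" and e p
  have "\<forall>C. \<exists>t. module R C \<longrightarrow> P C (fst t) (fst (snd t)) (fst (snd (snd t))) (snd (snd (snd t)))"
  proof
    fix C :: "('a, ('a + 'c) tree) module"
    show "\<exists>t. module R C \<longrightarrow> P C (fst t) (fst (snd t)) (fst (snd (snd t))) (snd (snd (snd t)))"
    proof (cases "module R C")
      case True
      then obtain E e C' p where "P C E e C' p"
        unfolding P_def using injective_step[OF True F] by blast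
      then show ?thesis by (intro exI[of _ "(E, e, C', p)"]) simp
    qed simp
  qed
  from choice[OF this] obtain T where T: "\<forall>C. module R C \<longrightarrow>
      P C (fst (T C)) (fst (snd (T C))) (fst (snd (snd (T C)))) (snd (snd (snd (T C))))" ..
  define Ef ef Cf pf where "Ef C = fst (T C)" and "ef C = fst (snd (T C))"
    and "Cf C = fst (snd (snd (T C)))" and "pf C = snd (snd (snd (T C)))" for C
  have step: "P C (Ef C) (ef C) (Cf C) (pf C)" if "module R C" for C
    using T that unfolding Ef_def ef_def Cf_def pf_def by blast
  define t :: "'c \<Rightarrow> ('a + 'c) tree" where "t x = Leaf (Inr x)" for x
  have t: "inj_on t (carrier N)" by (auto simp: t_def inj_on_def)
  note N' = transport_module[OF N t]
  define Cs where "Cs n = (Cf ^^ n) (transport_module t N)" for n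
  have Cs: "module R (Cs n)" for n
  proof (induction n)
    case 0
    then show ?case using N'(1) by (simp add: Cs_def)
  next
    case (Suc n)
    have "Cs (Suc n) = Cf (Cs n)" by (simp add: Cs_def)
    then show ?case using step[OF Suc] by (simp add: P_def)
  qed
  have Cs_Suc: "Cf (Cs n) = Cs (Suc n)" for n by (simp add: Cs_def)
  define E where "E n = Ef (Cs n)" for n
  define i where "i n = ef (Cs n)" for n
  define p where "p n = pf (Cs n)" for n
  have baer: "baer R (E n)" and i: "i n \<in> mod_hom R (Cs n) (E n)" and i_inj: "inj_on (i n) (carrier (Cs n))"
    and p: "p n \<in> mod_hom R (E n) (Cs (Suc n))" and p_surj: "p n ` carrier (E n) = carrier (Cs (Suc n))"
    and ker: "{x \<in> carrier (E n). p n x = \<zero>\<^bsub>Cs (Suc n)\<^esub>} = i n ` carrier (Cs n)" for n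
    using step[OF Cs[of n]] unfolding P_def E_def i_def p_def Cs_Suc by blast+
  have modE: "module R (E n)" for n using baer by (simp add: baer_def)
  define d where "d n x = i (Suc n) (p n x)" for n x
  have d: "d n \<in> mod_hom R (E n) (E (Suc n))" for n
    unfolding d_def by (rule mod_hom_comp[OF p i])
  have d_ker: "{x \<in> carrier (E n). d n x = \<zero>\<^bsub>E (Suc n)\<^esub>} = i n ` carrier (Cs n)" for n
  proof -
    have "d n x = \<zero>\<^bsub>E (Suc n)\<^esub> \<longleftrightarrow> p n x = \<zero>\<^bsub>Cs (Suc n)\<^esub>" if x: "x \<in> carrier (E n)" for x
    proof -
      interpret C: module R "Cs (Suc n)" by (rule Cs)
      show ?thesis
        using inj_on_eq_iff[OF i_inj mod_homD(1)[OF p x] C.zero_closed] mod_hom_zero[OF Cs modE i]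
        by (simp add: d_def)
    qed
    then show ?thesis using ker[of n] by blast
  qed
  have d_im: "d n ` carrier (E n) = i (Suc n) ` carrier (Cs (Suc n))" for n
    unfolding d_def p_surj[symmetric] by (simp add: image_image)
  have C0: "Cs 0 = transport_module t N" by (simp add: Cs_def)
  define e where "e x = i 0 (t x)" for x
  have e_im: "e ` carrier N = i 0 ` carrier (Cs 0)"
    unfolding e_def C0 N'(3) by (simp add: image_image)
  have "e \<in> mod_hom R N (E 0)"
    unfolding e_def using mod_hom_comp[OF N'(2)] i[of 0] C0 by simp
  moreover have "inj_on e (carrier N)"
    using comp_inj_on[OF t, of "i 0"] i_inj[of 0] unfolding C0 N'(3) by (simp add: e_def[abs_def] comp_def)
  ultimately have "injective_resolution R N E d e"
    unfolding injective_resolution_def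
    using baer_injective[OF baer] d d_ker[of 0] d_ker e_im d_im by simp
  then show ?thesis by blast
qed

section \<open>Local cohomology in degree one\<close>

text \<open>
  An ideal of \<open>R\<close> and \<open>R\<close> itself have copies among the test modules; the element is the value at \<open>1\<close> of an
  extension to \<open>R\<close>.
\<close>

lemma injective_baer:
  fixes R :: "('a, 'r) ring_scheme" and E :: "('a, 'e, 'm) module_scheme"
  assumes R: "cring R" and E: "injective_module R E"
  shows "baer R E"
  unfolding baer_def
proof (intro conjI allI impI)
  show "module R E" using E by (simp add: injective_module_def)
  fix J f assume "ideal J R \<and> f \<in> mod_hom R (ideal_module R J) E"
  then have J: "ideal J R" and f: "f \<in> mod_hom R (ideal_module R J) E" by auto
  define g :: "'a \<Rightarrow> ('a + 'e) tree" where "g a = Leaf (Inl a)" for a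
  have g: "inj g" by (auto simp: g_def inj_on_def)
  note modJ = ideal_module[OF R J] and modR = self_module[OF R]
  have gJ: "inj_on g (carrier (ideal_module R J))" and gR: "inj_on g (carrier (self_module R))"
    using g inj_on_subset by blast+
  let ?J = "transport_module g (ideal_module R J)" and ?R = "transport_module g (self_module R)"
  let ?k = "inv_into (carrier (ideal_module R J)) g"
  note TJ = transport_module[OF modJ gJ] and TR = transport_module[OF modR gR]
  have k: "?k \<in> mod_hom R ?J (ideal_module R J)" by (rule transport_module_inverse[OF modJ gJ])
  have "(\<lambda>a. a) \<in> mod_hom R (ideal_module R J) (self_module R)"
    using ideal.Icarr[OF J] by (intro mod_homI) (auto simp: ideal_module_simps self_module_simps)
  from mod_hom_comp[OF mod_hom_comp[OF k this] TR(2)]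
  have incl: "(\<lambda>x. g (?k x)) \<in> mod_hom R ?J ?R" .
  have gk: "g (?k x) = x" if "x \<in> carrier ?J" for x
    using that by (simp add: TJ(3) f_inv_into_f)
  have inj: "inj_on (\<lambda>x. g (?k x)) (carrier ?J)" by (rule inj_onI) (simp only: gk)
  have extend: "\<exists>h\<in>mod_hom R N' E. \<forall>x\<in>carrier N. h (i x) = f' x"
    if "module R N" "module R N'" "i \<in> mod_hom R N N'" "inj_on i (carrier N)" "f' \<in> mod_hom R N E"
    for N N' :: "('a, ('a + 'e) tree) module" and i f'
    using E that unfolding injective_module_def by simp
  obtain h where h: "h \<in> mod_hom R ?R E" "\<And>x. x \<in> carrier ?J \<Longrightarrow> h (g (?k x)) = f (?k x)"
    using extend[OF TJ(1) TR(1) incl inj mod_hom_comp[OF k f]] by blast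
  interpret R: cring R by fact
  have one: "\<one>\<^bsub>R\<^esub> \<in> carrier (self_module R)" by (simp add: self_module_simps)
  then have g1: "g \<one>\<^bsub>R\<^esub> \<in> carrier ?R" by (simp add: TR(3))
  have "f a = a \<odot>\<^bsub>E\<^esub> h (g \<one>\<^bsub>R\<^esub>)" if a: "a \<in> J" for a
  proof -
    have aR: "a \<in> carrier R" using ideal.Icarr[OF J a] .
    have ga: "g a \<in> carrier ?J" using a by (simp add: TJ(3) ideal_module_simps)
    have ka: "?k (g a) = a" using a gJ by (simp add: ideal_module_simps)
    have "f a = h (g a)" using h(2)[OF ga] ka by simp
    also have "g a = a \<odot>\<^bsub>?R\<^esub> g \<one>\<^bsub>R\<^esub>"
      using mod_homD(3)[OF TR(2) aR one] aR by (simp add: self_module_simps)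
    also have "h \<dots> = a \<odot>\<^bsub>E\<^esub> h (g \<one>\<^bsub>R\<^esub>)" by (rule mod_homD(3)[OF h(1) aR g1])
    finally show ?thesis .
  qed
  then show "\<exists>e\<in>carrier E. \<forall>a\<in>J. f a = a \<odot>\<^bsub>E\<^esub> e" using mod_homD(1)[OF h(1) g1] by blast
qed

text \<open>
  Local cohomology is computed from a resolution picked by a choice operator. Once some resolution
  exists, the picked one is a resolution too, and nothing else is known about it.
\<close>

lemma local_cohomology_resolution:
  fixes N :: "('a, 'b, 'm) module_scheme"
  assumes "\<exists>(E :: nat \<Rightarrow> ('a, ('a + 'b) tree) module) d e. injective_resolution R N E d e"
  obtains E :: "nat \<Rightarrow> ('a, ('a + 'b) tree) module" and d e
  where "injective_resolution R N E d e"
    and "local_cohomology R J i N = cohomology (\<lambda>n. torsion_submodule R J (E n)) d i"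
proof -
  define t where "t = (SOME (E :: nat \<Rightarrow> ('a, ('a + 'b) tree) module, d, e). injective_resolution R N E d e)"
  obtain E d e where t: "t = (E, d, e)" by (cases t)
  have "case t of (E, d, e) \<Rightarrow> injective_resolution R N E d e"
    unfolding t_def by (rule someI_ex) (use assms in auto)
  moreover have "local_cohomology R J i N = cohomology (\<lambda>n. torsion_submodule R J (E n)) d i"
    unfolding local_cohomology_def t_def[symmetric] by (simp add: t)
  ultimately show ?thesis using that t by simp
qed

lemma cohomology_1_zeroD:
  assumes "zero_module (cohomology C d 1)"
    and zero: "\<zero>\<^bsub>C 1\<^esub> \<in> d 0 ` carrier (C 0)"
    and x: "x \<in> carrier (C 1)" "d 1 x = \<zero>\<^bsub>C 2\<^esub>" "\<zero>\<^bsub>C 1\<^esub> \<oplus>\<^bsub>C 1\<^esub> x = x"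
  shows "x \<in> d 0 ` carrier (C 0)"
proof -
  let ?B = "d 0 ` carrier (C 0)"
  let ?Z = "(C 1)\<lparr>carrier := {x \<in> carrier (C 1). d 1 x = \<zero>\<^bsub>C 2\<^esub>}\<rparr>"
  have "?B +>\<^bsub>?Z\<^esub> x \<in> carrier (quotient_module ?Z ?B)"
    unfolding quotient_module_carrier using x by auto
  also have "\<dots> = {?B}"
    using assms(1) by (simp add: zero_module_def cohomology_def quotient_module_def numeral_2_eq_2)
  finally have "?B +>\<^bsub>?Z\<^esub> x = ?B" by simp
  moreover have "x \<in> ?B +>\<^bsub>?Z\<^esub> x"
  proof -
    have "x \<in> {\<zero>\<^bsub>C 1\<^esub> \<oplus>\<^bsub>?Z\<^esub> x}" using x(3) by simp
    then show ?thesis unfolding a_r_coset_def' using zero by blast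
  qed
  ultimately show ?thesis by simp
qed

lemma (in cring) ideal_power_ideal:
  assumes "ideal J R"
  shows "ideal (J [^]\<^bsub>ideals_set R\<^esub> (n::nat)) R"
proof -
  interpret S: comm_monoid "ideals_set R" by (rule ideals_set_is_comm_monoid)
  show ?thesis using S.nat_pow_closed[of J n] assms by (simp add: ideals_set_def)
qed

lemma (in cring) ideal_power_mult:
  assumes "ideal J R"
  shows "J [^]\<^bsub>ideals_set R\<^esub> (m + n :: nat) = (J [^]\<^bsub>ideals_set R\<^esub> m) \<cdot> (J [^]\<^bsub>ideals_set R\<^esub> n)"
proof -
  interpret S: comm_monoid "ideals_set R" by (rule ideals_set_is_comm_monoid)
  show ?thesis using S.nat_pow_mult[of J m n] assms by (simp add: ideals_set_def)
qed

lemma (in cring) ideal_power_antimono: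
  assumes "ideal J R" "m \<le> (n::nat)"
  shows "J [^]\<^bsub>ideals_set R\<^esub> n \<subseteq> J [^]\<^bsub>ideals_set R\<^esub> m"
  using ideal_power_mult[OF assms(1), of m "n - m"] assms
    ideal_prod_inter[OF ideal_power_ideal ideal_power_ideal, OF assms(1) assms(1), of m "n - m"] by simp

text \<open>
  A homomorphism from an ideal \<open>I\<close> with \<open>J\<^sup>n \<subseteq> I\<close> to \<open>N\<close> determines a section of \<open>N\<close> away from the closed set \<open>V(J)\<close>, and
  \<open>H\<^sup>1\<^sub>J(N)\<close> is the obstruction to extending such sections. In terms of a resolution: the homomorphism
  is multiplication by some \<open>z\<close> in the first injective module, the image of \<open>z\<close> under the differential
  is a torsion cocycle, and if it bounds a torsion element, that element corrects \<open>z\<close> to lie in \<open>N\<close>.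
\<close>

lemma local_cohomology_1_zero_extends:
  fixes N :: "('a, 'b, 'm) module_scheme" and F :: "('a \<Rightarrow> ('a + 'b) tree) \<Rightarrow> ('a + 'b) tree"
  assumes N: "module R N" and F: "inj F"
    and J: "ideal J R" and I: "ideal I R" and JI: "J [^]\<^bsub>ideals_set R\<^esub> (n::nat) \<subseteq> I"
    and f: "f \<in> mod_hom R (ideal_module R I) N"
    and zero: "zero_module (local_cohomology R J 1 N)"
  obtains w k where "w \<in> carrier N" "\<And>a. a \<in> J [^]\<^bsub>ideals_set R\<^esub> (k::nat) \<Longrightarrow> a \<in> I \<and> f a = a \<odot>\<^bsub>N\<^esub> w"
proof -
  interpret N: module R N by fact
  let ?pow = "\<lambda>n::nat. J [^]\<^bsub>ideals_set R\<^esub> n"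
  obtain E :: "nat \<Rightarrow> ('a, ('a + 'b) tree) module" and d e
    where res: "injective_resolution R N E d e"
      and loc: "local_cohomology R J 1 N = cohomology (\<lambda>n. torsion_submodule R J (E n)) d 1"
    using local_cohomology_resolution[OF injective_resolution_exists[OF N F]] by blast
  have inj: "injective_module R (E m)" and d: "d m \<in> mod_hom R (E m) (E (Suc m))" for m
    using res by (auto simp: injective_resolution_def)
  have e: "e \<in> mod_hom R N (E 0)" and e_inj: "inj_on e (carrier N)"
    and ker0: "{x \<in> carrier (E 0). d 0 x = \<zero>\<^bsub>E 1\<^esub>} = e ` carrier N"
    and ker1: "{x \<in> carrier (E 1). d 1 x = \<zero>\<^bsub>E 2\<^esub>} = d 0 ` carrier (E 0)"
    using res unfolding injective_resolution_def One_nat_def numeral_2_eq_2 by blast+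
  have modE: "module R (E m)" for m using inj by (simp add: injective_module_def)
  interpret E0: module R "E 0" by (rule modE)
  interpret E1: module R "E 1" by (rule modE)
  have d0: "d 0 \<in> mod_hom R (E 0) (E 1)" using d[of 0] by simp
  obtain z where z: "z \<in> carrier (E 0)" and fz: "\<And>a. a \<in> I \<Longrightarrow> e (f a) = a \<odot>\<^bsub>E 0\<^esub> z"
    using injective_baer[OF N.R.is_cring inj[of 0]] I mod_hom_comp[OF f e] unfolding baer_def by blast
  have fI: "f a \<in> carrier N" if "a \<in> I" for a
    using mod_homD(1)[OF f] that by (simp add: ideal_module_simps)
  have kills: "a \<odot>\<^bsub>E 1\<^esub> d 0 z = \<zero>\<^bsub>E 1\<^esub>" if a: "a \<in> I" for a
  proof -
    have "e (f a) \<in> {x \<in> carrier (E 0). d 0 x = \<zero>\<^bsub>E 1\<^esub>}" unfolding ker0 using fI[OF a] by blast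
    then show ?thesis
      using mod_homD(3)[OF d0 ideal.Icarr[OF I a] z] by (simp add: fz[OF a])
  qed
  let ?C = "\<lambda>n. torsion_submodule R J (E n)"
  have C: "carrier (?C m) = {x \<in> carrier (E m). \<exists>n. \<forall>a\<in>?pow n. a \<odot>\<^bsub>E m\<^esub> x = \<zero>\<^bsub>E m\<^esub>}"
    and C0: "\<zero>\<^bsub>?C m\<^esub> = \<zero>\<^bsub>E m\<^esub>" and C1: "x \<oplus>\<^bsub>?C m\<^esub> y = x \<oplus>\<^bsub>E m\<^esub> y" for m x y
    by (auto simp: torsion_submodule_def)
  have pow_car: "?pow m \<subseteq> carrier R" for m
    using ideal.Icarr[OF N.R.ideal_power_ideal[OF J]] by blast
  have "d 0 z \<in> d 0 ` carrier (?C 0)"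
  proof (rule cohomology_1_zeroD[of ?C])
    show "zero_module (cohomology ?C d 1)" using zero loc by simp
    have "a \<odot>\<^bsub>E 0\<^esub> \<zero>\<^bsub>E 0\<^esub> = \<zero>\<^bsub>E 0\<^esub>" if "a \<in> ?pow 0" for a
      using that pow_car[of 0] by (intro E0.smult_r_null) blast
    then have "\<zero>\<^bsub>E 0\<^esub> \<in> carrier (?C 0)" unfolding C using E0.zero_closed by blast
    then show "\<zero>\<^bsub>?C 1\<^esub> \<in> d 0 ` carrier (?C 0)"
      using mod_hom_zero[OF modE modE d0] by (metis C0 image_eqI)
    show "d 0 z \<in> carrier (?C 1)"
      unfolding C using mod_homD(1)[OF d0 z] kills JI by blast
    show "d 1 (d 0 z) = \<zero>\<^bsub>?C 2\<^esub>" using ker1 z unfolding C0 by blast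
    show "\<zero>\<^bsub>?C 1\<^esub> \<oplus>\<^bsub>?C 1\<^esub> d 0 z = d 0 z"
      unfolding C0 C1 by (rule E1.l_zero[OF mod_homD(1)[OF d0 z]])
  qed
  then obtain t m where t: "t \<in> carrier (E 0)" "d 0 z = d 0 t"
    and tm: "\<And>a. a \<in> ?pow m \<Longrightarrow> a \<odot>\<^bsub>E 0\<^esub> t = \<zero>\<^bsub>E 0\<^esub>"
    unfolding C by blast
  have "z \<ominus>\<^bsub>E 0\<^esub> t \<in> {x \<in> carrier (E 0). d 0 x = \<zero>\<^bsub>E 1\<^esub>}"
    using z t mod_homD(1)[OF d0] by (simp add: mod_hom_minus[OF modE modE d0] E1.minus_eq_zero_iff del: One_nat_def)
  then obtain w where w: "w \<in> carrier N" "e w = z \<ominus>\<^bsub>E 0\<^esub> t" unfolding ker0 by auto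
  have "a \<in> I \<and> f a = a \<odot>\<^bsub>N\<^esub> w" if a: "a \<in> ?pow (max n m)" for a
  proof -
    have aI: "a \<in> I" and am: "a \<in> ?pow m" using N.R.ideal_power_antimono[OF J] a JI
      by (meson max.cobounded1 max.cobounded2 subsetD)+
    have aR: "a \<in> carrier R" using ideal.Icarr[OF I aI] .
    have "e (a \<odot>\<^bsub>N\<^esub> w) = a \<odot>\<^bsub>E 0\<^esub> (z \<ominus>\<^bsub>E 0\<^esub> t)" using mod_homD(3)[OF e aR w(1)] w(2) by simp
    also have "\<dots> = a \<odot>\<^bsub>E 0\<^esub> z"
      using aR z t(1) tm[OF am] E0.smult_r_minus[OF aR t(1)]
      by (simp add: a_minus_def E0.smult_r_distr E0.add.inv_one)
    finally have "e (a \<odot>\<^bsub>N\<^esub> w) = e (f a)" using fz[OF aI] by simp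
    then have "f a = a \<odot>\<^bsub>N\<^esub> w"
      using inj_onD[OF e_inj, of "f a" "a \<odot>\<^bsub>N\<^esub> w"] fI[OF aI] aR w(1) by simp
    then show ?thesis using aI by simp
  qed
  then show ?thesis using that w(1) by blast
qed

section \<open>Nakayama, powers of the maximal ideal and depth\<close>

lemma (in noetherian_ring) exists_maximal_ideal_with:
  assumes "ideal I R" "P I"
  obtains K where "ideal K R" "I \<subseteq> K" "P K" "\<And>L. ideal L R \<Longrightarrow> K \<subseteq> L \<Longrightarrow> P L \<Longrightarrow> L = K"
proof -
  let ?S = "{K. ideal K R \<and> I \<subseteq> K \<and> P K}"
  have "\<exists>K\<in>?S. \<forall>L\<in>?S. K \<subseteq> L \<longrightarrow> L = K"
  proof (rule subset_Zorn_nonempty)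
    show "?S \<noteq> {}" using assms by blast
    fix C assume C: "C \<noteq> {}" "subset.chain ?S C"
    then have "subset.chain {I. ideal I R} C" unfolding subset.chain_def by blast
    then have "\<Union>C \<in> C" by (rule ideal_chain_is_trivial[OF C(1)])
    then show "\<Union>C \<in> ?S" using C(2) unfolding subset.chain_def by blast
  qed
  then obtain K where K: "K \<in> ?S" "\<forall>L\<in>?S. K \<subseteq> L \<longrightarrow> L = K" by (elim bexE)
  show ?thesis
  proof (rule that[of K])
    show "ideal K R" "I \<subseteq> K" "P K" using K(1) by auto
    show "L = K" if "ideal L R" "K \<subseteq> L" "P L" for L using K that by auto
  qed
qed

text \<open>
  Let \<open>K\<close> be maximal among the ideals over \<open>I\<close> that contain no power of \<open>J\<close>. Some \<open>x \<in> J\<close> is not in \<open>K\<close>; let \<open>u\<close>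
  be the last power of \<open>x\<close> outside \<open>K\<close>. Then \<open>K + (u)\<close> and \<open>(K : u)\<close> are both larger than \<open>K\<close>, so each contains
  a power of \<open>J\<close>, and the product of these two powers lies in \<open>K\<close>.
\<close>

lemma noetherian_power_subset:
  assumes cR: "cring R" and nR: "noetherian_ring R" and I: "ideal I R" and J: "ideal J R"
    and rad: "J \<subseteq> radical R I"
  shows "\<exists>n::nat. J [^]\<^bsub>ideals_set R\<^esub> n \<subseteq> I"
proof (rule ccontr)
  let ?P = "\<lambda>K. \<nexists>n::nat. J [^]\<^bsub>ideals_set R\<^esub> n \<subseteq> K"
  interpret noetherian_ring R by fact
  interpret cring R by fact
  assume "?P I"
  then obtain K where K: "ideal K R" "I \<subseteq> K" "?P K"
    and max: "\<And>L. ideal L R \<Longrightarrow> K \<subseteq> L \<Longrightarrow> ?P L \<Longrightarrow> L = K"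
    using exists_maximal_ideal_with[OF I, of ?P] by blast
  interpret K: ideal K R by (rule K(1))
  interpret S: comm_monoid "ideals_set R" by (rule ideals_set_is_comm_monoid)
  have "J [^]\<^bsub>ideals_set R\<^esub> (1::nat) = J" using S.nat_pow_eone[of J] J by (simp add: ideals_set_def)
  then obtain x where x: "x \<in> J" "x \<notin> K" using K(3) by (metis subsetI)
  then have xR: "x \<in> carrier R" using ideal.Icarr[OF J] by blast
  have "\<exists>k::nat. x [^]\<^bsub>R\<^esub> k \<in> K" using rad x(1) K(2) by (auto simp: radical_def)
  moreover define k where "k = (LEAST k::nat. x [^]\<^bsub>R\<^esub> k \<in> K)"
  ultimately have k: "x [^]\<^bsub>R\<^esub> k \<in> K" "\<And>j. j < k \<Longrightarrow> x [^]\<^bsub>R\<^esub> j \<notin> K"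
    by (metis LeastI_ex, metis not_less_Least)
  have "k \<noteq> 0"
  proof
    assume "k = 0"
    then have "\<one>\<^bsub>R\<^esub> \<in> K" using k(1) by simp
    then show False using x(2) xR K.one_imp_carrier by blast
  qed
  then obtain j where j: "k = Suc j" using not0_implies_Suc by blast
  define u where "u = x [^]\<^bsub>R\<^esub> j"
  have u: "u \<in> carrier R" "u \<notin> K" "x \<otimes>\<^bsub>R\<^esub> u \<in> K"
    using k j xR m_comm[of x "x [^]\<^bsub>R\<^esub> j"] by (auto simp: u_def)
  define L1 where "L1 = {y \<oplus>\<^bsub>R\<^esub> r \<otimes>\<^bsub>R\<^esub> u | y r. y \<in> K \<and> r \<in> carrier R}"
  define L2 where "L2 = {a \<in> carrier R. a \<otimes>\<^bsub>R\<^esub> u \<in> K}"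
  have L1_eq: "L1 = K <+>\<^bsub>R\<^esub> PIdl\<^bsub>R\<^esub> u"
    unfolding L1_def cgenideal_def set_add_def' by blast
  have L1: "ideal L1 R" unfolding L1_eq by (intro add_ideals K(1) cgenideal_ideal u(1))
  have L2: "ideal L2 R"
  proof (rule idealI)
    show "subgroup L2 (add_monoid R)"
      using u(1) by (intro subgroup.intro) (auto simp: L2_def l_distr a_inv_def[symmetric] l_minus)
    fix a b assume ab: "a \<in> L2" "b \<in> carrier R"
    then show "b \<otimes>\<^bsub>R\<^esub> a \<in> L2" using u(1) K.I_l_closed by (auto simp: L2_def m_assoc)
    then show "a \<otimes>\<^bsub>R\<^esub> b \<in> L2" using ab by (simp add: L2_def m_comm)
  qed (rule ring_axioms)
  have "K \<subseteq> L1"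
    unfolding L1_def using u(1) K.Icarr by (force intro: exI[of _ "\<zero>\<^bsub>R\<^esub>"])
  moreover have "u \<in> L1"
  proof -
    have "u = \<zero>\<^bsub>R\<^esub> \<oplus>\<^bsub>R\<^esub> \<one>\<^bsub>R\<^esub> \<otimes>\<^bsub>R\<^esub> u" using u(1) by simp
    then show ?thesis unfolding L1_def using K.zero_closed one_closed by blast
  qed
  ultimately obtain n1 where n1: "J [^]\<^bsub>ideals_set R\<^esub> (n1::nat) \<subseteq> L1" using max[OF L1] u(2) by blast
  have "K \<subseteq> L2" unfolding L2_def using u(1) K.Icarr K.I_r_closed by blast
  moreover have "x \<in> L2" unfolding L2_def using xR u(3) by blast
  ultimately obtain n2 where n2: "J [^]\<^bsub>ideals_set R\<^esub> (n2::nat) \<subseteq> L2" using max[OF L2] x(2) by blast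
  have "J [^]\<^bsub>ideals_set R\<^esub> (n2 + n1) \<subseteq> K"
  proof
    fix s assume "s \<in> J [^]\<^bsub>ideals_set R\<^esub> (n2 + n1)"
    then have "s \<in> (J [^]\<^bsub>ideals_set R\<^esub> n2) \<cdot>\<^bsub>R\<^esub> (J [^]\<^bsub>ideals_set R\<^esub> n1)"
      by (simp add: ideal_power_mult[OF J])
    then show "s \<in> K"
    proof (induction s rule: ideal_prod.induct)
      case (prod a b)
      obtain y r where b: "b = y \<oplus>\<^bsub>R\<^esub> r \<otimes>\<^bsub>R\<^esub> u" "y \<in> K" "r \<in> carrier R"
        using prod(2) n1 unfolding L1_def by blast
      have a: "a \<in> carrier R" "a \<otimes>\<^bsub>R\<^esub> u \<in> K" using prod(1) n2 unfolding L2_def by auto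
      have "a \<otimes>\<^bsub>R\<^esub> b = a \<otimes>\<^bsub>R\<^esub> y \<oplus>\<^bsub>R\<^esub> r \<otimes>\<^bsub>R\<^esub> (a \<otimes>\<^bsub>R\<^esub> u)"
        using a(1) b u(1) K.Icarr by (simp add: r_distr m_lcomm)
      then show ?case using a b K.I_l_closed by simp
    next
      case (sum s1 s2)
      then show ?case by simp
    qed
  qed
  then show False using K(3) by blast
qed

lemma local_ring_one_minus_unit:
  assumes local: "noetherian_local_ring R \<mm>" and a: "a \<in> \<mm>"
  shows "\<exists>u\<in>carrier R. u \<otimes>\<^bsub>R\<^esub> (\<one>\<^bsub>R\<^esub> \<ominus>\<^bsub>R\<^esub> a) = \<one>\<^bsub>R\<^esub>"
proof (rule ccontr)
  have cR: "cring R" and nR: "noetherian_ring R" and \<mm>: "maximalideal \<mm> R"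
    and uniq: "\<And>J. maximalideal J R \<Longrightarrow> J = \<mm>"
    using local by (auto simp: noetherian_local_ring_def)
  interpret noetherian_ring R by fact
  interpret cring R by fact
  interpret \<mm>: maximalideal \<mm> R by fact
  assume no: "\<not> ?thesis"
  let ?b = "\<one>\<^bsub>R\<^esub> \<ominus>\<^bsub>R\<^esub> a"
  have aR: "a \<in> carrier R" using \<mm>.Icarr[OF a] .
  have b: "?b \<in> carrier R" using aR by simp
  have "\<one>\<^bsub>R\<^esub> \<notin> PIdl\<^bsub>R\<^esub> ?b" using no by (force simp: cgenideal_def)
  then have "PIdl\<^bsub>R\<^esub> ?b \<noteq> carrier R" using one_closed by blast
  then obtain K where K: "ideal K R" "PIdl\<^bsub>R\<^esub> ?b \<subseteq> K" "K \<noteq> carrier R"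
    and max: "\<And>L. ideal L R \<Longrightarrow> K \<subseteq> L \<Longrightarrow> L \<noteq> carrier R \<Longrightarrow> L = K"
    using exists_maximal_ideal_with[OF cgenideal_ideal[OF b], of "\<lambda>K. K \<noteq> carrier R"] by metis
  have "maximalideal K R" using K(1,3) max by (intro maximalidealI) auto
  then have "?b \<in> \<mm>" using uniq K(2) cgenideal_self[OF b] by blast
  then have "?b \<oplus>\<^bsub>R\<^esub> a \<in> \<mm>" using a by simp
  moreover have "?b \<oplus>\<^bsub>R\<^esub> a = \<one>\<^bsub>R\<^esub>" using aR by (simp add: a_minus_def a_assoc l_neg)
  ultimately have "\<mm> = carrier R" using \<mm>.one_imp_carrier by simp
  then show False using \<mm>.I_notcarr by simp
qed

lemma zero_submodule:
  assumes "module R M"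
  shows "submodule {\<zero>\<^bsub>M\<^esub>} R M"
proof -
  interpret M: module R M by fact
  show ?thesis by (intro M.submoduleI) (auto simp: M.add.inv_one)
qed

text \<open>
  In a smallest generating set, a generator \<open>x\<close> can be written as \<open>a x + y\<close> with \<open>a \<in> I\<close> and \<open>y\<close> in the span of the
  other generators. Since \<open>1 - a\<close> is a unit, \<open>x\<close> lies in that span, which contradicts minimality.
\<close>

lemma nakayama:
  assumes local: "noetherian_local_ring R \<mm>" and M: "fin_gen_module R M"
    and I: "ideal I R" "I \<subseteq> \<mm>" and eq: "ideal_smult R I M = carrier M"
  shows "zero_module M"
proof -
  have modM: "module R M" using M by (simp add: fin_gen_module_def)
  interpret M: module R M by fact
  interpret I: ideal I R by fact
  let ?G = "\<lambda>n. \<exists>A. finite A \<and> card A = n \<and> A \<subseteq> carrier M \<and> submodule_gen R M A = carrier M"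
  define n where "n = (LEAST n. ?G n)"
  have "\<exists>n. ?G n" using M by (auto simp: fin_gen_module_def)
  then have "?G n" unfolding n_def by (rule LeastI_ex)
  moreover have least: "\<not> ?G m" if "m < n" for m
    using that unfolding n_def by (rule not_less_Least)
  ultimately obtain A where A: "finite A" "card A = n" "A \<subseteq> carrier M" "submodule_gen R M A = carrier M"
    by blast
  show ?thesis
  proof (cases "A = {}")
    case True
    have "carrier M \<subseteq> {\<zero>\<^bsub>M\<^esub>}"
      using submodule_gen(3)[OF modM A(3) zero_submodule[OF modM]] True A(4) by simp
    then show ?thesis by (auto simp: zero_module_def)
  next
    case False
    then obtain x where x: "x \<in> A" by blast
    define B where "B = A - {x}"
    have B: "finite B" "B \<subseteq> carrier M" and xM: "x \<in> carrier M" and AB: "A = insert x B"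
      using A x by (auto simp: B_def)
    have Bn: "card B < n" using card_Diff1_less[OF A(1) x] A(2) by (simp only: B_def)
    let ?N = "submodule_gen R M B"
    note N = submodule_gen[OF modM B(2)]
    have NM: "?N \<subseteq> carrier M" using M.submoduleE(1)[OF N(1)] .
    have N0: "\<zero>\<^bsub>M\<^esub> \<in> ?N"
      using submodule_gen(3)[OF modM B(2) N(1) N(2)]
        additive_subgroup.zero_closed[OF abelian_subgroup.axioms(1)[OF submodule_abelian_subgroup[OF modM N(1)]]]
      by blast
    have sub: "submodule {r \<odot>\<^bsub>M\<^esub> x \<oplus>\<^bsub>M\<^esub> y | r y. r \<in> S \<and> y \<in> ?N} R M"
      if S: "ideal S R" for S
    proof -
      interpret S: ideal S R by fact
      show ?thesis
      proof (rule M.submoduleI)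
        show "{r \<odot>\<^bsub>M\<^esub> x \<oplus>\<^bsub>M\<^esub> y | r y. r \<in> S \<and> y \<in> ?N} \<subseteq> carrier M"
          using S.Icarr NM xM by auto
        have "\<zero>\<^bsub>M\<^esub> = \<zero>\<^bsub>R\<^esub> \<odot>\<^bsub>M\<^esub> x \<oplus>\<^bsub>M\<^esub> \<zero>\<^bsub>M\<^esub>" using xM by simp
        then show "\<zero>\<^bsub>M\<^esub> \<in> {r \<odot>\<^bsub>M\<^esub> x \<oplus>\<^bsub>M\<^esub> y | r y. r \<in> S \<and> y \<in> ?N}"
          using S.zero_closed N0 by blast
      next
        fix a assume "a \<in> {r \<odot>\<^bsub>M\<^esub> x \<oplus>\<^bsub>M\<^esub> y | r y. r \<in> S \<and> y \<in> ?N}"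
        then obtain r y where a: "a = r \<odot>\<^bsub>M\<^esub> x \<oplus>\<^bsub>M\<^esub> y" "r \<in> S" "y \<in> ?N" by blast
        have "\<ominus>\<^bsub>M\<^esub> a = (\<ominus>\<^bsub>R\<^esub> r) \<odot>\<^bsub>M\<^esub> x \<oplus>\<^bsub>M\<^esub> \<ominus>\<^bsub>M\<^esub> y"
          using a S.Icarr NM xM by (auto simp: M.minus_add M.smult_l_minus)
        then show "\<ominus>\<^bsub>M\<^esub> a \<in> {r \<odot>\<^bsub>M\<^esub> x \<oplus>\<^bsub>M\<^esub> y | r y. r \<in> S \<and> y \<in> ?N}"
          using a S.a_inv_closed M.submoduleE(3)[OF N(1)] by blast
        fix b assume "b \<in> {r \<odot>\<^bsub>M\<^esub> x \<oplus>\<^bsub>M\<^esub> y | r y. r \<in> S \<and> y \<in> ?N}"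
        then obtain s z where b: "b = s \<odot>\<^bsub>M\<^esub> x \<oplus>\<^bsub>M\<^esub> z" "s \<in> S" "z \<in> ?N" by blast
        have car: "r \<in> carrier R" "s \<in> carrier R" "y \<in> carrier M" "z \<in> carrier M"
          using a b S.Icarr NM by auto
        have "a \<oplus>\<^bsub>M\<^esub> b = (r \<oplus>\<^bsub>R\<^esub> s) \<odot>\<^bsub>M\<^esub> x \<oplus>\<^bsub>M\<^esub> (y \<oplus>\<^bsub>M\<^esub> z)"
          unfolding a(1) b(1) using car xM by (simp add: M.smult_l_distr M.add.m_ac)
        moreover have "r \<oplus>\<^bsub>R\<^esub> s \<in> S" by (rule S.a_closed[OF a(2) b(2)])
        moreover have "y \<oplus>\<^bsub>M\<^esub> z \<in> ?N" by (rule M.submoduleE(5)[OF N(1) a(3) b(3)])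
        ultimately show "a \<oplus>\<^bsub>M\<^esub> b \<in> {r \<odot>\<^bsub>M\<^esub> x \<oplus>\<^bsub>M\<^esub> y | r y. r \<in> S \<and> y \<in> ?N}" by blast
      next
        fix c a assume c: "c \<in> carrier R" and "a \<in> {r \<odot>\<^bsub>M\<^esub> x \<oplus>\<^bsub>M\<^esub> y | r y. r \<in> S \<and> y \<in> ?N}"
        then obtain r y where a: "a = r \<odot>\<^bsub>M\<^esub> x \<oplus>\<^bsub>M\<^esub> y" "r \<in> S" "y \<in> ?N" by blast
        have "c \<odot>\<^bsub>M\<^esub> a = (c \<otimes>\<^bsub>R\<^esub> r) \<odot>\<^bsub>M\<^esub> x \<oplus>\<^bsub>M\<^esub> c \<odot>\<^bsub>M\<^esub> y"
          using a c S.Icarr NM xM by (auto simp: M.smult_r_distr M.smult_assoc1)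
        moreover have "c \<otimes>\<^bsub>R\<^esub> r \<in> S" by (rule S.I_l_closed[OF a(2) c])
        moreover have "c \<odot>\<^bsub>M\<^esub> y \<in> ?N" by (rule M.submoduleE(4)[OF N(1) c a(3)])
        ultimately show "c \<odot>\<^bsub>M\<^esub> a \<in> {r \<odot>\<^bsub>M\<^esub> x \<oplus>\<^bsub>M\<^esub> y | r y. r \<in> S \<and> y \<in> ?N}" by blast
      qed
    qed
    let ?T = "\<lambda>S. {r \<odot>\<^bsub>M\<^esub> x \<oplus>\<^bsub>M\<^esub> y | r y. r \<in> S \<and> y \<in> ?N}"
    have TI: "r \<odot>\<^bsub>M\<^esub> x \<oplus>\<^bsub>M\<^esub> y \<in> ?T S" if "r \<in> S" "y \<in> ?N" for r y S using that by blast
    have "A \<subseteq> ?T (carrier R)"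
    proof -
      have "x \<in> ?T (carrier R)" using TI[OF M.R.one_closed N0] xM by simp
      moreover have "b \<in> ?T (carrier R)" if "b \<in> B" for b
      proof -
        have "b \<in> ?N" "b \<in> carrier M" using that N(2) B(2) by auto
        then show ?thesis using TI[OF M.R.zero_closed, of b] xM by simp
      qed
      ultimately show ?thesis using AB by blast
    qed
    then have all: "carrier M \<subseteq> ?T (carrier R)"
      using submodule_gen(3)[OF modM A(3) sub[OF M.R.oneideal]] A(4) by simp
    have "{a \<odot>\<^bsub>M\<^esub> z | a z. a \<in> I \<and> z \<in> carrier M} \<subseteq> ?T I"
    proof safe
      fix a z assume a: "a \<in> I" and z: "z \<in> carrier M"
      obtain r y where z': "z = r \<odot>\<^bsub>M\<^esub> x \<oplus>\<^bsub>M\<^esub> y" "r \<in> carrier R" "y \<in> ?N" using all z by blast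
      have "a \<odot>\<^bsub>M\<^esub> z = (a \<otimes>\<^bsub>R\<^esub> r) \<odot>\<^bsub>M\<^esub> x \<oplus>\<^bsub>M\<^esub> a \<odot>\<^bsub>M\<^esub> y"
        using z' I.Icarr[OF a] NM xM by (auto simp: M.smult_r_distr M.smult_assoc1)
      then show "\<exists>r y. a \<odot>\<^bsub>M\<^esub> z = r \<odot>\<^bsub>M\<^esub> x \<oplus>\<^bsub>M\<^esub> y \<and> r \<in> I \<and> y \<in> ?N"
        using I.I_r_closed[OF a z'(2)] M.submoduleE(4)[OF N(1) I.Icarr[OF a] z'(3)] by blast
    qed
    moreover have "{a \<odot>\<^bsub>M\<^esub> z | a z. a \<in> I \<and> z \<in> carrier M} \<subseteq> carrier M" using I.Icarr by auto
    ultimately have "ideal_smult R I M \<subseteq> ?T I"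
      unfolding ideal_smult_def using submodule_gen(3)[OF modM _ sub[OF I(1)]] by blast
    then obtain a y where a: "a \<in> I" and y: "y \<in> ?N" and xay: "x = a \<odot>\<^bsub>M\<^esub> x \<oplus>\<^bsub>M\<^esub> y"
      using eq xM by blast
    have aR: "a \<in> carrier R" and yM: "y \<in> carrier M" using I.Icarr[OF a] y NM by auto
    obtain u where u: "u \<in> carrier R" "u \<otimes>\<^bsub>R\<^esub> (\<one>\<^bsub>R\<^esub> \<ominus>\<^bsub>R\<^esub> a) = \<one>\<^bsub>R\<^esub>"
      using local_ring_one_minus_unit[OF local] a I(2) by blast
    have "(\<one>\<^bsub>R\<^esub> \<ominus>\<^bsub>R\<^esub> a) \<odot>\<^bsub>M\<^esub> x = x \<oplus>\<^bsub>M\<^esub> \<ominus>\<^bsub>M\<^esub> (a \<odot>\<^bsub>M\<^esub> x)"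
      using aR xM by (simp add: a_minus_def M.smult_l_distr M.smult_l_minus)
    also have "\<dots> = (a \<odot>\<^bsub>M\<^esub> x \<oplus>\<^bsub>M\<^esub> y) \<oplus>\<^bsub>M\<^esub> \<ominus>\<^bsub>M\<^esub> (a \<odot>\<^bsub>M\<^esub> x)"
      using xay by simp
    also have "\<dots> = y \<oplus>\<^bsub>M\<^esub> (a \<odot>\<^bsub>M\<^esub> x \<oplus>\<^bsub>M\<^esub> \<ominus>\<^bsub>M\<^esub> (a \<odot>\<^bsub>M\<^esub> x))"
      using aR xM yM by (simp add: M.add.m_ac)
    also have "\<dots> = y" using aR xM yM by (simp add: M.r_neg)
    finally have "x = u \<odot>\<^bsub>M\<^esub> y"
      using M.smult_assoc1[of u "\<one>\<^bsub>R\<^esub> \<ominus>\<^bsub>R\<^esub> a" x] u aR xM by simp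
    then have "x \<in> ?N" using M.submoduleE(4)[OF N(1) u(1) y] by simp
    then have "A \<subseteq> ?N" using AB N(2) by blast
    then have "?N = carrier M" using submodule_gen(3)[OF modM A(3) N(1)] A(4) NM by blast
    then have "?G (card B)" using B by blast
    then show ?thesis using least[OF Bn] by blast
  qed
qed

text \<open>
  The first entry of a regular sequence acts on the quotient of \<open>M\<close> by the submodule coming from the
  empty sequence, which is zero.
\<close>

lemma depth_nonzerodivisor:
  assumes M: "module R M" "\<not> zero_module M" and depth: "depth R \<mm> M \<ge> 1"
  obtains x where "x \<in> \<mm>" "x \<in> carrier R" "nonzerodivisor_on M x"
proof -
  interpret M: module R M by fact
  have "\<exists>xs. set xs \<subseteq> \<mm> \<and> regular_sequence R M xs \<and> xs \<noteq> []"
  proof (rule ccontr)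
    assume no: "\<not> ?thesis"
    have "depth R \<mm> M \<le> 0"
      unfolding depth_def using M(2) no by (auto intro!: Sup_least simp: zero_enat_def)
    then show False using depth by simp
  qed
  then obtain xs where xs: "set xs \<subseteq> \<mm>" "regular_sequence R M xs" "xs \<noteq> []" by blast
  define K where "K = ideal_smult R (Idl\<^bsub>R\<^esub> {}) M"
  have "Idl\<^bsub>R\<^esub> {} \<subseteq> {\<zero>\<^bsub>R\<^esub>}" using M.R.genideal_minimal[OF M.R.zeroideal] by simp
  then have sub: "{a \<odot>\<^bsub>M\<^esub> x | a x. a \<in> Idl\<^bsub>R\<^esub> {} \<and> x \<in> carrier M} \<subseteq> {\<zero>\<^bsub>M\<^esub>}" by auto
  then have car: "{a \<odot>\<^bsub>M\<^esub> x | a x. a \<in> Idl\<^bsub>R\<^esub> {} \<and> x \<in> carrier M} \<subseteq> carrier M"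
    by (rule subset_trans) simp
  have K: "submodule K R M" "K \<subseteq> {\<zero>\<^bsub>M\<^esub>}"
    unfolding K_def ideal_smult_def
    using submodule_gen[OF M(1) car] zero_submodule[OF M(1)] sub by auto
  have nzd: "nonzerodivisor_on (quotient_module M K) (xs ! 0)" and x: "xs ! 0 \<in> carrier R" "xs ! 0 \<in> \<mm>"
    using xs by (auto simp: regular_sequence_def K_def)
  note Q = quotient_module[OF M(1) K(1)]
  have "nonzerodivisor_on M (xs ! 0)"
    unfolding nonzerodivisor_on_def
  proof (intro ballI impI)
    fix y assume y: "y \<in> carrier M" "xs ! 0 \<odot>\<^bsub>M\<^esub> y = \<zero>\<^bsub>M\<^esub>"
    have "xs ! 0 \<odot>\<^bsub>quotient_module M K\<^esub> (K +>\<^bsub>M\<^esub> y) = K +>\<^bsub>M\<^esub> \<zero>\<^bsub>M\<^esub>"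
      using mod_homD(3)[OF Q(2) x(1) y(1)] y(2) by simp
    also have "\<dots> = \<zero>\<^bsub>quotient_module M K\<^esub>" by (rule mod_hom_zero[OF M(1) Q(1) Q(2)])
    finally have "K +>\<^bsub>M\<^esub> y = \<zero>\<^bsub>quotient_module M K\<^esub>"
      using nzd mod_homD(1)[OF Q(2) y(1)] unfolding nonzerodivisor_on_def by blast
    then show "y = \<zero>\<^bsub>M\<^esub>" using Q(3)[OF y(1)] K(2) by blast
  qed
  then show ?thesis using that x by blast
qed

lemma nonzerodivisor_power:
  assumes "module R M" "x \<in> carrier R" "nonzerodivisor_on M x" "y \<in> carrier M"
    and "(x [^]\<^bsub>R\<^esub> (n::nat)) \<odot>\<^bsub>M\<^esub> y = \<zero>\<^bsub>M\<^esub>"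
  shows "y = \<zero>\<^bsub>M\<^esub>"
  using assms(5)
proof (induction n)
  interpret M: module R M by fact
  case 0
  then show ?case using assms(4) by simp
next
  interpret M: module R M by fact
  case (Suc n)
  have "x \<odot>\<^bsub>M\<^esub> ((x [^]\<^bsub>R\<^esub> n) \<odot>\<^bsub>M\<^esub> y) = \<zero>\<^bsub>M\<^esub>"
    using Suc.prems assms(2,4) M.R.m_comm[of "x [^]\<^bsub>R\<^esub> n" x] by (simp add: M.smult_assoc1[symmetric])
  then have "(x [^]\<^bsub>R\<^esub> n) \<odot>\<^bsub>M\<^esub> y = \<zero>\<^bsub>M\<^esub>"
    using assms(2-4) by (auto simp: nonzerodivisor_on_def)
  then show ?case by (rule Suc.IH)
qed

text \<open>
  Over a finite local ring some power of each element of the maximal ideal repeats, hence is zero, and no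
  such element can be a nonzerodivisor on a nonzero module.
\<close>

lemma infinite_ring_of_nonzerodivisor:
  assumes local: "noetherian_local_ring R \<mm>" and M: "module R M" "\<not> zero_module M"
    and x: "x \<in> \<mm>" "x \<in> carrier R" "nonzerodivisor_on M x"
  shows "infinite (carrier R)"
proof
  assume fin: "finite (carrier R)"
  interpret M: module R M by fact
  have "maximalideal \<mm> R" using local by (simp add: noetherian_local_ring_def)
  then interpret \<mm>: maximalideal \<mm> R .
  have "\<not> inj (\<lambda>n::nat. x [^]\<^bsub>R\<^esub> n)"
    using fin x(2) finite_subset[of "range (\<lambda>n::nat. x [^]\<^bsub>R\<^esub> n)" "carrier R"] range_inj_infinite by blast
  then obtain i j :: nat where ij: "i < j" "x [^]\<^bsub>R\<^esub> i = x [^]\<^bsub>R\<^esub> j"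
    unfolding inj_on_def by (metis linorder_neqE_nat)
  define y where "y = x [^]\<^bsub>R\<^esub> (j - i)"
  have yR: "y \<in> carrier R" using x(2) by (simp add: y_def)
  have "y = x [^]\<^bsub>R\<^esub> (j - i - 1) \<otimes>\<^bsub>R\<^esub> x"
    unfolding M.R.nat_pow_Suc[symmetric] y_def using ij(1) by (simp add: Suc_diff_Suc)
  then have "y \<in> \<mm>" using \<mm>.I_l_closed[OF x(1)] x(2) by simp
  then obtain u where u: "u \<in> carrier R" "u \<otimes>\<^bsub>R\<^esub> (\<one>\<^bsub>R\<^esub> \<ominus>\<^bsub>R\<^esub> y) = \<one>\<^bsub>R\<^esub>"
    using local_ring_one_minus_unit[OF local] by blast
  let ?p = "x [^]\<^bsub>R\<^esub> i"
  have p: "?p \<in> carrier R" using x(2) by simp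
  have "?p \<otimes>\<^bsub>R\<^esub> y = ?p"
    using M.R.nat_pow_mult[OF x(2), of i "j - i"] ij by (simp add: y_def)
  then have "?p \<otimes>\<^bsub>R\<^esub> (\<one>\<^bsub>R\<^esub> \<ominus>\<^bsub>R\<^esub> y) = \<zero>\<^bsub>R\<^esub>"
    using p yR by (simp add: a_minus_def M.R.r_distr M.R.r_minus M.R.r_neg)
  then have "?p \<otimes>\<^bsub>R\<^esub> (u \<otimes>\<^bsub>R\<^esub> (\<one>\<^bsub>R\<^esub> \<ominus>\<^bsub>R\<^esub> y)) = \<zero>\<^bsub>R\<^esub>"
    using p u(1) yR M.R.m_lcomm[of ?p u "\<one>\<^bsub>R\<^esub> \<ominus>\<^bsub>R\<^esub> y"] by simp
  then have "?p = \<zero>\<^bsub>R\<^esub>" using p by (simp add: u(2))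
  then have "z = \<zero>\<^bsub>M\<^esub>" if "z \<in> carrier M" for z
    using nonzerodivisor_power[OF M(1) x(2,3) that, of i] that by simp
  then show False using M(2) by (auto simp: zero_module_def)
qed

section \<open>The first local cohomology of a tensor product with a primary ideal\<close>

theorem proposition4p1:
  fixes R :: "('a, 'r) ring_scheme"
    and \<mm> I :: "'a set"
    and M :: "('a, 'b, 's) module_scheme"
  assumes local: "noetherian_local_ring R \<mm>"
    and depth_R: "depth R \<mm> (self_module R) \<ge> 1"
    and primary: "primary_ideal R I" "radical R I = \<mm>"
    and rigid: "\<And>(X :: ('a, 'a tree) module) (t :: nat).
        fin_gen_module R X \<Longrightarrow>
        zero_module (Tor R t X (quotient_module (self_module R) I)) \<Longrightarrow>
        proj_dim R X < ereal (real t)"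
    and M: "fin_gen_module R M" "\<not> zero_module M"
    and M_free: "locally_free_on_punctured_spectrum R \<mm> M"
    and depth_M: "depth R \<mm> M \<ge> 1"
  shows "\<not> zero_module (local_cohomology R \<mm> 1 (tensor_product R M (ideal_module R I)))"
proof
  assume zero: "zero_module (local_cohomology R \<mm> 1 (tensor_product R M (ideal_module R I)))"
  have cR: "cring R" and nR: "noetherian_ring R" and \<mm>: "ideal \<mm> R"
    using local maximalideal.axioms(1) by (auto simp: noetherian_local_ring_def)
  have I: "ideal I R" using primary(1) by (simp add: primary_ideal_def)
  have modM: "module R M" using M(1) by (simp add: fin_gen_module_def)
  have modI: "module R (ideal_module R I)" by (rule ideal_module[OF cR I])
  interpret M: module R M by fact
  interpret I: ideal I R by fact
  let ?N = "tensor_product R M (ideal_module R I)"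
  have modN: "module R ?N" by (rule tensor_product_module[OF modM modI])
  have "a \<in> radical R I" if a: "a \<in> I" for a
  proof -
    have "a [^]\<^bsub>R\<^esub> (1::nat) \<in> I" using a I.Icarr[OF a] by simp
    then show ?thesis using I.Icarr[OF a] unfolding radical_def by blast
  qed
  then have I\<mm>: "I \<subseteq> \<mm>" using primary(2) by blast
  obtain n :: nat where n: "\<mm> [^]\<^bsub>ideals_set R\<^esub> n \<subseteq> I"
    using noetherian_power_subset[OF cR nR I \<mm>] primary(2) by blast
  obtain x where x: "x \<in> \<mm>" "x \<in> carrier R" "nonzerodivisor_on M x"
    using depth_nonzerodivisor[OF modM M(2) depth_M] .
  have "infinite (carrier R)" by (rule infinite_ring_of_nonzerodivisor[OF local modM M(2) x])
  then have inf: "infinite (UNIV :: 'a set)" using finite_subset subset_UNIV by blast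
  \<comment> \<open>Elements of the tensor product are sets of functions, and the constant ones form a copy of \<open>'a\<close>.\<close>
  have emb: "inj (\<lambda>a (p :: 'b \<times> 'a). a)" by (auto simp: inj_on_def fun_eq_iff)
  then have "infinite (UNIV :: ('b \<times> 'a \<Rightarrow> 'a) set)" using inf finite_imageD finite_subset subset_UNIV by blast
  then obtain F :: "('a \<Rightarrow> ('a + ('b \<times> 'a \<Rightarrow> 'a) set) tree) \<Rightarrow> ('a + ('b \<times> 'a \<Rightarrow> 'a) set) tree" where F: "inj F"
    using tree_type_absorbs_functions[OF _ emb] by blast
  have gen: "{a \<odot>\<^bsub>M\<^esub> z | a z. a \<in> I \<and> z \<in> carrier M} \<subseteq> carrier M" using I.Icarr by auto
  note IM = submodule_gen[OF modM gen, folded ideal_smult_def]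
  \<comment> \<open>The multiplication map takes values in \<open>I M\<close>; choosing that as the target records the fact.\<close>
  let ?P = "M\<lparr>carrier := ideal_smult R I M\<rparr>"
  have modP: "module R ?P" by (rule submodule.submodule_is_module[OF IM(1) modM])
  have in_IM: "a \<odot>\<^bsub>M\<^esub> z \<in> ideal_smult R I M" if "a \<in> I" "z \<in> carrier M" for a z
    using IM(2) that by blast
  obtain \<phi> where \<phi>: "\<phi> \<in> mod_hom R ?N ?P"
    and \<phi>_pure: "\<And>z a. z \<in> carrier M \<Longrightarrow> a \<in> I \<Longrightarrow> \<phi> (pure_tensor R M (ideal_module R I) z a) = a \<odot>\<^bsub>M\<^esub> z"
  proof (rule tensor_product_lift[OF modM modI modP, of "\<lambda>z a. a \<odot>\<^bsub>M\<^esub> z"])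
    show "(\<lambda>z. a \<odot>\<^bsub>M\<^esub> z) \<in> mod_hom R M ?P" if "a \<in> carrier (ideal_module R I)" for a
      using that I.Icarr M.R.m_comm
      by (intro mod_homI) (auto simp: ideal_module_simps in_IM M.smult_r_distr M.smult_assoc1[symmetric])
    show "(\<lambda>a. a \<odot>\<^bsub>M\<^esub> z) \<in> mod_hom R (ideal_module R I) ?P" if "z \<in> carrier M" for z
      using that I.Icarr by (intro mod_homI) (auto simp: ideal_module_simps in_IM M.smult_l_distr M.smult_assoc1)
  qed (auto simp: ideal_module_simps)
  have "ideal_smult R I M \<noteq> carrier M" using nakayama[OF local M(1) I I\<mm>] M(2) by blast
  then obtain y where y: "y \<in> carrier M" "y \<notin> ideal_smult R I M" using M.submoduleE(1)[OF IM(1)] by blast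
  obtain w k where w: "w \<in> carrier ?N"
    and wk: "\<And>a. a \<in> \<mm> [^]\<^bsub>ideals_set R\<^esub> (k::nat) \<Longrightarrow>
      a \<in> I \<and> pure_tensor R M (ideal_module R I) y a = a \<odot>\<^bsub>?N\<^esub> w"
    using local_cohomology_1_zero_extends[OF modN F \<mm> I n pure_tensor_right_linear[OF modM modI y(1)] zero]
    by blast
  have \<phi>w: "\<phi> w \<in> ideal_smult R I M" "\<phi> w \<in> carrier M"
    using mod_homD(1)[OF \<phi> w] M.submoduleE(1)[OF IM(1)] by auto
  have xk: "x [^]\<^bsub>R\<^esub> k \<in> \<mm> [^]\<^bsub>ideals_set R\<^esub> k"
  proof (induction k)
    case 0
    then show ?case by (simp add: ideals_set_def nat_pow_def)
  next
    case (Suc k)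
    then show ?case using x(1) by (auto simp: ideals_set_def nat_pow_def intro: ideal_prod.prod)
  qed
  \<comment> \<open>The single scalar \<open>x\<^sup>k\<close> suffices: it acts injectively on \<open>M\<close>, so it can be cancelled from \<open>x\<^sup>k y = x\<^sup>k \<phi>(w)\<close>.\<close>
  let ?a = "x [^]\<^bsub>R\<^esub> k"
  have a: "?a \<in> carrier R" using x(2) by simp
  have "?a \<odot>\<^bsub>M\<^esub> y = \<phi> (?a \<odot>\<^bsub>?N\<^esub> w)" using wk[OF xk] \<phi>_pure[OF y(1)] by metis
  also have "\<dots> = ?a \<odot>\<^bsub>M\<^esub> \<phi> w" using mod_homD(3)[OF \<phi> a w] by simp
  finally have "?a \<odot>\<^bsub>M\<^esub> (y \<ominus>\<^bsub>M\<^esub> \<phi> w) = \<zero>\<^bsub>M\<^esub>"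
    using a y(1) \<phi>w(2) by (simp add: a_minus_def M.smult_r_distr M.smult_r_minus M.r_neg)
  then have "y \<ominus>\<^bsub>M\<^esub> \<phi> w = \<zero>\<^bsub>M\<^esub>"
    using nonzerodivisor_power[OF modM x(2,3)] y(1) \<phi>w(2) by blast
  then show False using M.minus_eq_zero_iff[OF y(1) \<phi>w(2)] y(2) \<phi>w(1) by simp
qed

end
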